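(* Let $k\ge 2$ be an even integer and let $H$ be a graph. Then there exists some $\delta>0$ such that $\mathrm{ex}(n,H^{k-1})=O(n^{1+2/k-\delta})$ as $n\to\infty$.
   Context: For a graph $F$, $\mathrm{ex}(n,F)$ is the maximum number of edges in an $n$-vertex graph containing no copy of $F$ as a subgraph. $H^{k-1}$ is the $(k-1)$-subdivision of $H$, i.e. the graph obtained by replacing the edges of $H$ by internally disjoint paths of length $k$. $H$ is a fixed finite simple graph (not necessarily bipartite), and the implied constant may depend on $H$ and $k$. *)

theory Defs
  imports Complex_Main "HOL-Library.Landau_Symbols"
begin

text \<open>A graph is a pair of its vertex set and its edge set, edges being two-element sets of
  vertices.\<close>

type_synonym 'a graph = "'a set \<times> 'a set set"

abbreviation verts :: "'a graph \<Rightarrow> 'a set" where "verts \<equiv> fst"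
abbreviation edges :: "'a graph \<Rightarrow> 'a set set" where "edges \<equiv> snd"

definition simple_graph :: "'a graph \<Rightarrow> bool" where
  "simple_graph G \<longleftrightarrow> finite (verts G) \<and> (\<forall>e\<in>edges G. e \<subseteq> verts G \<and> card e = 2)"

text \<open>Containment is as a not necessarily induced subgraph.\<close>

definition contains_copy :: "'a graph \<Rightarrow> 'b graph \<Rightarrow> bool" where
  "contains_copy G F \<longleftrightarrow>
    (\<exists>f. inj_on f (verts F) \<and> f ` verts F \<subseteq> verts G \<and> (\<forall>e\<in>edges F. f ` e \<in> edges G))"

text \<open>Up to isomorphism every finite graph has its vertices in \<^typ>\<open>nat\<close>. The supremum is a
  maximum (see \<open>finite_F_free_sizes\<close> below) unless no \<open>n\<close>-vertex graph is \<open>F\<close>-free, which for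
  large \<open>n\<close> happens only if \<open>F\<close> has no edges; its value is then \<open>0\<close>.\<close>

definition F_free_sizes :: "nat \<Rightarrow> 'b graph \<Rightarrow> nat set" where
  "F_free_sizes n F =
    {card (edges G) | G :: nat graph.
       simple_graph G \<and> card (verts G) = n \<and> \<not> contains_copy G F}"

definition ex :: "nat \<Rightarrow> 'b graph \<Rightarrow> nat" where
  "ex n F = Sup (F_free_sizes n F)"

text \<open>The \<open>m\<close>-subdivision replaces each edge \<open>e\<close> by a path
  \<open>path_vertex m e 0, \<dots>, path_vertex m e (m + 1)\<close> of length \<open>m + 1\<close>, whose \<open>m\<close> internal vertices
  \<open>Inr (e, 1), \<dots>, Inr (e, m)\<close> are new and belong to \<open>e\<close> only. The direction in which the path
  traverses \<open>e\<close> is an arbitrary choice that does not affect the isomorphism type.\<close>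

definition ends :: "'a set \<Rightarrow> 'a \<times> 'a" where
  "ends e = (SOME p. e = {fst p, snd p})"

definition path_vertex :: "nat \<Rightarrow> 'a set \<Rightarrow> nat \<Rightarrow> 'a + 'a set \<times> nat" where
  "path_vertex m e i =
    (if i = 0 then Inl (fst (ends e))
     else if i = m + 1 then Inl (snd (ends e))
     else Inr (e, i))"

definition subdivision :: "nat \<Rightarrow> 'a graph \<Rightarrow> ('a + 'a set \<times> nat) graph" where
  "subdivision m H =
    (Inl ` verts H \<union> Inr ` (edges H \<times> {1..m}),
     {{path_vertex m e i, path_vertex m e (i + 1)} | e i. e \<in> edges H \<and> i \<le> m})"

lemma finite_edges:
  assumes "simple_graph G"
  shows "finite (edges G)"
  using assms finite_subset[of "edges G" "Pow (verts G)"]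
  by (auto simp: simple_graph_def)

lemma finite_F_free_sizes: "finite (F_free_sizes n F)"
proof (rule finite_subset)
  show "F_free_sizes n F \<subseteq> {..2 ^ n}"
  proof
    fix x assume "x \<in> F_free_sizes n F"
    then obtain G :: "nat graph"
      where G: "simple_graph G" "card (verts G) = n" and x: "x = card (edges G)"
      by (auto simp: F_free_sizes_def)
    have "card (edges G) \<le> card (Pow (verts G))"
      using G(1) by (intro card_mono) (auto simp: simple_graph_def)
    also have "\<dots> = 2 ^ n"
      using G by (simp add: card_Pow simple_graph_def)
    finally show "x \<in> {..2 ^ n}" using x by simp
  qed
qed simp

lemma ends_eq:
  assumes "card e = 2"
  shows "{fst (ends e), snd (ends e)} = e" "fst (ends e) \<noteq> snd (ends e)"
proof -
  from assms obtain u v where "e = {u, v}" by (auto simp: card_2_iff)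
  then have "e = {fst (u, v), snd (u, v)}" by simp
  then have "e = {fst (ends e), snd (ends e)}"
    unfolding ends_def by (rule someI)
  then show *: "{fst (ends e), snd (ends e)} = e" by simp
  show "fst (ends e) \<noteq> snd (ends e)"
  proof
    assume "fst (ends e) = snd (ends e)"
    then have "e = {snd (ends e)}" using * by simp
    then have "card e = card {snd (ends e)}" by (rule arg_cong)
    then show False using assms by simp
  qed
qed

lemma simple_graph_subdivision:
  assumes "simple_graph H"
  shows "simple_graph (subdivision m H)"
proof -
  have fin: "finite (edges H)" using assms by (rule finite_edges)
  have "path_vertex m e i \<in> verts (subdivision m H)" if "e \<in> edges H" "i \<le> m + 1" for e i
  proof -
    have "card e = 2" "e \<subseteq> verts H" using assms that by (auto simp: simple_graph_def)
    then have "fst (ends e) \<in> verts H" "snd (ends e) \<in> verts H"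
      using ends_eq(1)[of e] by blast+
    then show ?thesis using that by (auto simp: subdivision_def path_vertex_def)
  qed
  note inV = this
  have neq: "path_vertex m e i \<noteq> path_vertex m e (i + 1)" if "e \<in> edges H" for e i
    using assms that ends_eq(2)[of e] by (auto simp: simple_graph_def path_vertex_def)
  have "f \<subseteq> verts (subdivision m H) \<and> card f = 2"
    if "f \<in> edges (subdivision m H)" for f
  proof -
    from that obtain e i where e: "e \<in> edges H" "i \<le> m"
      and f: "f = {path_vertex m e i, path_vertex m e (i + 1)}"
      by (auto simp: subdivision_def)
    then show ?thesis
      using inV[of e i] inV[of e "i + 1"] neq[of e i] by simp
  qed
  moreover have "finite (verts (subdivision m H))"
    using assms fin by (simp add: subdivision_def simple_graph_def)
  ultimately show ?thesis by (simp add: simple_graph_def)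
qed

end

theory Submission
  imports Defs "HOL-Library.Sublist"
begin

text \<open>
  Write \<open>k = 2 l\<close>. Call \<open>x\<close> and \<open>y\<close> robustly connected by paths of length \<open>n\<close> if such a path can be
  chosen so that it avoids any prescribed bounded set of inner vertices. Sufficiently many vertices
  that are pairwise robustly connected by paths of length \<open>2 l\<close> give a copy of the subdivision, greedily.

  After passing to an almost regular subgraph of degree about \<open>d \<ge> m powr (1 / l - \<delta>)\<close> on \<open>m\<close> vertices,
  call a path heavy if there are many paths of the same length between its ends while all its proper
  subpaths have only boundedly many. Heavy paths have robustly connected ends.

  If for every \<open>j \<le> l\<close> few paths of length \<open>j\<close> are heavy, then the paths of length \<open>l\<close> join at least
  \<open>m powr (2 - o(1))\<close> pairs of vertices, with one path fixed for each pair. One then finds a bounded set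
  \<open>U\<close> having so many common partners \<open>v\<close>, with the paths from \<open>U\<close> to \<open>v\<close> disjoint outside \<open>v\<close>, that
  two such half-paths joined at \<open>v\<close> can avoid any bounded set.

  Otherwise a positive proportion of the paths of some length \<open>j\<close> is heavy, where \<open>2 \<le> j \<le> l\<close>. Around
  some vertex \<open>z\<close>, many legs of length \<open>j - 1\<close> and many neighbours \<open>c\<close> of \<open>z\<close> pairwise form heavy paths.
  Hence a vertex on a leg, at distance \<open>a\<close> from its far end, is robustly connected to each \<open>c\<close> by paths of
  length \<open>a + j\<close>, and, zigzagging between far ends and neighbours, of length \<open>a + (2 s + 1) j\<close>. Writing
  \<open>l = q j - e\<close> with \<open>1 \<le> e \<le> j\<close>, the choice \<open>a = j - e\<close> works if \<open>e \<ge> 2\<close>. If \<open>e = 1\<close>, this choice would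
  leave only the vertex \<open>z\<close> itself, and one uses hubs: vertices reached by robustly disjoint tails of
  some length \<open>0 < g < j\<close> from different neighbours \<open>c\<close>; then \<open>a = j - 1 - g\<close> gives the same total length.
  Few hubs would leave boundedly many tails of each length \<open>g < j\<close> to every other vertex, and then
  there would be too few alternatives for the heavy paths at \<open>z\<close>.
\<close>

section \<open>Robust connections and embedding a subdivision\<close>

definition walk :: "('a \<times> 'a) set \<Rightarrow> 'a list \<Rightarrow> bool" where
  "walk E p \<longleftrightarrow> (\<forall>i. Suc i < length p \<longrightarrow> (p ! i, p ! Suc i) \<in> E)"

definition paths :: "('a \<times> 'a) set \<Rightarrow> 'a list set" where
  "paths E = {p. p \<noteq> [] \<and> distinct p \<and> walk E p}"

text \<open>The number \<open>n\<close> counts edges, hence \<open>Suc n\<close> entries. The set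
  \<open>S\<close> is a parameter so that one notation serves for all paths and for the light ones
  among them.\<close>

definition joining :: "'a list set \<Rightarrow> nat \<Rightarrow> 'a \<Rightarrow> 'a \<Rightarrow> 'a list set" where
  "joining S n x y = {p \<in> S. length p = Suc n \<and> hd p = x \<and> last p = y}"

text \<open>The ends are exempt from avoidance, so \<open>Z\<close> may contain them. This allows
  one to forbid all branch vertices at once.\<close>

definition robust :: "('a \<times> 'a) set \<Rightarrow> nat \<Rightarrow> nat \<Rightarrow> 'a \<Rightarrow> 'a \<Rightarrow> bool" where
  "robust E M n x y \<longleftrightarrow>
     (\<forall>Z. finite Z \<and> card Z \<le> M \<longrightarrow> (\<exists>p\<in>joining (paths E) n x y. set p \<inter> Z \<subseteq> {x, y}))"

lemma walk_sublist: "walk E p \<Longrightarrow> sublist q p \<Longrightarrow> walk E q"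
proof -
  assume w: "walk E p" and "sublist q p"
  then obtain ps ss where p: "p = ps @ q @ ss" by (auto simp: sublist_def)
  show "walk E q"
    unfolding walk_def
  proof (intro allI impI)
    fix i assume i: "Suc i < length q"
    then have "(p ! (length ps + i), p ! Suc (length ps + i)) \<in> E"
      using w p unfolding walk_def by (metis add_Suc_right add_less_cancel_left length_append trans_less_add1)
    moreover have "p ! (length ps + i) = q ! i" "p ! Suc (length ps + i) = q ! Suc i"
      using i p by (simp_all add: nth_append)
    ultimately show "(q ! i, q ! Suc i) \<in> E" by simp
  qed
qed

lemma distinct_sublist: "distinct p \<Longrightarrow> sublist q p \<Longrightarrow> distinct q"
  by (auto simp: sublist_def)

lemma paths_sublist: "p \<in> paths E \<Longrightarrow> sublist q p \<Longrightarrow> q \<noteq> [] \<Longrightarrow> q \<in> paths E"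
  by (auto simp: paths_def intro: walk_sublist distinct_sublist)

lemma walk_append:
  assumes "walk E p" "walk E q" "p \<noteq> []" "q \<noteq> []" "last p = hd q"
  shows "walk E (p @ tl q)"
  unfolding walk_def
proof (intro allI impI)
  fix i assume i: "Suc i < length (p @ tl q)"
  consider "Suc i < length p" | "Suc i = length p" | "length p \<le> i" by linarith
  then show "((p @ tl q) ! i, (p @ tl q) ! Suc i) \<in> E"
  proof cases
    case 1
    then show ?thesis using assms(1) by (auto simp: walk_def nth_append)
  next
    case 2
    then have "p ! i = q ! 0"
      using assms by (metis diff_Suc_1 hd_conv_nth last_conv_nth)
    moreover have "Suc 0 < length q" using i 2 assms by auto
    ultimately show ?thesis using assms(2) 2 by (auto simp: walk_def nth_append nth_tl)
  next
    case 3
    define j where "j = i - length p"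
    have "i = length p + j" using 3 j_def by simp
    moreover have "Suc (Suc j) < length q" using i calculation by auto
    ultimately show ?thesis using assms(2) by (auto simp: walk_def nth_append nth_tl)
  qed
qed

lemma walk_rev: "sym E \<Longrightarrow> walk E p \<Longrightarrow> walk E (rev p)"
  unfolding walk_def
proof (intro allI impI)
  fix i assume s: "sym E" and w: "\<forall>i. Suc i < length p \<longrightarrow> (p ! i, p ! Suc i) \<in> E"
    and i: "Suc i < length (rev p)"
  define j where "j = length p - Suc (Suc i)"
  have j: "rev p ! i = p ! Suc j" "rev p ! Suc i = p ! j" "Suc j < length p"
    using i by (auto simp: rev_nth j_def Suc_diff_Suc)
  then show "(rev p ! i, rev p ! Suc i) \<in> E"
    using w s by (auto dest: symD)
qed

lemma joining_paths_rev:
  assumes "sym E" "p \<in> joining (paths E) n x y"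
  shows "rev p \<in> joining (paths E) n y x"
  using assms walk_rev[of E p] by (auto simp: joining_def paths_def hd_rev last_rev)

lemma joining_paths_append:
  assumes p: "p \<in> joining (paths E) n x w" and q: "q \<in> joining (paths E) n' w y"
    and dj: "set p \<inter> set q \<subseteq> {w}"
  shows "p @ tl q \<in> joining (paths E) (n + n') x y"
proof -
  have 1: "p \<noteq> []" "q \<noteq> []" "last p = hd q" "hd q = w" "last q = y" "hd p = x"
    "length p = Suc n" "length q = Suc n'" "distinct p" "distinct q" "walk E p" "walk E q"
    using p q by (auto simp: joining_def paths_def)
  have "w \<notin> set (tl q)" using 1 by (metis distinct.simps(2) list.collapse)
  then have "set p \<inter> set (tl q) = {}" using dj 1(2) by (auto dest: list.set_sel(2))
  then have "distinct (p @ tl q)" using 1 by (simp add: distinct_tl)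
  moreover have "walk E (p @ tl q)" using 1 walk_append by blast
  moreover have "last (p @ tl q) = y"
    using 1 by (cases q) auto
  ultimately show ?thesis using 1 by (auto simp: joining_def paths_def)
qed

lemma robust_sym: "sym E \<Longrightarrow> robust E M n x y \<Longrightarrow> robust E M n y x"
  unfolding robust_def by (metis insert_commute joining_paths_rev set_rev)

lemma robust_mono: "robust E M n x y \<Longrightarrow> M' \<le> M \<Longrightarrow> robust E M' n x y"
  unfolding robust_def by (meson le_trans)

lemma joining_paths_card: "p \<in> joining (paths E) n x y \<Longrightarrow> card (set p) = Suc n"
  by (auto simp: joining_def paths_def distinct_card)

lemma joining_ends: "p \<in> joining (paths E) n x y \<Longrightarrow> x \<in> set p \<and> y \<in> set p"
  by (auto simp: joining_def paths_def)

text \<open>The final segment \<open>q\<close> is fixed first, away from \<open>Z\<close> and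
  \<open>x\<close>; the robust connection from \<open>x\<close> to the start of \<open>q\<close>
  then avoids both \<open>Z\<close> and \<open>q\<close>. The summand \<open>n' + 1\<close> pays for
  the vertices of \<open>q\<close>, and \<open>Suc M\<close> leaves room for forbidding
  \<open>x\<close>.\<close>

lemma robust_extend:
  assumes "x \<noteq> y" and M': "M + n' + 1 \<le> M'"
    and ex: "\<And>Z. finite Z \<Longrightarrow> card Z \<le> Suc M \<Longrightarrow>
      \<exists>w q. q \<in> joining (paths E) n' w y \<and> set q \<inter> Z \<subseteq> {y} \<and> robust E M' n x w"
  shows "robust E M (n + n') x y"
  unfolding robust_def
proof (intro allI impI)
  fix Z :: "'a set" assume Z: "finite Z \<and> card Z \<le> M"
  have "card (insert x Z) \<le> Suc M" using Z by (simp add: card_insert_if)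
  then obtain w q where q: "q \<in> joining (paths E) n' w y" "set q \<inter> insert x Z \<subseteq> {y}"
    and r: "robust E M' n x w"
    using ex[of "insert x Z"] Z by auto
  have "card (Z \<union> set q) \<le> M'"
    using card_Un_le[of Z "set q"] joining_paths_card[OF q(1)] Z M' by linarith
  then obtain p where p: "p \<in> joining (paths E) n x w" "set p \<inter> (Z \<union> set q) \<subseteq> {x, w}"
    using r Z unfolding robust_def by (metis List.finite_set finite_Un)
  have "x \<notin> set q" using q(2) assms(1) by auto
  then have "p @ tl q \<in> joining (paths E) (n + n') x y"
    using p q by (intro joining_paths_append) auto
  moreover have "set (p @ tl q) \<inter> Z \<subseteq> {x, y}"
  proof -
    have "set (p @ tl q) \<subseteq> set p \<union> set q"
      by (cases q) auto
    moreover have "w \<in> set q" using q(1) joining_ends by fast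
    ultimately show ?thesis using p(2) q(2) by auto
  qed
  ultimately show "\<exists>p\<in>joining (paths E) (n + n') x y. set p \<inter> Z \<subseteq> {x, y}" by blast
qed

text \<open>The final segment now comes from a robust connection as well, starting at a midpoint
  outside the forbidden set. That set has up to \<open>M + 1\<close> elements because
  \<open>robust_extend\<close> also forbids \<open>x\<close>.\<close>

lemma robust_trans:
  assumes "x \<noteq> y" and M': "M + n' + 2 \<le> M'"
    and ex: "\<And>Z. finite Z \<Longrightarrow> card Z \<le> M + 1 \<Longrightarrow>
      \<exists>w. w \<notin> Z \<and> robust E M' n x w \<and> robust E M' n' w y"
  shows "robust E M (n + n') x y"
proof (rule robust_extend[OF assms(1)])
  show "M + n' + 1 \<le> M'" using M' by simp
  fix Z :: "'a set" assume Z: "finite Z" "card Z \<le> Suc M"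
  then obtain w where w: "w \<notin> Z" "robust E M' n x w" "robust E M' n' w y"
    using ex[of Z] by auto
  moreover obtain q where "q \<in> joining (paths E) n' w y" "set q \<inter> Z \<subseteq> {w, y}"
  proof -
    have "card Z \<le> M'" using Z M' by linarith
    then show ?thesis using w(3) Z(1) that unfolding robust_def by blast
  qed
  ultimately show "\<exists>w q. q \<in> joining (paths E) n' w y \<and> set q \<inter> Z \<subseteq> {y} \<and> robust E M' n x w"
    by blast
qed

text \<open>Greedy choice: apart from its own ends, each new path avoids \<open>B\<close> and all
  earlier paths. These obstacles never number more than
  \<open>card B + card F * Suc k\<close>.\<close>

lemma robust_linkage:
  fixes s t :: "'e \<Rightarrow> 'a"
  assumes "finite F" "finite B"
    and "\<And>e. e \<in> F \<Longrightarrow> s e \<in> B \<and> t e \<in> B"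
    and r: "\<And>e. e \<in> F \<Longrightarrow> robust E M k (s e) (t e)"
    and M: "card B + card F * Suc k \<le> M"
  shows "\<exists>P. (\<forall>e\<in>F. P e \<in> joining (paths E) k (s e) (t e) \<and> set (P e) \<inter> B \<subseteq> {s e, t e}) \<and>
    (\<forall>e\<in>F. \<forall>e'\<in>F. e \<noteq> e' \<longrightarrow> set (P e) \<inter> set (P e') \<subseteq> B)"
  using assms(1,3,4,5)
proof (induction F)
  case empty
  then show ?case by simp
next
  case (insert e F)
  have "card B + card F * Suc k \<le> M" using insert by simp
  then obtain P where P: "\<And>e. e \<in> F \<Longrightarrow> P e \<in> joining (paths E) k (s e) (t e) \<and> set (P e) \<inter> B \<subseteq> {s e, t e}"
    "\<And>e e'. e \<in> F \<Longrightarrow> e' \<in> F \<Longrightarrow> e \<noteq> e' \<Longrightarrow> set (P e) \<inter> set (P e') \<subseteq> B"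
    using insert.IH insert.prems by (metis (no_types, lifting) insertI2)
  define Z where "Z = B \<union> (\<Union>e\<in>F. set (P e))"
  have "card (\<Union>e\<in>F. set (P e)) \<le> (\<Sum>e\<in>F. card (set (P e)))"
    by (rule card_UN_le) (use insert in auto)
  also have "\<dots> = card F * Suc k"
  proof -
    have "card (set (P e)) = Suc k" if "e \<in> F" for e
      using P(1)[OF that] by (auto dest: joining_paths_card)
    then show ?thesis by simp
  qed
  finally have "card Z \<le> M"
    using card_Un_le[of B "\<Union>e\<in>F. set (P e)"] insert unfolding Z_def by simp
  moreover have "finite Z" using insert assms(2) by (auto simp: Z_def)
  ultimately obtain p where p: "p \<in> joining (paths E) k (s e) (t e)" "set p \<inter> Z \<subseteq> {s e, t e}"
    using insert.prems(2)[of e] unfolding robust_def by (metis insertI1)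
  have se: "s e \<in> B" "t e \<in> B" using insert.prems(1)[of e] by auto
  show ?case
  proof (intro exI[of _ "P(e := p)"] conjI ballI impI)
    fix e1 assume "e1 \<in> insert e F"
    then show "(P(e := p)) e1 \<in> joining (paths E) k (s e1) (t e1)"
      "set ((P(e := p)) e1) \<inter> B \<subseteq> {s e1, t e1}"
      using P(1) p insert.hyps unfolding Z_def by auto
  next
    fix e1 e2 assume "e1 \<in> insert e F" "e2 \<in> insert e F" "e1 \<noteq> e2"
    note e = this
    have pe: "set p \<inter> set (P e') \<subseteq> B" if "e' \<in> F" for e'
      using p(2) se that unfolding Z_def by auto
    show "set ((P(e := p)) e1) \<inter> set ((P(e := p)) e2) \<subseteq> B"
    proof (cases "e1 = e \<or> e2 = e")
      case True
      then show ?thesis using e pe[of e1] pe[of e2] by auto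
    next
      case False
      then show ?thesis using P(2)[of e1 e2] e by simp
    qed
  qed
qed


section \<open>From pairwise robustly connected vertices to a copy of the subdivision\<close>

definition arcs :: "'a graph \<Rightarrow> ('a \<times> 'a) set" where
  "arcs G = {(x, y). {x, y} \<in> edges G}"

text \<open>Branch vertices are placed by \<open>\<phi>\<close>, and the inner vertices of an edge
  on its linking path, which is oriented as \<open>ends\<close> prescribes. The map is injective
  because inner vertices of the paths miss \<open>B\<close> and two different paths share only
  elements of \<open>B\<close>.\<close>

lemma contains_subdivision:
  fixes G :: "'a graph" and H :: "'b graph"
  assumes H: "simple_graph H" and k: "0 < k"
    and \<phi>: "inj_on \<phi> (verts H)" "\<phi> ` verts H \<subseteq> verts G"
    and G: "simple_graph G"
    and r: "\<And>x y. x \<in> verts H \<Longrightarrow> y \<in> verts H \<Longrightarrow> x \<noteq> y \<Longrightarrow> robust (arcs G) M k (\<phi> x) (\<phi> y)"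
    and M: "card (verts H) + card (edges H) * Suc k \<le> M"
  shows "contains_copy G (subdivision (k - 1) H)"
proof -
  define s where "s e = fst (ends e)" for e :: "'b set"
  define t where "t e = snd (ends e)" for e :: "'b set"
  define B where "B = \<phi> ` verts H"
  have fin: "finite (verts H)" "finite (edges H)"
    using H finite_edges[OF H] by (auto simp: simple_graph_def)
  have st: "s e \<in> verts H" "t e \<in> verts H" "s e \<noteq> t e" if "e \<in> edges H" for e
    using that H ends_eq[of e] unfolding simple_graph_def s_def t_def by blast+
  have "card B = card (verts H)" unfolding B_def by (simp add: card_image \<phi>)
  have "\<exists>P. (\<forall>e\<in>edges H. P e \<in> joining (paths (arcs G)) k (\<phi> (s e)) (\<phi> (t e)) \<and>
      set (P e) \<inter> B \<subseteq> {\<phi> (s e), \<phi> (t e)}) \<and>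
    (\<forall>e\<in>edges H. \<forall>e'\<in>edges H. e \<noteq> e' \<longrightarrow> set (P e) \<inter> set (P e') \<subseteq> B)"
  proof (rule robust_linkage[where M = M])
    show "finite (edges H)" "finite B" using fin by (simp_all add: B_def)
    show "card B + card (edges H) * Suc k \<le> M" using M \<open>card B = _\<close> by simp
    show "\<phi> (s e) \<in> B \<and> \<phi> (t e) \<in> B" if "e \<in> edges H" for e
      using st[OF that] by (simp add: B_def)
    show "robust (arcs G) M k (\<phi> (s e)) (\<phi> (t e))" if "e \<in> edges H" for e
      by (rule r[OF st[OF that]])
  qed
  then obtain P where
    P0: "\<forall>e\<in>edges H. P e \<in> joining (paths (arcs G)) k (\<phi> (s e)) (\<phi> (t e)) \<and>
      set (P e) \<inter> B \<subseteq> {\<phi> (s e), \<phi> (t e)}"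
    and P': "\<forall>e\<in>edges H. \<forall>e'\<in>edges H. e \<noteq> e' \<longrightarrow> set (P e) \<inter> set (P e') \<subseteq> B"
    by (elim exE conjE)
  have Pl: "length (P e) = Suc k" "distinct (P e)" "P e ! 0 = \<phi> (s e)" "P e ! k = \<phi> (t e)"
    "walk (arcs G) (P e)" if "e \<in> edges H" for e
  proof -
    from P0 that have *: "length (P e) = Suc k" "P e \<noteq> []" "distinct (P e)" "hd (P e) = \<phi> (s e)"
      "last (P e) = \<phi> (t e)" "walk (arcs G) (P e)" by (auto simp: joining_def paths_def)
    then show "length (P e) = Suc k" "distinct (P e)" "P e ! 0 = \<phi> (s e)" "P e ! k = \<phi> (t e)"
      "walk (arcs G) (P e)" by (auto simp: hd_conv_nth last_conv_nth)
  qed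
  define f where "f v = (case v of Inl x \<Rightarrow> \<phi> x | Inr (e, i) \<Rightarrow> P e ! i)" for v :: "'b + 'b set \<times> nat"
  have fpv: "f (path_vertex (k - 1) e i) = P e ! i" if "e \<in> edges H" "i \<le> k" for e i
    using Pl(3,4)[OF that(1)] that(2) k by (auto simp: f_def path_vertex_def s_def t_def)
  have arcV: "x \<in> verts G \<and> y \<in> verts G" if "(x, y) \<in> arcs G" for x y
    using that G by (auto simp: arcs_def simple_graph_def)
  have inV: "P e ! i \<in> verts G" if "e \<in> edges H" "i \<le> k" for e i
  proof (cases "i = k")
    case True
    then show ?thesis using Pl(4)[OF that(1)] st[OF that(1)] \<phi> by auto
  next
    case False
    then have "(P e ! i, P e ! Suc i) \<in> arcs G"
      using Pl(1,5)[OF that(1)] that(2) by (simp add: walk_def)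
    then show ?thesis using arcV by blast
  qed
  have notB: "P e ! i \<notin> B" if "e \<in> edges H" "0 < i" "i < k" for e i
  proof
    assume "P e ! i \<in> B"
    moreover have "P e ! i \<in> set (P e)" using Pl(1)[OF that(1)] that(3) by simp
    moreover have "set (P e) \<inter> B \<subseteq> {P e ! 0, P e ! k}"
      using P0 that(1) Pl(3,4)[OF that(1)] by simp
    ultimately have "P e ! i = P e ! 0 \<or> P e ! i = P e ! k" by blast
    then show False using Pl(1,2)[OF that(1)] that by (auto simp: nth_eq_iff_index_eq)
  qed
  have vs: "verts (subdivision (k - 1) H) = Inl ` verts H \<union> Inr ` (edges H \<times> {1..k - 1})"
    by (simp add: subdivision_def)
  have i1: "1 \<le> i \<and> i \<le> k - 1 \<longleftrightarrow> 0 < i \<and> i < k" for i by auto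
  have "inj_on f (verts (subdivision (k - 1) H))"
  proof (rule inj_onI)
    fix v w assume v: "v \<in> verts (subdivision (k - 1) H)" and w: "w \<in> verts (subdivision (k - 1) H)"
      and eq: "f v = f w"
    have inner: "e = e' \<and> i = i'" if "e \<in> edges H" "e' \<in> edges H" "0 < i" "i < k" "0 < i'" "i' < k"
      "P e ! i = P e' ! i'" for e e' i i'
    proof -
      have "P e ! i \<in> set (P e)" "P e ! i \<in> set (P e')"
        using that Pl(1)[OF that(1)] Pl(1)[OF that(2)] by (metis less_SucI nth_mem)+
      then have "e = e'" using P' that(1,2) notB[OF that(1,3,4)] by blast
      then show ?thesis using that Pl(1,2)[OF that(1)] by (auto simp: nth_eq_iff_index_eq)
    qed
    from v w consider x y where "v = Inl x" "w = Inl y" "x \<in> verts H" "y \<in> verts H"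
      | x e i where "v = Inl x" "w = Inr (e, i)" "x \<in> verts H" "e \<in> edges H" "0 < i" "i < k"
      | x e i where "w = Inl x" "v = Inr (e, i)" "x \<in> verts H" "e \<in> edges H" "0 < i" "i < k"
      | e i e' i' where "v = Inr (e, i)" "w = Inr (e', i')" "e \<in> edges H" "e' \<in> edges H"
        "0 < i" "i < k" "0 < i'" "i' < k"
      unfolding vs by (auto simp: i1)
    then show "v = w"
    proof cases
      case 1
      then show ?thesis using eq \<phi>(1) by (auto simp: f_def dest: inj_onD)
    next
      case 2
      then have "P e ! i = \<phi> x" using eq by (simp add: f_def)
      then show ?thesis using 2 notB[of e i] by (auto simp: B_def)
    next
      case 3
      then have "P e ! i = \<phi> x" using eq by (simp add: f_def)
      then show ?thesis using 3 notB[of e i] by (auto simp: B_def)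
    next
      case 4
      then show ?thesis using eq inner by (auto simp: f_def)
    qed
  qed
  moreover have "f ` verts (subdivision (k - 1) H) \<subseteq> verts G"
    using \<phi>(2) inV unfolding vs by (auto simp: f_def)
  moreover have "f ` a \<in> edges G" if "a \<in> edges (subdivision (k - 1) H)" for a
  proof -
    from that obtain e i where e: "e \<in> edges H" "i \<le> k - 1"
      and a: "a = {path_vertex (k - 1) e i, path_vertex (k - 1) e (i + 1)}"
      by (auto simp: subdivision_def)
    then have "f ` a = {P e ! i, P e ! Suc i}" using fpv[of e i] fpv[of e "i + 1"] k by auto
    moreover have "(P e ! i, P e ! Suc i) \<in> arcs G"
      using Pl(1,5)[OF e(1)] e(2) k by (auto simp: walk_def)
    ultimately show ?thesis by (simp add: arcs_def)
  qed
  ultimately show ?thesis unfolding contains_copy_def by blast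
qed

section \<open>Walks in graphs of bounded degree\<close>

text \<open>For every \<open>i\<close> from 1 to \<open>j\<close>, level \<open>j\<close> bounds the
  number of alternatives to each subpath with \<open>i\<close> edges. Only alternatives of level
  \<open>i - 1\<close> are counted, so that the alternatives in turn split into pieces with bounded
  counts.\<close>

primrec light :: "('a \<times> 'a) set \<Rightarrow> (nat \<Rightarrow> nat) \<Rightarrow> nat \<Rightarrow> 'a list set" where
  "light E f 0 = paths E"
| "light E f (Suc j) = {p \<in> light E f j. \<forall>q. sublist q p \<and> length q = Suc (Suc j) \<longrightarrow>
     card (joining (light E f j) (Suc j) (hd q) (last q)) \<le> f (Suc j)}"

definition heavy :: "('a \<times> 'a) set \<Rightarrow> (nat \<Rightarrow> nat) \<Rightarrow> nat \<Rightarrow> 'a list set" where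
  "heavy E f j = {p \<in> light E f (j - 1). length p = Suc j \<and>
     f j < card (joining (light E f (j - 1)) j (hd p) (last p))}"

lemma light_antimono: "i \<le> j \<Longrightarrow> light E f j \<subseteq> light E f i"
  by (induction j) (auto simp: le_Suc_eq)

lemma light_paths: "light E f j \<subseteq> paths E"
  using light_antimono[of 0 j E f] by simp

lemma light_sublist: "p \<in> light E f j \<Longrightarrow> sublist q p \<Longrightarrow> q \<noteq> [] \<Longrightarrow> q \<in> light E f j"
proof (induction j)
  case 0
  then show ?case by (auto intro: paths_sublist)
next
  case (Suc j)
  then have "sublist r p" if "sublist r q" for r
    using that sublist_order.order.trans by blast
  with Suc show ?case by simp
qed

lemma joining_mono: "S \<subseteq> T \<Longrightarrow> joining S n x y \<subseteq> joining T n x y"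
  by (auto simp: joining_def)

lemma take_Suc_eq_imp: "take (Suc m) p = take (Suc m) q \<Longrightarrow> take m p = take m q"
  by (metis le_SucI min.absorb1 order_refl take_take)

text \<open>Vertices may repeat, which makes the counts multiplicative in the degrees. Walks with a
  repetition are subtracted later.\<close>

definition walks :: "('a \<times> 'a) set \<Rightarrow> nat \<Rightarrow> 'a \<Rightarrow> 'a list set" where
  "walks E n x = {p. length p = Suc n \<and> hd p = x \<and> walk E p}"

section \<open>Counting walks when all degrees lie between \<open>d\<close> and
  \<open>D\<close>\<close>

locale finite_arcs =
  fixes V :: "'a set" and E :: "('a \<times> 'a) set"
  assumes finV: "finite V" and EV: "E \<subseteq> V \<times> V" and symE: "sym E" and irrE: "irrefl E"
begin

lemma finite_nbrs [simp]: "finite (E `` A)"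
  using finite_subset[of "E `` A" V] finV EV by auto

lemma walks_0: "walks E 0 x = {[x]}"
proof -
  have "p = [hd p]" if "length p = Suc 0" for p :: "'a list"
    using that by (cases p) auto
  then show ?thesis by (auto simp: walks_def walk_def)
qed

lemma walk_Cons: "walk E (x # p) \<longleftrightarrow> p = [] \<or> ((x, hd p) \<in> E \<and> walk E p)"
proof (cases p)
  case (Cons y q)
  have "walk E (x # p) \<longleftrightarrow> (x, y) \<in> E \<and> walk E p"
    unfolding walk_def Cons by (auto simp: nth_Cons split: nat.splits)
  then show ?thesis using Cons by simp
qed (auto simp: walk_def)

lemma walks_Suc: "walks E (Suc n) x = (\<Union>y\<in>E `` {x}. (#) x ` walks E n y)"
proof (intro set_eqI iffI)
  fix p assume "p \<in> walks E (Suc n) x"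
  then obtain q where "p = x # q" "length q = Suc n" "walk E (x # q)"
    by (cases p) (auto simp: walks_def)
  then show "p \<in> (\<Union>y\<in>E `` {x}. (#) x ` walks E n y)"
    by (auto simp: walk_Cons walks_def)
next
  fix p assume "p \<in> (\<Union>y\<in>E `` {x}. (#) x ` walks E n y)"
  then show "p \<in> walks E (Suc n) x"
    by (auto simp: walks_def walk_Cons)
qed

lemma finite_walks [simp]: "finite (walks E n x)"
  by (induction n arbitrary: x) (auto simp: walks_0 walks_Suc)

lemma card_walks_Suc: "card (walks E (Suc n) x) = (\<Sum>y\<in>E `` {x}. card (walks E n y))"
proof -
  have "card (walks E (Suc n) x) = (\<Sum>y\<in>E `` {x}. card ((#) x ` walks E n y))"
    unfolding walks_Suc
  proof (rule card_UN_disjoint)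
    show "\<forall>y\<in>E `` {x}. \<forall>z\<in>E `` {x}. y \<noteq> z \<longrightarrow> (#) x ` walks E n y \<inter> (#) x ` walks E n z = {}"
      by (auto simp: walks_def)
  qed simp_all
  then show ?thesis by (simp add: card_image)
qed

lemma walks_V: "x \<in> V \<Longrightarrow> p \<in> walks E n x \<Longrightarrow> set p \<subseteq> V"
proof (induction n arbitrary: x p)
  case (Suc n)
  then obtain y q where q: "(x, y) \<in> E" "p = x # q" "q \<in> walks E n y"
    by (auto simp: walks_Suc)
  then have "set q \<subseteq> V" using EV Suc.IH[of y q] by blast
  then show ?case using q(2) Suc.prems(1) by simp
qed (simp add: walks_0)

lemma walk_last_in_V:
  assumes "x \<in> V" "p \<in> walks E n x"
  shows "last p \<in> V"
proof -
  have "p \<noteq> []" using assms(2) by (auto simp: walks_def)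
  then show ?thesis using walks_V[OF assms] last_in_set by blast
qed

end

locale near_regular = finite_arcs +
  fixes d D :: real
  assumes V_ne: "V \<noteq> {}" and d1: "1 \<le> d" and dD: "d \<le> D"
    and deg_ge: "x \<in> V \<Longrightarrow> d \<le> card (E `` {x})" and deg_le: "x \<in> V \<Longrightarrow> card (E `` {x}) \<le> D"
begin

lemma D1: "1 \<le> D" using d1 dD by simp

lemma nbr_in_V: "y \<in> E `` {x} \<Longrightarrow> y \<in> V"
  using EV by auto

lemma card_walks_le: "x \<in> V \<Longrightarrow> card (walks E n x) \<le> D ^ n"
proof (induction n arbitrary: x)
  case (Suc n)
  have "real (card (walks E (Suc n) x)) = (\<Sum>y\<in>E `` {x}. real (card (walks E n y)))"
    by (simp add: card_walks_Suc)
  also have "\<dots> \<le> (\<Sum>y\<in>E `` {x}. D ^ n)"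
    using Suc.IH nbr_in_V by (intro sum_mono) blast
  also have "\<dots> \<le> D * D ^ n"
    using deg_le[OF Suc.prems] D1 by (simp add: mult_right_mono)
  finally show ?case by simp
qed (simp add: walks_0)

lemma card_walks_ge: "x \<in> V \<Longrightarrow> d ^ n \<le> card (walks E n x)"
proof (induction n arbitrary: x)
  case (Suc n)
  have "d * d ^ n \<le> (\<Sum>y\<in>E `` {x}. d ^ n)"
    using deg_ge[OF Suc.prems] d1 by (simp add: mult_right_mono)
  also have "\<dots> \<le> (\<Sum>y\<in>E `` {x}. real (card (walks E n y)))"
    using Suc.IH nbr_in_V by (intro sum_mono) blast
  also have "\<dots> = real (card (walks E (Suc n) x))" by (simp add: card_walks_Suc)
  finally show ?case by simp
qed (simp add: walks_0)

lemma walks_take: "p \<in> walks E n x \<Longrightarrow> m \<le> n \<Longrightarrow> take (Suc m) p \<in> walks E m x"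
  unfolding walks_def by (auto intro: walk_sublist sublist_take)

lemma walks_drop: "p \<in> walks E n x \<Longrightarrow> m \<le> n \<Longrightarrow> drop m p \<in> walks E (n - m) (p ! m)"
  unfolding walks_def by (auto intro: walk_sublist sublist_drop simp: hd_drop_conv_nth)

text \<open>Cutting just before position \<open>g\<close> leaves a walk with \<open>g - 1\<close>
  edges from \<open>x\<close> and one with \<open>n - g\<close> edges from \<open>w\<close>.
  Prescribing a vertex thus saves one factor \<open>D\<close>.\<close>

lemma walks_through:
  assumes "x \<in> V" "0 < g" "g \<le> n"
  shows "card {p \<in> walks E n x. p ! g = w} \<le> D ^ (n - 1)"
proof (cases "w \<in> V")
  case True
  have "card {p \<in> walks E n x. p ! g = w} \<le> card (walks E (g - 1) x \<times> walks E (n - g) w)"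
  proof (rule card_inj_on_le[of "\<lambda>p. (take g p, drop g p)"])
    show "inj_on (\<lambda>p. (take g p, drop g p)) {p \<in> walks E n x. p ! g = w}"
      by (rule inj_onI) (metis append_take_drop_id prod.inject)
    show "(\<lambda>p. (take g p, drop g p)) ` {p \<in> walks E n x. p ! g = w} \<subseteq> walks E (g - 1) x \<times> walks E (n - g) w"
      using walks_take[of _ n x "g - 1"] walks_drop[of _ n x g] assms by auto
  qed simp
  then have "real (card {p \<in> walks E n x. p ! g = w}) \<le> real (card (walks E (g - 1) x)) * real (card (walks E (n - g) w))"
    by (simp only: card_cartesian_product flip: of_nat_mult of_nat_le_iff)
  also have "\<dots> \<le> D ^ (g - 1) * D ^ (n - g)"
    using card_walks_le[OF assms(1)] card_walks_le[OF True] D1 by (intro mult_mono) auto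
  also have "\<dots> = D ^ (n - 1)" using assms by (simp flip: power_add)
  finally show ?thesis .
next
  case False
  have "p ! g \<in> V" if "p \<in> walks E n x" for p
  proof -
    have "p ! g \<in> set p" using that assms(3) by (simp add: walks_def)
    then show ?thesis using walks_V[OF assms(1) that] by blast
  qed
  then have "{p \<in> walks E n x. p ! g = w} = {}" using False by blast
  then have "card {p \<in> walks E n x. p ! g = w} = 0" by (metis card.empty)
  moreover have "0 \<le> D ^ (n - 1)" using D1 by simp
  ultimately show ?thesis by linarith
qed

text \<open>Beyond the prefix there is a walk with \<open>n - m\<close> edges from
  \<open>last r\<close>, and \<open>walks_through\<close> applies to each forbidden vertex and each
  position. The saved factor \<open>D\<close> makes such continuations rare.\<close>

lemma walk_prefix_count:
  assumes "x \<in> V" "r \<in> walks E m x" "m \<le> n" and that: "finite Z"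
  shows "card {p \<in> walks E n x. take (Suc m) p = r \<and> (\<exists>i. m < i \<and> i \<le> n \<and> p ! i \<in> Z)} \<le>
    card Z * real (n - m) * D ^ (n - m - 1)"
proof -
  have l: "length r = Suc m" using assms(2) by (auto simp: walks_def)
  define L where "L = {p \<in> walks E n x. take (Suc m) p = r \<and> (\<exists>i. m < i \<and> i \<le> n \<and> p ! i \<in> Z)}"
  define T where "T = (\<lambda>(z, i). {p \<in> walks E (n - m) (last r). p ! i = z})"
  have "last r \<in> V" using walk_last_in_V assms by blast
  have finT: "finite (T a)" for a by (cases a) (simp add: T_def)
  have "inj_on (drop m) L"
  proof (rule inj_onI)
    fix p q assume a: "p \<in> L" "q \<in> L" and e: "drop m p = drop m q"
    have "take m p = take m q"
      using a by - (rule take_Suc_eq_imp, simp add: L_def)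
    then show "p = q" using e by (metis append_take_drop_id)
  qed
  moreover have "drop m ` L \<subseteq> (\<Union>a\<in>Z \<times> {1..n - m}. T a)"
  proof
    fix q assume "q \<in> drop m ` L"
    then obtain p i where p: "q = drop m p" "p \<in> walks E n x" "take (Suc m) p = r" "m < i" "i \<le> n" "p ! i \<in> Z"
      by (auto simp: L_def)
    have lp: "length p = Suc n" using p(2) by (simp add: walks_def)
    have "last (take (Suc m) p) = p ! m"
      using assms(3) lp by (subst last_conv_nth) auto
    then have "q \<in> walks E (n - m) (last r)" "q ! (i - m) = p ! i"
      using walks_drop[OF p(2) assms(3)] p lp by simp_all
    then have "q \<in> T (p ! i, i - m)" by (simp add: T_def)
    moreover have "(p ! i, i - m) \<in> Z \<times> {1..n - m}" using p by auto
    ultimately show "q \<in> (\<Union>a\<in>Z \<times> {1..n - m}. T a)" by blast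
  qed
  moreover have "finite (\<Union>a\<in>Z \<times> {1..n - m}. T a)" using finT that by simp
  ultimately have "card L \<le> card (\<Union>a\<in>Z \<times> {1..n - m}. T a)" by (rule card_inj_on_le)
  also have "\<dots> \<le> (\<Sum>a\<in>Z \<times> {1..n - m}. card (T a))"
    using that by (intro card_UN_le) simp
  finally have "real (card L) \<le> (\<Sum>a\<in>Z \<times> {1..n - m}. real (card (T a)))"
    by (simp flip: of_nat_sum)
  also have "\<dots> \<le> (\<Sum>a\<in>Z \<times> {1..n - m}. D ^ (n - m - 1))"
  proof (rule sum_mono)
    fix a assume "a \<in> Z \<times> {1..n - m}"
    then obtain z i where "a = (z, i)" "0 < i" "i \<le> n - m" by auto
    then show "real (card (T a)) \<le> D ^ (n - m - 1)"
      using walks_through[OF \<open>last r \<in> V\<close>, of i "n - m" z] by (simp add: T_def)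
  qed
  also have "\<dots> = card Z * real (n - m) * D ^ (n - m - 1)" by (simp add: card_cartesian_product)
  finally show ?thesis unfolding L_def .
qed

end

section \<open>Light and heavy paths\<close>

text \<open>If there is such a path at all, it is also light at level \<open>i\<close>, and this
  bounds the alternatives of level \<open>i - 1\<close> between its ends, a larger set. The second
  disjunct is there because \<open>card\<close> is monotone only below finite sets.\<close>

lemma light_joining_card:
  assumes "0 < i" "i \<le> j"
  shows "card (joining (light E f j) i x y) \<le> f i \<or> infinite (joining (paths E) i x y)"
proof (cases "joining (light E f j) i x y = {}")
  case False
  then obtain q where q: "q \<in> light E f j" "length q = Suc i" "hd q = x" "last q = y"
    by (auto simp: joining_def)
  obtain i' where i': "i = Suc i'" using assms by (cases i) auto
  have "q \<in> light E f i" using q light_antimono[OF assms(2)] by auto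
  then have le: "card (joining (light E f i') i x y) \<le> f i" using q i' by auto
  have sub: "joining (light E f j) i x y \<subseteq> joining (light E f i') i x y"
    using assms i' by (intro joining_mono light_antimono) simp
  have sub2: "joining (light E f i') i x y \<subseteq> joining (paths E) i x y"
    by (intro joining_mono light_paths)
  show ?thesis
    using le sub sub2 by (meson card_mono finite_subset le_trans)
qed simp

text \<open>At the first level where \<open>p\<close> stops being light, the offending subpath is
  still light at the previous level, hence heavy.\<close>

lemma not_light_heavy:
  assumes "p \<in> paths E" "p \<notin> light E f l"
  shows "\<exists>j\<in>{1..l}. \<exists>q\<in>heavy E f j. sublist q p"
  using assms
proof (induction l)
  case (Suc l)
  show ?case
  proof (cases "p \<in> light E f l")
    case True
    then obtain q where q: "sublist q p" "length q = Suc (Suc l)"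
      "f (Suc l) < card (joining (light E f l) (Suc l) (hd q) (last q))"
      using Suc.prems by auto
    then have "q \<in> light E f l" using light_sublist[OF True, of q] by (cases q) auto
    then have "q \<in> heavy E f (Suc l)" using q by (simp add: heavy_def)
    then show ?thesis using q by auto
  next
    case False
    then show ?thesis using Suc by fastforce
  qed
qed simp

context finite_arcs
begin

lemma joining_paths_walks: "joining (paths E) n x y \<subseteq> walks E n x"
  by (auto simp: joining_def paths_def walks_def)

lemma finite_joining_paths [simp]: "finite (joining (paths E) n x y)"
  using joining_paths_walks finite_walks by (rule finite_subset)

lemma finite_joining_light [simp]: "finite (joining (light E f j) n x y)"
  using joining_mono[OF light_paths] finite_joining_paths by (rule finite_subset)

lemma card_joining_light: "0 < i \<Longrightarrow> i \<le> j \<Longrightarrow> card (joining (light E f j) i x y) \<le> f i"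
  using light_joining_card[of i j E f x y] by simp

text \<open>At most one path with one edge joins two given vertices. For this reason heavy lengths
  start at 2.\<close>

lemma heavy_1_empty: assumes "1 \<le> f 1" shows "heavy E f 1 = {}"
proof -
  have "joining (paths E) 1 x y \<subseteq> {[x, y]}" for x y
    by (auto simp: joining_def length_Suc_conv)
  then have "card (joining (paths E) 1 x y) \<le> 1" for x y
    using card_mono[of "{[x, y]}" "joining (paths E) 1 x y"] by simp
  then have "card (joining (paths E) 1 x y) \<le> f 1" for x y
    using assms le_trans by blast
  then show ?thesis by (auto simp: heavy_def not_less)
qed

text \<open>A path through a given vertex at a given inner position splits into two shorter light
  paths with fixed ends, and there are at most \<open>F\<close> choices for each of the two.\<close>

lemma light_through_card:
  assumes F: "\<And>i. i < j \<Longrightarrow> f i \<le> F" and that: "finite Z"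
  shows "card {q \<in> joining (light E f (j - 1)) j x y. \<exists>i. 0 < i \<and> i < j \<and> q ! i \<in> Z} \<le> card Z * j * F * F"
proof -
  define L where "L = light E f (j - 1)"
  have one: "card {q \<in> joining L j x y. q ! i = z} \<le> F * F" if i: "0 < i" "i < j" for i z
  proof -
    have "card {q \<in> joining L j x y. q ! i = z} \<le> card (joining L i x z \<times> joining L (j - i) z y)"
    proof (rule card_inj_on_le[of "\<lambda>q. (take (Suc i) q, drop i q)"])
      show "inj_on (\<lambda>q. (take (Suc i) q, drop i q)) {q \<in> joining L j x y. q ! i = z}"
      proof (rule inj_onI)
        fix p q assume "(take (Suc i) p, drop i p) = (take (Suc i) q, drop i q)"
        then have *: "take (Suc i) p = take (Suc i) q" "drop i p = drop i q" by auto
        then have "take i p = take i q" by - (rule take_Suc_eq_imp)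
        then show "p = q" using * by (metis append_take_drop_id)
      qed
      show "(\<lambda>q. (take (Suc i) q, drop i q)) ` {q \<in> joining L j x y. q ! i = z} \<subseteq>
        joining L i x z \<times> joining L (j - i) z y"
      proof safe
        fix q assume q: "q \<in> joining L j x y" "z = q ! i"
        have l: "length q = Suc j" "q \<in> L" using q by (auto simp: joining_def)
        have "take (Suc i) q \<in> L" "drop i q \<in> L"
          using light_sublist[OF l(2)[unfolded L_def], of "take (Suc i) q"]
            light_sublist[OF l(2)[unfolded L_def], of "drop i q"] l i
          unfolding L_def by (auto simp flip: length_0_conv)
        moreover have "last (take (Suc i) q) = q ! i"
          using l i by (subst last_conv_nth) auto
        ultimately show "take (Suc i) q \<in> joining L i x (q ! i)" "drop i q \<in> joining L (j - i) (q ! i) y"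
          using q l i by (auto simp: joining_def hd_drop_conv_nth)
      qed
    qed (simp add: L_def)
    also have "\<dots> \<le> F * F"
      unfolding card_cartesian_product L_def
      using card_joining_light[of i "j - 1" f x z] card_joining_light[of "j - i" "j - 1" f z y] F[of i] F[of "j - i"] i
      by (intro mult_le_mono) linarith+
    finally show ?thesis .
  qed
  have eq: "{q \<in> joining L j x y. \<exists>i. 0 < i \<and> i < j \<and> q ! i \<in> Z} =
    (\<Union>(z, i)\<in>Z \<times> {0<..<j}. {q \<in> joining L j x y. q ! i = z})"
    by fastforce
  have "card {q \<in> joining L j x y. \<exists>i. 0 < i \<and> i < j \<and> q ! i \<in> Z} \<le> (\<Sum>(z, i)\<in>Z \<times> {0<..<j}. card {q \<in> joining L j x y. q ! i = z})"
    unfolding eq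
    using card_UN_le[of "Z \<times> {0<..<j}" "\<lambda>(z, i). {q \<in> joining L j x y. q ! i = z}"] that
    by (simp add: case_prod_beta)
  also have "\<dots> \<le> (\<Sum>(z, i)\<in>Z \<times> {0<..<j}. F * F)"
    using one by (intro sum_mono) auto
  also have "\<dots> = card Z * (j - 1) * (F * F)" by (simp add: case_prod_beta card_cartesian_product)
  also have "\<dots> \<le> card Z * j * (F * F)" by (intro mult_le_mono) auto
  finally show ?thesis by (simp add: L_def mult.assoc)
qed

text \<open>By \<open>light_through_card\<close>, at most \<open>M * j * F * F\<close> of the more
  than \<open>f j\<close> alternatives meet the forbidden set inside, so one of them
  survives.\<close>

lemma heavy_robust:
  assumes p: "p \<in> heavy E f j" and F: "\<And>i. i < j \<Longrightarrow> f i \<le> F" and M: "M * j * F * F \<le> f j"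
  shows "robust E M j (hd p) (last p)"
  unfolding robust_def
proof (intro allI impI)
  fix Z :: "'a set" assume Z: "finite Z \<and> card Z \<le> M"
  define x y where "x = hd p" and "y = last p"
  let ?A = "joining (light E f (j - 1)) j x y"
  let ?B = "{q \<in> ?A. \<exists>i. 0 < i \<and> i < j \<and> q ! i \<in> Z}"
  have "card ?B \<le> card Z * j * F * F"
    using light_through_card[where f = f and F = F and Z = Z and j = j] F Z by blast
  also have "\<dots> \<le> M * j * F * F" using Z by (intro mult_le_mono) auto
  also have "\<dots> \<le> f j" by (rule M)
  also have "f j < card ?A" using p by (simp add: heavy_def x_def y_def)
  finally have "\<not> ?A \<subseteq> ?B" using card_mono[of ?B ?A] by auto
  then obtain q where q: "q \<in> ?A" "\<And>i. 0 < i \<Longrightarrow> i < j \<Longrightarrow> q ! i \<notin> Z" by blast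
  have l: "length q = Suc j" "hd q = x" "last q = y" "q \<noteq> []" using q(1) by (auto simp: joining_def)
  have "set q \<inter> Z \<subseteq> {x, y}"
  proof
    fix z assume z: "z \<in> set q \<inter> Z"
    then obtain i where i: "i \<le> j" "z = q ! i" using l by (auto simp: in_set_conv_nth less_Suc_eq_le)
    then have "i = 0 \<or> i = j" using q(2)[of i] z by force
    then show "z \<in> {x, y}" using i l by (auto simp: hd_conv_nth last_conv_nth)
  qed
  moreover have "q \<in> joining (paths E) j x y" using q(1) light_paths by (auto simp: joining_def)
  ultimately show "\<exists>q\<in>joining (paths E) j (hd p) (last p). set q \<inter> Z \<subseteq> {hd p, last p}"
    by (auto simp: x_def y_def)
qed

end

section \<open>Removing walks that repeat a vertex or contain a heavy path\<close>

context near_regular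
begin

text \<open>A repetition means that the walk returns, after some initial segment \<open>r\<close>,
  to \<open>last r\<close>. There are at most \<open>D ^ i\<close> segments with \<open>i\<close>
  edges, and \<open>walk_prefix_count\<close> saves a factor \<open>D\<close> on the rest.\<close>

lemma repeating_walks_card:
  assumes x: "x \<in> V"
  shows "card {p \<in> walks E n x. \<not> distinct p} \<le> real n * n * D ^ (n - 1)"
proof -
  let ?S = "\<lambda>i r. {p \<in> walks E n x. take (Suc i) p = r \<and> (\<exists>k. i < k \<and> k \<le> n \<and> p ! k \<in> {last r})}"
  have fin: "finite (?S i r)" for i r by simp
  have "{p \<in> walks E n x. \<not> distinct p} \<subseteq> (\<Union>i\<in>{..<n}. \<Union>r\<in>walks E i x. ?S i r)"
  proof safe
    fix p assume p: "p \<in> walks E n x" "\<not> distinct p"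
    then have l: "length p = Suc n" by (simp add: walks_def)
    from p obtain i k where ik: "i < k" "k \<le> n" "p ! k = p ! i"
      unfolding distinct_conv_nth l using less_Suc_eq_le by (metis linorder_neqE_nat)
    have "last (take (Suc i) p) = p ! i" using ik l by (subst last_conv_nth) auto
    then show "p \<in> (\<Union>i\<in>{..<n}. \<Union>r\<in>walks E i x. ?S i r)"
      using p ik walks_take[OF p(1), of i]
      by (intro UN_I[of i] UN_I[of "take (Suc i) p"]) auto
  qed
  then have "card {p \<in> walks E n x. \<not> distinct p} \<le> card (\<Union>i\<in>{..<n}. \<Union>r\<in>walks E i x. ?S i r)"
    by (intro card_mono) auto
  also have "\<dots> \<le> (\<Sum>i<n. card (\<Union>r\<in>walks E i x. ?S i r))" by (rule card_UN_le) simp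
  also have "\<dots> \<le> (\<Sum>i<n. \<Sum>r\<in>walks E i x. card (?S i r))"
    by (intro sum_mono card_UN_le) simp
  finally have "real (card {p \<in> walks E n x. \<not> distinct p}) \<le> (\<Sum>i<n. \<Sum>r\<in>walks E i x. real (card (?S i r)))"
    by (simp flip: of_nat_sum)
  also have "\<dots> \<le> (\<Sum>i<n. \<Sum>r\<in>walks E i x. real n * D ^ (n - i - 1))"
  proof (intro sum_mono)
    fix i r assume i: "i \<in> {..<n}" "r \<in> walks E i x"
    have "real (card (?S i r)) \<le> card {last r} * real (n - i) * D ^ (n - i - 1)"
      using walk_prefix_count[OF x i(2), of n "{last r}"] i by auto
    also have "\<dots> \<le> real n * D ^ (n - i - 1)" using D1 by (intro mult_right_mono) auto
    finally show "real (card (?S i r)) \<le> real n * D ^ (n - i - 1)" .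
  qed
  also have "\<dots> = (\<Sum>i<n. card (walks E i x) * (real n * D ^ (n - i - 1)))" by simp
  also have "\<dots> \<le> (\<Sum>i<n. D ^ i * (real n * D ^ (n - i - 1)))"
    using card_walks_le[OF x] D1 by (intro sum_mono mult_right_mono) auto
  also have "\<dots> = (\<Sum>i<n. real n * D ^ (n - 1))"
  proof (intro sum.cong refl)
    fix i assume "i \<in> {..<n}"
    then have "D ^ (n - 1) = D ^ i * D ^ (n - i - 1)" by (simp flip: power_add)
    then show "D ^ i * (real n * D ^ (n - i - 1)) = real n * D ^ (n - 1)" by simp
  qed
  also have "\<dots> = real n * n * D ^ (n - 1)" by simp
  finally show ?thesis .
qed

definition all_walks :: "nat \<Rightarrow> 'a list set" where
  "all_walks n = (\<Union>x\<in>V. walks E n x)"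

lemma finite_all_walks [simp]: "finite (all_walks n)"
  using finV by (auto simp: all_walks_def)

lemma card_all_walks_Int:
  "card {p \<in> all_walks n. P p} = (\<Sum>x\<in>V. card {p \<in> walks E n x. P p})"
proof -
  have "{p \<in> all_walks n. P p} = (\<Union>x\<in>V. {p \<in> walks E n x. P p})"
    by (auto simp: all_walks_def)
  also have "card \<dots> = (\<Sum>x\<in>V. card {p \<in> walks E n x. P p})"
  proof (rule card_UN_disjoint)
    show "\<forall>x\<in>V. \<forall>y\<in>V. x \<noteq> y \<longrightarrow> {p \<in> walks E n x. P p} \<inter> {p \<in> walks E n y. P p} = {}"
      by (auto simp: walks_def)
  qed (simp_all add: finV)
  finally show ?thesis .
qed

text \<open>Once the position of \<open>q\<close> is fixed, the walk is determined by its part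
  before \<open>q\<close>, read backwards from \<open>hd q\<close>, and its part after
  \<open>q\<close>, read from \<open>last q\<close>. Together these have \<open>n - i\<close>
  edges.\<close>

lemma containing_walks_card:
  assumes q: "q \<in> all_walks i" and i: "i \<le> n"
  shows "card {p \<in> all_walks n. sublist q p} \<le> real (Suc n) * D ^ (n - i)"
proof -
  have l: "length q = Suc i" using q by (auto simp: all_walks_def walks_def)
  have qV: "hd q \<in> V" "last q \<in> V"
  proof -
    obtain x where x: "x \<in> V" "q \<in> walks E i x" using q by (auto simp: all_walks_def)
    then show "hd q \<in> V" by (auto simp: walks_def)
    show "last q \<in> V" using x walk_last_in_V by blast
  qed
  let ?S = "\<lambda>a. {p \<in> all_walks n. take (Suc i) (drop a p) = q}"
  have "card {p \<in> all_walks n. sublist q p} \<le> card (\<Union>a\<in>{..n - i}. ?S a)"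
  proof (rule card_mono)
    show "{p \<in> all_walks n. sublist q p} \<subseteq> (\<Union>a\<in>{..n - i}. ?S a)"
    proof safe
      fix p assume p: "p \<in> all_walks n" "sublist q p"
      then obtain ps ss where e: "p = ps @ q @ ss" by (auto simp: sublist_def)
      then have "length ps \<le> n - i" "take (Suc i) (drop (length ps) p) = q"
        using p(1) l by (auto simp: all_walks_def walks_def)
      then show "p \<in> (\<Union>a\<in>{..n - i}. ?S a)" using p by auto
    qed
  qed simp
  also have "\<dots> \<le> (\<Sum>a\<le>n - i. card (?S a))" by (rule card_UN_le) simp
  finally have "real (card {p \<in> all_walks n. sublist q p}) \<le> (\<Sum>a\<le>n - i. real (card (?S a)))"
    by (simp flip: of_nat_sum)
  also have "\<dots> \<le> (\<Sum>a\<le>n - i. D ^ (n - i))"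
  proof (rule sum_mono)
    fix a assume a: "a \<in> {..n - i}"
    have "card (?S a) \<le> card (walks E a (hd q) \<times> walks E (n - i - a) (last q))"
    proof (rule card_inj_on_le[of "\<lambda>p. (rev (take (Suc a) p), drop (a + i) p)"])
      show "inj_on (\<lambda>p. (rev (take (Suc a) p), drop (a + i) p)) (?S a)"
      proof (rule inj_onI)
        fix p p' assume a: "p \<in> ?S a" "p' \<in> ?S a"
          "(rev (take (Suc a) p), drop (a + i) p) = (rev (take (Suc a) p'), drop (a + i) p')"
        have 1: "take a p = take a p'" using a(3) by - (rule take_Suc_eq_imp, simp)
        have 2: "take i (drop a p) = take i (drop a p')" using a(1,2) by - (rule take_Suc_eq_imp, simp)
        have 3: "drop i (drop a p) = drop i (drop a p')" using a by (simp add: add.commute)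
        show "p = p'" using 1 2 3 by (metis append_take_drop_id)
      qed
      show "(\<lambda>p. (rev (take (Suc a) p), drop (a + i) p)) ` ?S a \<subseteq> walks E a (hd q) \<times> walks E (n - i - a) (last q)"
      proof safe
        fix p assume p: "p \<in> all_walks n" and qe: "q = take (Suc i) (drop a p)"
        have lp: "length p = Suc n" and w: "walk E p" using p by (auto simp: all_walks_def walks_def)
        have an: "a + i \<le> n" using a i by auto
        have "hd q = p ! a" using qe lp an by (simp add: hd_drop_conv_nth)
        moreover have "last (take (Suc a) p) = p ! a" using lp an by (subst last_conv_nth) auto
        moreover have "walk E (rev (take (Suc a) p))"
          using w by (intro walk_rev symE) (auto intro: walk_sublist)
        ultimately show "rev (take (Suc a) p) \<in> walks E a (hd (take (Suc i) (drop a p)))"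
          using lp an qe by (auto simp: walks_def hd_rev)
        have "last q = p ! (a + i)" using qe lp an by (subst last_conv_nth) auto
        then show "drop (a + i) p \<in> walks E (n - i - a) (last (take (Suc i) (drop a p)))"
          using lp an w qe by (auto simp: walks_def hd_drop_conv_nth intro: walk_sublist)
      qed
    qed simp
    then have "real (card (?S a)) \<le> real (card (walks E a (hd q))) * real (card (walks E (n - i - a) (last q)))"
      by (simp only: card_cartesian_product flip: of_nat_mult of_nat_le_iff)
    also have "\<dots> \<le> D ^ a * D ^ (n - i - a)"
      using card_walks_le[OF qV(1)] card_walks_le[OF qV(2)] D1 by (intro mult_mono) auto
    also have "\<dots> = D ^ (n - i)"
    proof -
      have "a + (n - i - a) = n - i" using a by simp
      then show ?thesis by (metis power_add)
    qed
    finally show "real (card (?S a)) \<le> D ^ (n - i)" .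
  qed
  also have "\<dots> = real (Suc (n - i)) * D ^ (n - i)" by simp
  also have "\<dots> \<le> real (Suc n) * D ^ (n - i)" using D1 by (intro mult_right_mono) auto
  finally show ?thesis .
qed

lemma paths_all_walks: "p \<in> paths E \<Longrightarrow> length p = Suc n \<Longrightarrow> 0 < n \<Longrightarrow> p \<in> all_walks n"
proof -
  assume p: "p \<in> paths E" "length p = Suc n" "0 < n"
  then have "(p ! 0, p ! Suc 0) \<in> E" by (auto simp: paths_def walk_def)
  then have "hd p \<in> V" using p EV by (auto simp: hd_conv_nth paths_def)
  then show "p \<in> all_walks n" using p by (auto simp: all_walks_def walks_def paths_def)
qed

text \<open>A walk that is not a light path repeats a vertex or contains a heavy path of some length
  \<open>j\<close> between 2 and \<open>l\<close>. Both kinds are subtracted from the at least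
  \<open>card V * d ^ l\<close> walks.\<close>

lemma many_light_paths:
  fixes c :: real
  assumes few: "\<And>j. 2 \<le> j \<Longrightarrow> j \<le> l \<Longrightarrow> card (heavy E f j) \<le> c * card V * D ^ j"
    and f1: "1 \<le> f 1" and c: "0 \<le> c"
  shows "card {p \<in> all_walks l. p \<in> light E f l} \<ge>
    card V * (d ^ l - real l * l * D ^ (l - 1) - real (Suc l) * real (Suc l) * c * D ^ l)"
proof -
  let ?N = "{p \<in> all_walks l. \<not> distinct p}"
  let ?H = "\<Union>j\<in>{2..l}. \<Union>q\<in>heavy E f j. {p \<in> all_walks l. sublist q p}"
  have finh: "finite (heavy E f j)" if "2 \<le> j" for j
    by (rule finite_subset[of _ "all_walks j"])
      (use that light_paths in \<open>auto simp: heavy_def intro!: paths_all_walks\<close>)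
  have "all_walks l \<subseteq> {p \<in> all_walks l. p \<in> light E f l} \<union> ?N \<union> ?H"
  proof
    fix p assume p: "p \<in> all_walks l"
    show "p \<in> {p \<in> all_walks l. p \<in> light E f l} \<union> ?N \<union> ?H"
    proof (cases "p \<in> light E f l \<or> \<not> distinct p")
      case False
      then have "p \<in> paths E" using p by (auto simp: paths_def all_walks_def walks_def)
      then obtain j q where j: "1 \<le> j" "j \<le> l" "q \<in> heavy E f j" "sublist q p"
        using not_light_heavy[of p E f l] False by auto
      then have "j \<noteq> 1" using heavy_1_empty[of f] f1 by auto
      then show ?thesis using j p by (intro UnI2 UN_I[of j] UN_I[of q]) auto
    qed (use p in auto)
  qed
  then have "card (all_walks l) \<le> card ({p \<in> all_walks l. p \<in> light E f l} \<union> ?N \<union> ?H)"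
    by (intro card_mono) (auto simp: finh)
  also have "\<dots> \<le> card {p \<in> all_walks l. p \<in> light E f l} + card ?N + card ?H"
    using card_Un_le[of "{p \<in> all_walks l. p \<in> light E f l} \<union> ?N" ?H]
      card_Un_le[of "{p \<in> all_walks l. p \<in> light E f l}" ?N] by linarith
  finally have main: "real (card (all_walks l)) \<le>
    card {p \<in> all_walks l. p \<in> light E f l} + real (card ?N) + card ?H" by simp
  have "card V * d ^ l \<le> (\<Sum>x\<in>V. real (card (walks E l x)))"
    using sum_mono[of V "\<lambda>_. d ^ l" "\<lambda>x. real (card (walks E l x))"] card_walks_ge by simp
  also have "\<dots> = card (all_walks l)"
    using card_all_walks_Int[of l "\<lambda>_. True"] by simp
  finally have lo: "card V * d ^ l \<le> card (all_walks l)" .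
  have "real (card ?N) = (\<Sum>x\<in>V. real (card {p \<in> walks E l x. \<not> distinct p}))"
    by (simp add: card_all_walks_Int)
  also have "\<dots> \<le> (\<Sum>x\<in>V. real l * l * D ^ (l - 1))"
    by (intro sum_mono repeating_walks_card)
  finally have N: "real (card ?N) \<le> card V * (real l * l * D ^ (l - 1))" by simp
  have "card ?H \<le> (\<Sum>j\<in>{2..l}. card (\<Union>q\<in>heavy E f j. {p \<in> all_walks l. sublist q p}))"
    by (rule card_UN_le) simp
  also have "\<dots> \<le> (\<Sum>j\<in>{2..l}. \<Sum>q\<in>heavy E f j. card {p \<in> all_walks l. sublist q p})"
    using finh by (intro sum_mono card_UN_le) auto
  finally have "real (card ?H) \<le> (\<Sum>j\<in>{2..l}. \<Sum>q\<in>heavy E f j. real (card {p \<in> all_walks l. sublist q p}))"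
    by (simp flip: of_nat_sum)
  also have "\<dots> \<le> (\<Sum>j\<in>{2..l}. real (Suc l) * (c * card V * D ^ l))"
  proof (rule sum_mono)
    fix j assume j: "j \<in> {2..l}"
    have "(\<Sum>q\<in>heavy E f j. real (card {p \<in> all_walks l. sublist q p})) \<le>
      (\<Sum>q\<in>heavy E f j. real (Suc l) * D ^ (l - j))"
    proof (rule sum_mono)
      fix q assume "q \<in> heavy E f j"
      then have "q \<in> all_walks j"
        using j light_paths by (intro paths_all_walks) (auto simp: heavy_def)
      then show "real (card {p \<in> all_walks l. sublist q p}) \<le> real (Suc l) * D ^ (l - j)"
        using containing_walks_card j by auto
    qed
    also have "\<dots> = card (heavy E f j) * (real (Suc l) * D ^ (l - j))" by simp
    also have "\<dots> \<le> (c * card V * D ^ j) * (real (Suc l) * D ^ (l - j))"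
      using few j D1 by (intro mult_right_mono) auto
    also have "\<dots> = real (Suc l) * (c * card V * (D ^ j * D ^ (l - j)))" by (simp add: mult_ac)
    also have "D ^ j * D ^ (l - j) = D ^ l" using j by (simp flip: power_add)
    finally show "(\<Sum>q\<in>heavy E f j. real (card {p \<in> all_walks l. sublist q p})) \<le> real (Suc l) * (c * card V * D ^ l)" .
  qed
  also have "\<dots> = real (l - 1) * (real (Suc l) * (c * card V * D ^ l))" by simp
  also have "\<dots> \<le> real (Suc l) * (real (Suc l) * (c * card V * D ^ l))"
    using c D1 by (intro mult_right_mono) auto
  finally have H: "real (card ?H) \<le> real (Suc l) * (real (Suc l) * (c * card V * D ^ l))" .
  have "card V * (d ^ l - real l * l * D ^ (l - 1) - real (Suc l) * real (Suc l) * c * D ^ l) =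
    card V * d ^ l - card V * (real l * l * D ^ (l - 1)) - real (Suc l) * (real (Suc l) * (c * card V * D ^ l))"
    by (simp add: algebra_simps)
  then show ?thesis using main lo N H by linarith
qed

end

section \<open>Mostly light paths\<close>

lemma double_count:
  assumes "finite X" "finite Y"
  shows "(\<Sum>x\<in>X. card {y \<in> Y. P x y}) = (\<Sum>y\<in>Y. card {x \<in> X. P x y})"
  using sum.swap_restrict[OF assms, of "\<lambda>_ _. 1::nat" P]
  by simp

lemma exists_card_ge_average:
  fixes c :: real
  assumes "finite X" "finite Y" "X \<noteq> {}"
    and "\<And>y. y \<in> Y \<Longrightarrow> c * card X \<le> card {x \<in> X. P x y}"
  shows "\<exists>x\<in>X. c * card Y \<le> card {y \<in> Y. P x y}"
proof (rule ccontr)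
  assume "\<not> ?thesis"
  then have "(\<Sum>x\<in>X. real (card {y \<in> Y. P x y})) < (\<Sum>x\<in>X. c * card Y)"
    using assms(1,3) by (intro sum_strict_mono) (auto simp: not_le)
  moreover have "(\<Sum>y\<in>Y. c * card X) \<le> (\<Sum>y\<in>Y. real (card {x \<in> X. P x y}))"
    using assms(4) by (intro sum_mono)
  moreover have "(\<Sum>x\<in>X. real (card {y \<in> Y. P x y})) = (\<Sum>y\<in>Y. real (card {x \<in> X. P x y}))"
    using double_count[OF assms(1,2), of P] by (simp flip: of_nat_sum)
  ultimately show False by (simp add: mult_ac)
qed

text \<open>The \<open>f a\<close> are chosen one after another. Every surviving \<open>y\<close>
  has at least \<open>\<nu> * card X\<close> neighbours, and at most half as many conflict with
  earlier choices, so by averaging some new \<open>x\<close> keeps a proportion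
  \<open>\<nu> / 2\<close> of the survivors.\<close>

lemma greedy_common_neighbours:
  fixes \<nu> \<kappa> :: real
  assumes fin: "finite X" "finite Y" and ne: "X \<noteq> {}"
    and deg: "\<And>y. y \<in> Y \<Longrightarrow> \<nu> * card X \<le> card {x \<in> X. A x y}"
    and conf: "\<And>x y. x \<in> X \<Longrightarrow> y \<in> Y \<Longrightarrow> A x y \<Longrightarrow> card {x' \<in> X. C x x' y} \<le> \<kappa> * card X"
    and sym: "\<And>x x' y. C x x' y \<Longrightarrow> C x' x y"
    and N: "real N * \<kappa> \<le> \<nu> / 2" and \<nu>: "0 \<le> \<nu>" and \<kappa>: "0 \<le> \<kappa>"
  shows "\<exists>f. (\<forall>a<N. f a \<in> X) \<and> (\<nu> / 2) ^ N * card Y \<le>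
    card {y \<in> Y. (\<forall>a<N. A (f a) y) \<and> (\<forall>a<N. \<forall>b<N. a \<noteq> b \<longrightarrow> \<not> C (f a) (f b) y)}"
  using N
proof (induction N)
  case 0
  then show ?case by simp
next
  case (Suc n)
  have "real n * \<kappa> \<le> \<nu> / 2" using Suc.prems \<kappa> by (simp add: algebra_simps)
  then obtain f where f: "\<And>a. a < n \<Longrightarrow> f a \<in> X" "(\<nu> / 2) ^ n * card Y \<le>
    card {y \<in> Y. (\<forall>a<n. A (f a) y) \<and> (\<forall>a<n. \<forall>b<n. a \<noteq> b \<longrightarrow> \<not> C (f a) (f b) y)}"
    using Suc.IH by blast
  define Q where "Q = {y \<in> Y. (\<forall>a<n. A (f a) y) \<and> (\<forall>a<n. \<forall>b<n. a \<noteq> b \<longrightarrow> \<not> C (f a) (f b) y)}"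
  define G where "G x y \<longleftrightarrow> A x y \<and> (\<forall>a<n. \<not> C (f a) x y)" for x y
  have "\<exists>x\<in>X. (\<nu> / 2) * card Q \<le> card {y \<in> Q. G x y}"
  proof (rule exists_card_ge_average[OF fin(1) _ ne])
    show "finite Q" using fin by (simp add: Q_def)
    fix y assume y: "y \<in> Q"
    have "{x \<in> X. A x y} \<subseteq> {x \<in> X. G x y} \<union> (\<Union>a<n. {x \<in> X. C (f a) x y})"
      by (auto simp: G_def)
    then have "card {x \<in> X. A x y} \<le> card ({x \<in> X. G x y} \<union> (\<Union>a<n. {x \<in> X. C (f a) x y}))"
      using fin by (intro card_mono) auto
    also have "\<dots> \<le> card {x \<in> X. G x y} + (\<Sum>a<n. card {x \<in> X. C (f a) x y})"
      using card_Un_le[of "{x \<in> X. G x y}" "\<Union>a<n. {x \<in> X. C (f a) x y}"]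
        card_UN_le[of "{..<n}" "\<lambda>a. {x \<in> X. C (f a) x y}"] by simp
    finally have "real (card {x \<in> X. A x y}) \<le>
      real (card {x \<in> X. G x y}) + (\<Sum>a<n. real (card {x \<in> X. C (f a) x y}))"
      by (simp flip: of_nat_sum of_nat_add)
    moreover have "(\<Sum>a<n. real (card {x \<in> X. C (f a) x y})) \<le> (\<Sum>a<n. \<kappa> * card X)"
      using f(1) y conf by (intro sum_mono) (auto simp: Q_def)
    moreover have "(\<Sum>a<n. \<kappa> * card X) \<le> \<nu> / 2 * card X"
      using mult_right_mono[OF \<open>real n * \<kappa> \<le> \<nu> / 2\<close>, of "card X"] by (simp add: mult_ac)
    moreover have "\<nu> * card X \<le> card {x \<in> X. A x y}" using deg y by (simp add: Q_def)
    ultimately show "\<nu> / 2 * card X \<le> card {x \<in> X. G x y}" by (simp add: field_simps)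
  qed
  then obtain x where x: "x \<in> X" "(\<nu> / 2) * card Q \<le> card {y \<in> Q. G x y}" by blast
  define g where "g = f(n := x)"
  have "(\<nu> / 2) ^ Suc n * card Y \<le> (\<nu> / 2) * card Q"
    using mult_left_mono[OF f(2), of "\<nu> / 2"] \<nu> by (simp add: Q_def mult_ac)
  also have "\<dots> \<le> card {y \<in> Q. G x y}" by (rule x(2))
  also have "{y \<in> Q. G x y} \<subseteq> {y \<in> Y. (\<forall>a<Suc n. A (g a) y) \<and>
      (\<forall>a<Suc n. \<forall>b<Suc n. a \<noteq> b \<longrightarrow> \<not> C (g a) (g b) y)}"
    using sym by (auto simp: Q_def G_def g_def less_Suc_eq)
  then have "real (card {y \<in> Q. G x y}) \<le> card {y \<in> Y. (\<forall>a<Suc n. A (g a) y) \<and>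
      (\<forall>a<Suc n. \<forall>b<Suc n. a \<noteq> b \<longrightarrow> \<not> C (g a) (g b) y)}"
    using fin by (intro of_nat_mono card_mono) auto
  finally have "(\<nu> / 2) ^ Suc n * card Y \<le> card {y \<in> Y. (\<forall>a<Suc n. A (g a) y) \<and>
      (\<forall>a<Suc n. \<forall>b<Suc n. a \<noteq> b \<longrightarrow> \<not> C (g a) (g b) y)}" .
  moreover have "\<forall>a<Suc n. g a \<in> X" using f(1) x(1) by (auto simp: g_def less_Suc_eq)
  ultimately show ?case by blast
qed

text \<open>Density \<open>\<mu>\<close> forces at least a proportion \<open>\<mu> / 2\<close> of
  all \<open>y\<close> to have degree at least \<open>\<mu> / 2 * card X\<close>. The greedy choice
  is applied to these with \<open>\<nu> = \<mu> / 2\<close>.\<close>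

lemma dense_common_neighbours:
  fixes \<mu> \<kappa> :: real
  assumes fin: "finite X" "finite Y" and ne: "X \<noteq> {}"
    and dense: "\<mu> * card X * card Y \<le> card {(x, y) \<in> X \<times> Y. A x y}"
    and conf: "\<And>x y. x \<in> X \<Longrightarrow> y \<in> Y \<Longrightarrow> A x y \<Longrightarrow> card {x' \<in> X. C x x' y} \<le> \<kappa> * card X"
    and sym: "\<And>x x' y. C x x' y \<Longrightarrow> C x' x y"
    and N: "real N * \<kappa> \<le> \<mu> / 4" and \<mu>: "0 \<le> \<mu>" and \<kappa>: "0 \<le> \<kappa>"
  shows "\<exists>f. (\<forall>a<N. f a \<in> X) \<and> (\<mu> / 4) ^ Suc N * card Y \<le>
    card {y \<in> Y. (\<forall>a<N. A (f a) y) \<and> (\<forall>a<N. \<forall>b<N. a \<noteq> b \<longrightarrow> \<not> C (f a) (f b) y)}"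
proof -
  define Y' where "Y' = {y \<in> Y. \<mu> / 2 * card X \<le> card {x \<in> X. A x y}}"
  have cX: "0 < real (card X)" using fin ne by (simp add: card_gt_0_iff)
  have "{(x, y) \<in> X \<times> Y. A x y} = (\<lambda>(y, x). (x, y)) ` (SIGMA y:Y. {x \<in> X. A x y})" by auto
  then have "card {(x, y) \<in> X \<times> Y. A x y} = card (SIGMA y:Y. {x \<in> X. A x y})"
    by (simp add: card_image inj_on_def case_prod_beta prod_eq_iff)
  also have "\<dots> = (\<Sum>y\<in>Y. card {x \<in> X. A x y})" using fin by (intro card_SigmaI) auto
  finally have "real (card {(x, y) \<in> X \<times> Y. A x y}) = (\<Sum>y\<in>Y. real (card {x \<in> X. A x y}))"
    by simp
  \<comment> \<open>Members of \<open>Y'\<close> have degree at most \<open>card X\<close>, all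
    others at most \<open>\<mu> / 2 * card X\<close>.\<close>
  also have "\<dots> \<le> (\<Sum>y\<in>Y. (if y \<in> Y' then real (card X) else 0) + \<mu> / 2 * card X)"
  proof (intro sum_mono)
    fix y assume "y \<in> Y"
    moreover have "real (card {x \<in> X. A x y}) \<le> card X"
      using fin by (intro of_nat_mono card_mono) auto
    moreover have "0 \<le> \<mu> / 2 * card X" using \<mu> by simp
    ultimately show "real (card {x \<in> X. A x y}) \<le> (if y \<in> Y' then real (card X) else 0) + \<mu> / 2 * card X"
      by (auto simp: Y'_def)
  qed
  also have "\<dots> = card Y' * card X + \<mu> / 2 * card X * card Y"
  proof -
    have "(\<Sum>y\<in>Y. if y \<in> Y' then real (card X) else 0) = card Y' * card X"
      using fin by (simp add: sum.If_cases Y'_def Collect_conj_eq Int_assoc)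
    then show ?thesis by (simp add: sum.distrib)
  qed
  finally have "\<mu> * card X * card Y \<le> card Y' * card X + \<mu> / 2 * card X * card Y" using dense by linarith
  then have "card X * (\<mu> / 2 * card Y) \<le> card X * card Y'" by (simp add: algebra_simps)
  then have Y': "\<mu> / 2 * card Y \<le> card Y'" using cX by simp
  have "\<exists>f. (\<forall>a<N. f a \<in> X) \<and> (\<mu> / 2 / 2) ^ N * card Y' \<le>
    card {y \<in> Y'. (\<forall>a<N. A (f a) y) \<and> (\<forall>a<N. \<forall>b<N. a \<noteq> b \<longrightarrow> \<not> C (f a) (f b) y)}"
  proof (rule greedy_common_neighbours[OF fin(1) _ ne])
    show "real N * \<kappa> \<le> \<mu> / 2 / 2" using N by simp
  qed (use fin \<mu> \<kappa> sym conf in \<open>auto simp: Y'_def\<close>)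
  then obtain f where f: "\<forall>a<N. f a \<in> X" "(\<mu> / 4) ^ N * card Y' \<le>
    card {y \<in> Y'. (\<forall>a<N. A (f a) y) \<and> (\<forall>a<N. \<forall>b<N. a \<noteq> b \<longrightarrow> \<not> C (f a) (f b) y)}"
    by auto
  have "(\<mu> / 4) ^ Suc N * card Y \<le> (\<mu> / 4) ^ N * (\<mu> / 2 * card Y)"
    using \<mu> by (simp add: mult_ac mult_left_mono)
  also have "\<dots> \<le> (\<mu> / 4) ^ N * card Y'" using Y' \<mu> by (intro mult_left_mono) auto
  also note f(2)
  also have "real (card {y \<in> Y'. (\<forall>a<N. A (f a) y) \<and> (\<forall>a<N. \<forall>b<N. a \<noteq> b \<longrightarrow> \<not> C (f a) (f b) y)}) \<le>
    card {y \<in> Y. (\<forall>a<N. A (f a) y) \<and> (\<forall>a<N. \<forall>b<N. a \<noteq> b \<longrightarrow> \<not> C (f a) (f b) y)}"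
    using fin by (intro of_nat_mono card_mono) (auto simp: Y'_def)
  finally show ?thesis using f(1) by blast
qed

section \<open>Robust connections through common partners\<close>

context near_regular
begin

text \<open>Each ordered pair accounts for at most \<open>f l\<close> light paths, so at least
  \<open>\<mu> * card V * card V\<close> pairs are joined by one, and \<open>P u v\<close> is fixed
  for each such pair. \<open>dense_common_neighbours\<close> then yields \<open>N\<close> starts and
  many common partners \<open>v\<close> towards which the fixed paths meet only in \<open>v\<close>.
  The guards \<open>\<mu> \<le> 1\<close> are discharged because there are only
  \<open>card V * card V\<close> pairs.\<close>

lemma robust_clique_light:
  assumes l: "0 < l" and F: "1 \<le> f l"
    and many: "card V * d ^ l / 2 \<le> card {p \<in> all_walks l. p \<in> light E f l}"
    and \<mu>: "\<mu> = d ^ l / (2 * real (f l) * card V)"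
    and N: "\<mu> \<le> 1 \<Longrightarrow> real N * (real l * l * D ^ (l - 1)) \<le> \<mu> / 4 * card V"
    and M: "\<mu> \<le> 1 \<Longrightarrow> real M * (real (Suc l) * D ^ (l - 1)) < (\<mu> / 4) ^ Suc N * card V"
  shows "\<exists>U\<subseteq>V. card U = N \<and> (\<forall>u\<in>U. \<forall>u'\<in>U. u \<noteq> u' \<longrightarrow> robust E M (2 * l) u u')"
proof -
  have cV: "0 < real (card V)" using V_ne finV by (simp add: card_gt_0_iff)
  have D0: "0 \<le> D" using D1 by simp
  define L where "L = light E f l"
  define A where "A u v \<longleftrightarrow> joining L l u v \<noteq> {}" for u v
  define P where "P u v = (SOME p. p \<in> joining L l u v)" for u v
  have P: "P u v \<in> joining (paths E) l u v" if "A u v" for u v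
  proof -
    have "P u v \<in> joining L l u v" using that unfolding A_def P_def by (simp add: some_in_eq)
    then show ?thesis using light_paths by (auto simp: joining_def L_def)
  qed
  have Pl: "length (P u v) = Suc l" "P u v ! 0 = u" "P u v ! l = v" "distinct (P u v)" "set (P u v) \<subseteq> V"
    "walk E (P u v)" if "A u v" for u v
  proof -
    have p: "P u v \<in> paths E" "length (P u v) = Suc l" "hd (P u v) = u" "last (P u v) = v"
      using P[OF that] by (auto simp: joining_def)
    then have ne: "P u v \<noteq> []" by auto
    show "length (P u v) = Suc l" "P u v ! 0 = u" "P u v ! l = v" "distinct (P u v)" "walk E (P u v)"
      using p ne by (auto simp: paths_def hd_conv_nth last_conv_nth)
    show "set (P u v) \<subseteq> V"
      using paths_all_walks[OF p(1,2) l] walks_V by (auto simp: all_walks_def)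
  qed
  define J where "J = (\<lambda>(u, v). joining L l u v)"
  define R where "R = {(u, v) \<in> V \<times> V. A u v}"
  have finR: "finite R" by (rule finite_subset[of _ "V \<times> V"]) (use finV in \<open>auto simp: R_def\<close>)
  have finJ: "finite (J a)" for a by (cases a) (simp add: J_def L_def)
  have "{p \<in> all_walks l. p \<in> L} \<subseteq> (\<Union>a\<in>R. J a)"
  proof
    fix p assume p: "p \<in> {p \<in> all_walks l. p \<in> L}"
    then obtain u where u: "u \<in> V" "p \<in> walks E l u" by (auto simp: all_walks_def)
    then have "last p \<in> V" using walk_last_in_V by blast
    moreover have "p \<in> joining L l u (last p)" using p u by (auto simp: joining_def walks_def)
    ultimately show "p \<in> (\<Union>a\<in>R. J a)"
      using u(1) by (intro UN_I[of "(u, last p)"]) (auto simp: A_def R_def J_def)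
  qed
  then have "card {p \<in> all_walks l. p \<in> L} \<le> card (\<Union>a\<in>R. J a)"
    using finR finJ by (intro card_mono) auto
  also have "\<dots> \<le> (\<Sum>a\<in>R. card (J a))" using finR by (rule card_UN_le)
  also have "\<dots> \<le> (\<Sum>a\<in>R. f l)"
  proof (rule sum_mono)
    fix a show "card (J a) \<le> f l"
      using card_joining_light[OF l, of l f] by (cases a) (simp add: J_def L_def)
  qed
  also have "\<dots> = f l * card {(u, v) \<in> V \<times> V. A u v}" by (simp add: R_def)
  finally have "real (card {p \<in> all_walks l. p \<in> L}) \<le> f l * real (card {(u, v) \<in> V \<times> V. A u v})"
    by (simp flip: of_nat_mult)
  then have "card V * d ^ l / 2 \<le> f l * real (card {(u, v) \<in> V \<times> V. A u v})"
    using many by (simp add: L_def)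
  then have dense: "\<mu> * card V * card V \<le> card {(u, v) \<in> V \<times> V. A u v}"
    using F cV unfolding \<mu> by (simp add: field_simps)
  have "card {(u, v) \<in> V \<times> V. A u v} \<le> card (V \<times> V)" using finV by (intro card_mono) auto
  then have "real (card {(u, v) \<in> V \<times> V. A u v}) \<le> real (card V) * card V"
    by (simp only: card_cartesian_product flip: of_nat_mult of_nat_le_iff)
  then have "\<mu> * (real (card V) * card V) \<le> 1 * (real (card V) * card V)" using dense by (simp add: mult.assoc)
  then have \<mu>1: "\<mu> \<le> 1" using cV by (simp only: mult_le_cancel_right) simp
  define C where "C u u' v \<longleftrightarrow> A u v \<and> A u' v \<and> (\<exists>w. w \<noteq> v \<and> w \<in> set (P u v) \<and> w \<in> set (P u' v))" for u u' v
  define \<kappa> where "\<kappa> = real l * l * D ^ (l - 1) / card V"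
  have reach: "card (last ` walks E i w) \<le> D ^ (l - 1)" if "w \<in> V" "i < l" for w i
  proof -
    have "real (card (last ` walks E i w)) \<le> card (walks E i w)" by (simp add: card_image_le)
    also have "\<dots> \<le> D ^ i" using card_walks_le[OF that(1)] .
    also have "\<dots> \<le> D ^ (l - 1)" using D1 that by (intro power_increasing) auto
    finally show ?thesis .
  qed
  \<comment> \<open>A conflicting \<open>u'\<close> is the end of a walk with fewer than
    \<open>l\<close> edges from one of the \<open>l\<close> vertices of \<open>P u v\<close> other
    than \<open>v\<close>. This gives the two factors \<open>l\<close> in
    \<open>\<kappa>\<close>.\<close>
  have conf: "card {u' \<in> V. C u u' v} \<le> \<kappa> * card V" if "A u v" for u v
  proof -
    let ?W = "set (P u v) - {v}"
    have W: "card ?W = l" "?W \<subseteq> V" "v \<in> set (P u v)"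
      using Pl[OF that] distinct_card[of "P u v"] nth_mem[of l "P u v"] by auto
    have "{u' \<in> V. C u u' v} \<subseteq> (\<Union>w\<in>?W. \<Union>i<l. last ` walks E i w)"
    proof
      fix u' assume "u' \<in> {u' \<in> V. C u u' v}"
      then obtain w where w: "A u' v" "w \<noteq> v" "w \<in> set (P u v)" "w \<in> set (P u' v)"
        by (auto simp: C_def)
      obtain i where i: "i \<le> l" "P u' v ! i = w"
        using w(4) Pl(1)[OF w(1)] by (auto simp: in_set_conv_nth less_Suc_eq_le)
      have "i < l" using i Pl(3)[OF w(1)] w(2) by (metis le_neq_implies_less)
      let ?q = "rev (take (Suc i) (P u' v))"
      have "last (take (Suc i) (P u' v)) = w"
        using i Pl(1)[OF w(1)] by (subst last_conv_nth) auto
      moreover have "walk E ?q"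
        using Pl(6)[OF w(1)] by (intro walk_rev symE) (auto intro: walk_sublist)
      ultimately have "?q \<in> walks E i w" using i Pl(1)[OF w(1)] by (auto simp: walks_def hd_rev)
      moreover have "last ?q = u'"
        using Pl(1,2)[OF w(1)] by (auto simp: last_rev hd_conv_nth simp flip: length_0_conv)
      ultimately have "u' \<in> last ` walks E i w" by (metis imageI)
      then show "u' \<in> (\<Union>w\<in>?W. \<Union>i<l. last ` walks E i w)"
        using w \<open>i < l\<close> by blast
    qed
    then have "card {u' \<in> V. C u u' v} \<le> card (\<Union>w\<in>?W. \<Union>i<l. last ` walks E i w)"
      by (intro card_mono) auto
    also have "\<dots> \<le> (\<Sum>w\<in>?W. card (\<Union>i<l. last ` walks E i w))" by (rule card_UN_le) simp
    also have "\<dots> \<le> (\<Sum>w\<in>?W. \<Sum>i<l. card (last ` walks E i w))" by (intro sum_mono card_UN_le) simp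
    finally have "real (card {u' \<in> V. C u u' v}) \<le> (\<Sum>w\<in>?W. \<Sum>i<l. real (card (last ` walks E i w)))"
      by (simp flip: of_nat_sum)
    also have "\<dots> \<le> (\<Sum>w\<in>?W. \<Sum>i<l. D ^ (l - 1))"
      using reach W(2) by (intro sum_mono) auto
    also have "\<dots> = \<kappa> * card V" using cV W(1) by (simp add: \<kappa>_def)
    finally show ?thesis .
  qed
  have "\<exists>g. (\<forall>a<N. g a \<in> V) \<and> (\<mu> / 4) ^ Suc N * card V \<le>
    card {v \<in> V. (\<forall>a<N. A (g a) v) \<and> (\<forall>a<N. \<forall>b<N. a \<noteq> b \<longrightarrow> \<not> C (g a) (g b) v)}"
  proof (rule dense_common_neighbours[OF finV finV V_ne dense])
    show "real N * \<kappa> \<le> \<mu> / 4" using N[OF \<mu>1] cV by (simp add: \<kappa>_def field_simps)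
    show "0 \<le> \<mu>" "0 \<le> \<kappa>" using d1 D0 by (simp_all add: \<mu> \<kappa>_def)
    show "\<And>x x' y. C x x' y \<Longrightarrow> C x' x y" by (auto simp: C_def)
  qed (use conf in auto)
  then obtain g where g: "\<forall>a<N. g a \<in> V" "(\<mu> / 4) ^ Suc N * card V \<le>
    card {v \<in> V. (\<forall>a<N. A (g a) v) \<and> (\<forall>a<N. \<forall>b<N. a \<noteq> b \<longrightarrow> \<not> C (g a) (g b) v)}" by blast
  define Q where "Q = {v \<in> V. (\<forall>a<N. A (g a) v) \<and> (\<forall>a<N. \<forall>b<N. a \<noteq> b \<longrightarrow> \<not> C (g a) (g b) v)}"
  have finQ: "finite Q" using finV by (simp add: Q_def)
  have cQ: "real M * (real (Suc l) * D ^ (l - 1)) < card Q" using M[OF \<mu>1] g(2) by (simp add: Q_def)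
  have disj: "w = v" if "v \<in> Q" "a < N" "b < N" "a \<noteq> b" "w \<in> set (P (g a) v)" "w \<in> set (P (g b) v)" for a b v w
    using that by (auto simp: Q_def C_def)
  have neq: "g a \<noteq> v" if "v \<in> Q" "a < N" for a v
  proof
    assume "g a = v"
    moreover have "A (g a) v" using that by (simp add: Q_def)
    ultimately show False using Pl[of "g a" v] l by (metis less_Suc_eq nth_eq_iff_index_eq zero_less_Suc less_numeral_extra(3))
  qed
  have start: "g a \<in> set (P (g a) v)" if "v \<in> Q" "a < N" for a v
    using P[of "g a" v] that joining_ends by (fastforce simp: Q_def)
  have "Q \<noteq> {}"
  proof
    assume "Q = {}"
    then have "real M * (real (Suc l) * D ^ (l - 1)) < 0" using cQ by simp
    moreover have "0 \<le> real M * (real (Suc l) * D ^ (l - 1))" using D0 by simp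
    ultimately show False by linarith
  qed
  then obtain v0 where v0: "v0 \<in> Q" by blast
  \<comment> \<open>A start lies on its own path to \<open>v0\<close> and differs from
    \<open>v0\<close>, so two equal starts would be in conflict.\<close>
  have inj: "inj_on g {..<N}"
  proof (rule inj_onI)
    fix a b assume "a \<in> {..<N}" "b \<in> {..<N}" "g a = g b"
    then show "a = b" using disj[OF v0, of a b "g a"] start[OF v0, of a] neq[OF v0, of a] by auto
  qed
  have "robust E M (2 * l) (g a) (g b)" if ab: "a < N" "b < N" "a \<noteq> b" for a b
    unfolding robust_def
  proof (intro allI impI)
    fix Z :: "'a set" assume Z: "finite Z \<and> card Z \<le> M"
    \<comment> \<open>If a vertex of \<open>Z\<close> lies on a fixed path to \<open>v\<close> after
      its start, then \<open>v\<close> is the end of a walk with fewer than \<open>l\<close> edges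
      from that vertex. Partners outside \<open>Bad\<close> are therefore safe.\<close>
    define Bad where "Bad = Z \<union> (\<Union>z\<in>Z \<inter> V. \<Union>i<l. last ` walks E i z)"
    have "card Bad \<le> card Z + (\<Sum>z\<in>Z \<inter> V. \<Sum>i<l. card (last ` walks E i z))"
    proof -
      have "card (\<Union>z\<in>Z \<inter> V. \<Union>i<l. last ` walks E i z) \<le> (\<Sum>z\<in>Z \<inter> V. card (\<Union>i<l. last ` walks E i z))"
        using Z by (intro card_UN_le) simp
      also have "\<dots> \<le> (\<Sum>z\<in>Z \<inter> V. \<Sum>i<l. card (last ` walks E i z))" by (intro sum_mono card_UN_le) simp
      finally show ?thesis unfolding Bad_def
        using card_Un_le[of Z "\<Union>z\<in>Z \<inter> V. \<Union>i<l. last ` walks E i z"] by linarith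
    qed
    then have "real (card Bad) \<le> card Z + (\<Sum>z\<in>Z \<inter> V. \<Sum>i<l. real (card (last ` walks E i z)))"
      by (simp flip: of_nat_sum of_nat_add)
    also have "\<dots> \<le> card Z + (\<Sum>z\<in>Z \<inter> V. \<Sum>i<l. D ^ (l - 1))"
      using reach by (intro add_left_mono sum_mono) auto
    also have "\<dots> = card Z + card (Z \<inter> V) * (l * D ^ (l - 1))" by simp
    also have "\<dots> \<le> M * D ^ (l - 1) + M * (l * D ^ (l - 1))"
    proof (rule add_mono)
      have "1 \<le> D ^ (l - 1)" using D1 by simp
      then show "real (card Z) \<le> M * D ^ (l - 1)"
        using Z mult_mono[of "real (card Z)" "real M" 1 "D ^ (l - 1)"] by simp
      have "card (Z \<inter> V) \<le> M" using Z card_mono[of Z "Z \<inter> V"] by simp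
      then show "card (Z \<inter> V) * (l * D ^ (l - 1)) \<le> M * (l * D ^ (l - 1))"
        using D0 by (intro mult_right_mono) auto
    qed
    also have "\<dots> = real M * (real (Suc l) * D ^ (l - 1))" by (simp add: algebra_simps)
    finally have "card Bad < card Q" using cQ by linarith
    moreover have "finite Bad" using Z by (auto simp: Bad_def)
    ultimately obtain v where v: "v \<in> Q" "v \<notin> Bad"
      using card_mono[of Bad Q] by (meson leD subsetI)
    have avoid: "set (P (g c) v) \<inter> Z \<subseteq> {g c}" if "c < N" for c
    proof
      fix z assume z: "z \<in> set (P (g c) v) \<inter> Z"
      have Ac: "A (g c) v" using v(1) that by (simp add: Q_def)
      note p = Pl[OF Ac]
      obtain i where i: "i \<le> l" "P (g c) v ! i = z"
        using z p(1) by (auto simp: in_set_conv_nth less_Suc_eq_le)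
      have "i = 0"
      proof (rule ccontr)
        assume i0: "i \<noteq> 0"
        have "drop i (P (g c) v) \<in> walks E (l - i) z"
          using p i by (auto simp: walks_def hd_drop_conv_nth intro: walk_sublist)
        moreover have "last (drop i (P (g c) v)) = v" using p i by (auto simp: last_conv_nth)
        moreover have "z \<in> Z \<inter> V" using z p(5) by auto
        ultimately have "v \<in> last ` walks E (l - i) z" "z \<in> Z \<inter> V" by (metis imageI)+
        moreover have "l - i \<in> {..<l}" using i0 l by simp
        ultimately have "v \<in> Bad" unfolding Bad_def by blast
        then show False using v(2) by simp
      qed
      then show "z \<in> {g c}" using i p(2) by simp
    qed
    have Aab: "A (g a) v" "A (g b) v" using v(1) ab by (auto simp: Q_def)
    have "P (g a) v @ tl (rev (P (g b) v)) \<in> joining (paths E) (l + l) (g a) (g b)"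
      using P Aab disj[OF v(1) ab] joining_paths_rev[OF symE]
      by (intro joining_paths_append[of _ _ _ _ v]) auto
    moreover have "set (P (g a) v @ tl (rev (P (g b) v))) \<inter> Z \<subseteq> {g a, g b}"
    proof -
      have "set (tl (rev (P (g b) v))) \<subseteq> set (P (g b) v)"
        by (metis list.set_sel(2) list.sel(2) set_rev subsetI)
      then show ?thesis using avoid[OF ab(1)] avoid[OF ab(2)] by auto
    qed
    ultimately show "\<exists>p\<in>joining (paths E) (2 * l) (g a) (g b). set p \<inter> Z \<subseteq> {g a, g b}"
      by (metis mult_2)
  qed
  then show ?thesis
    using g(1) inj by (intro exI[of _ "g ` {..<N}"]) (auto simp: card_image)
qed

end

section \<open>Many heavy paths\<close>

text \<open>A leg \<open>\<gamma>\<close> is listed from \<open>z\<close> outwards, so \<open>rev \<gamma> @ [c]\<close> runs from its far end through \<open>z\<close>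
  to the neighbour \<open>c\<close>. The chosen legs \<open>\<beta> a\<close> agree only in \<open>z\<close>, and by assumption \<open>ext\<close> each
  of their initial segments can be continued in many ways.\<close>

locale heavy_centre = near_regular V E d D
  for V :: "'a set" and E :: "('a \<times> 'a) set" and d D :: real +
  fixes f :: "nat \<Rightarrow> nat" and j F N M0 M1 M3 S K T T' :: nat
    and z :: 'a and \<beta> :: "nat \<Rightarrow> 'a list" and Q :: "'a set" and \<rho> \<sigma> :: real
  assumes j2: "2 \<le> j" and zV: "z \<in> V" and Q: "Q \<subseteq> E `` {z}" and cQ: "\<sigma> * D \<le> card Q"
    and \<rho>: "0 < \<rho>" and \<sigma>: "0 < \<sigma>"
    and \<beta>: "a < N \<Longrightarrow> \<beta> a \<in> walks E (j - 1) z"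
    and link: "a < N \<Longrightarrow> c \<in> Q \<Longrightarrow> rev (\<beta> a) @ [c] \<in> heavy E f j"
    and branches: "a < N \<Longrightarrow> b < N \<Longrightarrow> a \<noteq> b \<Longrightarrow> 0 < g \<Longrightarrow> g < j \<Longrightarrow> \<beta> a ! g \<noteq> \<beta> b ! g"
    and ext: "a < N \<Longrightarrow> c \<in> Q \<Longrightarrow> g < j \<Longrightarrow> \<rho> * D ^ (j - 1 - g) \<le>
      card {\<gamma> \<in> walks E (j - 1) z. take (Suc g) \<gamma> = take (Suc g) (\<beta> a) \<and> rev \<gamma> @ [c] \<in> heavy E f j}"
    and F: "i < j \<Longrightarrow> f i \<le> F" and F1: "1 \<le> F"
    and f0: "M0 * j * F * F \<le> f j"
    and f1: "2 * T * j * F * F \<le> f j"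
    and f2: "4 * real ((Suc M3 * j + 1) ^ j) * F < \<sigma> * \<rho> * f j"
    and M0: "M1 + 2 * j + 2 \<le> M0" and M1: "M3 + j + 1 + S * K \<le> M1"
    and K: "2 * j * S + 2 * j + 2 \<le> K"
    and N: "M1 + 1 < N"
    and Dlarge: "real (M1 + 1) * j < \<rho> * D" "real (M1 + 2) < \<sigma> * D" "2 * real T \<le> \<sigma> * D"
    and T: "j * T' \<le> T" and T': "T' < real M1"
begin

text \<open>The far end of a leg is the head of the reversed list, and \<open>f0\<close> is what
  \<open>heavy_robust\<close> demands for the budget \<open>M0\<close>.\<close>

lemma heavy_legs_robust:
  assumes "rev \<gamma> @ [c] \<in> heavy E f j"
  shows "robust E M0 j (last \<gamma>) c"
proof -
  have "length \<gamma> = j" using assms by (auto simp: heavy_def)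
  then have "\<gamma> \<noteq> []" using j2 by auto
  then show ?thesis
    using heavy_robust[OF assms F f0] by (simp add: hd_append hd_rev)
qed

lemma heavy_path: "p \<in> heavy E f j \<Longrightarrow> p \<in> paths E"
  using light_paths by (auto simp: heavy_def)

lemma finite_Q: "finite Q"
  using Q finite_nbrs by (rule finite_subset)

lemma card_Q: "M1 + 2 < card Q"
  using cQ Dlarge(2) by linarith

lemma leg_length: "a < N \<Longrightarrow> length (\<beta> a) = j"
  using \<beta>[of a] j2 by (auto simp: walks_def)

lemma leg_not_end: "a < N \<Longrightarrow> c \<in> Q \<Longrightarrow> g < j \<Longrightarrow> \<beta> a ! g \<noteq> c"
  using heavy_path[OF link[of a c]] leg_length[of a] by (auto simp: paths_def)

text \<open>The leg is kept up to position \<open>g\<close> and continued from there by one of the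
  many continuations that \<open>ext\<close> provides, chosen to avoid \<open>Z\<close>. The far end
  of the new leg is robustly connected to \<open>c\<close> by paths of length
  \<open>j\<close>.\<close>

lemma robust_leg:
  assumes a: "a < N" and c: "c \<in> Q" and g: "g < j"
  shows "robust E M1 (j + (j - 1 - g)) c (\<beta> a ! g)"
proof (rule robust_extend[where M' = M0])
  show "c \<noteq> \<beta> a ! g" using leg_not_end[OF a c g] by simp
  show "M1 + (j - 1 - g) + 1 \<le> M0" using M0 by simp
  fix Z :: "'a set" assume Z: "finite Z" "card Z \<le> Suc M1"
  let ?r = "take (Suc g) (\<beta> a)"
  define G where "G = {\<gamma> \<in> walks E (j - 1) z. take (Suc g) \<gamma> = ?r \<and> rev \<gamma> @ [c] \<in> heavy E f j}"
  define B where "B = {\<gamma> \<in> walks E (j - 1) z. take (Suc g) \<gamma> = ?r \<and> (\<exists>i. g < i \<and> i \<le> j - 1 \<and> \<gamma> ! i \<in> Z)}"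
  have r: "?r \<in> walks E g z" using walks_take[OF \<beta>[OF a]] g by simp
  have B: "card B \<le> card Z * real (j - 1 - g) * D ^ (j - 1 - g - 1)"
    using walk_prefix_count[OF zV r _ Z(1), of "j - 1"] g by (simp add: B_def)
  \<comment> \<open>Meeting \<open>Z\<close> beyond position \<open>g\<close> costs a factor
    \<open>D\<close>, which outweighs \<open>\<rho>\<close> by the first bound in
    \<open>Dlarge\<close>. If \<open>g = j - 1\<close>, nothing lies beyond and \<open>B\<close> is
    empty.\<close>
  have "card B < \<rho> * D ^ (j - 1 - g)"
  proof (cases "j - 1 - g")
    case 0
    then show ?thesis using B \<rho> by simp
  next
    case (Suc n)
    have "card Z * real (j - 1 - g) \<le> real (M1 + 1) * j"
      using Z by (intro mult_mono) auto
    then have "card Z * real (j - 1 - g) < \<rho> * D" using Dlarge(1) by linarith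
    then have "card Z * real (j - 1 - g) * D ^ n < \<rho> * D * D ^ n"
      using D1 by (intro mult_strict_right_mono) auto
    moreover have "\<rho> * D ^ (j - 1 - g) = \<rho> * D * D ^ n" unfolding Suc by simp
    moreover have "card B \<le> card Z * real (j - 1 - g) * D ^ n" using B unfolding Suc by simp
    ultimately show ?thesis by linarith
  qed
  also have "\<dots> \<le> card G" using ext[OF a c g] by (simp add: G_def)
  finally have "card B < card G" by simp
  moreover have "finite B" by (simp add: B_def)
  ultimately have "\<not> G \<subseteq> B" using card_mono[of B G] by (auto simp: not_le)
  then obtain \<gamma> where \<gamma>: "\<gamma> \<in> walks E (j - 1) z" "take (Suc g) \<gamma> = ?r" "rev \<gamma> @ [c] \<in> heavy E f j"
    "\<And>i. g < i \<Longrightarrow> i \<le> j - 1 \<Longrightarrow> \<gamma> ! i \<notin> Z" unfolding G_def B_def by blast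
  have l: "length \<gamma> = j" using \<gamma>(1) j2 by (auto simp: walks_def)
  have \<gamma>g: "\<gamma> ! g = \<beta> a ! g"
    using \<gamma>(2) by (metis lessI nth_take)
  let ?q = "rev (drop g \<gamma>)"
  have "rev \<gamma> \<in> paths E"
    using paths_sublist[OF heavy_path[OF \<gamma>(3)], of "rev \<gamma>"] l j2 by (auto simp flip: length_0_conv)
  moreover have "\<gamma> \<noteq> []" using l j2 by auto
  ultimately have "?q \<in> paths E"
    using paths_sublist[of "rev \<gamma>" E ?q] l g by (auto simp: rev_drop sublist_take)
  moreover have "last ?q = \<beta> a ! g" using l g \<gamma>g by (simp add: last_rev hd_drop_conv_nth)
  moreover have "hd ?q = last \<gamma>" using l g by (simp add: hd_rev)
  ultimately have q: "?q \<in> joining (paths E) (j - 1 - g) (last \<gamma>) (\<beta> a ! g)"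
    using l g by (simp add: joining_def)
  have "set ?q \<inter> Z \<subseteq> {\<beta> a ! g}"
  proof
    fix w assume w: "w \<in> set ?q \<inter> Z"
    then obtain i where i: "i < j - g" "w = \<gamma> ! (g + i)" using l by (auto simp: in_set_conv_nth)
    then show "w \<in> {\<beta> a ! g}" using \<gamma>(4)[of "g + i"] \<gamma>g w by (cases "i = 0") auto
  qed
  then show "\<exists>w q. q \<in> joining (paths E) (j - 1 - g) w (\<beta> a ! g) \<and> set q \<inter> Z \<subseteq> {\<beta> a ! g} \<and> robust E M0 j c w"
    using q robust_sym[OF symE heavy_legs_robust[OF \<gamma>(3)]] by blast
qed

text \<open>The far ends of the \<open>N\<close> legs are distinct and more numerous than
  \<open>Z\<close>, so one of them can serve as midpoint between \<open>c\<close> and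
  \<open>c'\<close>.\<close>

lemma robust_Q:
  assumes "c \<in> Q" "c' \<in> Q" "c \<noteq> c'"
  shows "robust E M1 (j + j) c c'"
proof (rule robust_trans[where M' = M0])
  show "c \<noteq> c'" by fact
  show "M1 + j + 2 \<le> M0" using M0 by simp
  fix Z :: "'a set" assume Z: "finite Z" "card Z \<le> M1 + 1"
  have "inj_on (\<lambda>a. \<beta> a ! (j - 1)) {..<N}"
  proof (rule inj_onI)
    fix a b assume "a \<in> {..<N}" "b \<in> {..<N}" "\<beta> a ! (j - 1) = \<beta> b ! (j - 1)"
    then show "a = b" using branches[of a b "j - 1"] j2 by auto
  qed
  then have "card ((\<lambda>a. \<beta> a ! (j - 1)) ` {..<N}) = N" by (simp add: card_image)
  then have "card Z < card ((\<lambda>a. \<beta> a ! (j - 1)) ` {..<N})" using Z(2) N by linarith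
  then have "\<not> (\<lambda>a. \<beta> a ! (j - 1)) ` {..<N} \<subseteq> Z" using card_mono[OF Z(1)] leD by blast
  then obtain a where a: "a < N" "\<beta> a ! (j - 1) \<notin> Z" by auto
  have "last (\<beta> a) = \<beta> a ! (j - 1)" using leg_length[OF a(1)] j2 by (subst last_conv_nth) auto
  then show "\<exists>w. w \<notin> Z \<and> robust E M0 j c w \<and> robust E M0 j w c'"
    using a heavy_legs_robust[OF link[OF a(1) assms(1)]] heavy_legs_robust[OF link[OF a(1) assms(2)]]
      robust_sym[OF symE] by metis
qed

text \<open>Every step first moves from \<open>c\<close> to a fresh \<open>c'\<close> in
  \<open>Q\<close>, adding length \<open>2 * j\<close>. It costs at most \<open>K\<close> of the
  budget, since \<open>K\<close> exceeds by at least 2 the length of the connection still to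
  follow.\<close>

lemma robust_zigzag:
  assumes a: "a < N" and g: "g < j"
  shows "s \<le> S \<Longrightarrow> M + s * K \<le> M1 \<Longrightarrow> c \<in> Q \<Longrightarrow> robust E M (s * (j + j) + (j + (j - 1 - g))) c (\<beta> a ! g)"
proof (induction s arbitrary: M c)
  case 0
  then show ?case using robust_mono[OF robust_leg[OF a _ g]] by simp
next
  case (Suc s)
  let ?n = "s * (j + j) + (j + (j - 1 - g))"
  have "s * (j + j) \<le> S * (j + j)" using Suc.prems by (intro mult_right_mono) auto
  then have n: "?n + 2 \<le> K" using K by (simp add: algebra_simps)
  have "robust E M ((j + j) + ?n) c (\<beta> a ! g)"
  proof (rule robust_trans[where M' = "M + K"])
    show "c \<noteq> \<beta> a ! g" using leg_not_end[OF a _ g] Suc.prems by metis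
    show "M + ?n + 2 \<le> M + K" using n by simp
    fix Z :: "'a set" assume Z: "finite Z" "card Z \<le> M + 1"
    have "card (insert c Z) \<le> M1 + 2" using Z Suc.prems(2) by (simp add: card_insert_if)
    then have "\<not> Q \<subseteq> insert c Z" using card_Q card_mono[of "insert c Z" Q] Z by auto
    then obtain c' where c': "c' \<in> Q" "c' \<noteq> c" "c' \<notin> Z" by auto
    have "robust E (M + K) (j + j) c c'"
      using robust_mono[OF robust_Q] c' Suc.prems by simp
    moreover have "robust E (M + K) ?n c' (\<beta> a ! g)"
      using Suc.IH[of "M + K" c'] Suc.prems c' by simp
    ultimately show "\<exists>w. w \<notin> Z \<and> robust E (M + K) (j + j) c w \<and> robust E (M + K) ?n w (\<beta> a ! g)"
      using c' by blast
  qed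
  then show ?case by (simp add: algebra_simps)
qed

section \<open>Hubs and their number\<close>

definition hub :: "nat \<Rightarrow> 'a \<Rightarrow> bool" where
  "hub g w \<longleftrightarrow> (\<forall>Z. finite Z \<and> card Z \<le> Suc M3 \<longrightarrow>
     (\<exists>c\<in>Q. \<exists>q\<in>joining (paths E) g c w. set q \<inter> Z \<subseteq> {w}))"

definition hubs :: "'a set" where
  "hubs = {w. \<exists>g. 0 < g \<and> g < j \<and> hub g w}"

text \<open>Only tails without hubs are counted, so each vertex of such a tail, including
  \<open>w\<close>, fails to be a hub for every length. This makes the recursion on \<open>g\<close>
  possible.\<close>

definition sources :: "nat \<Rightarrow> 'a \<Rightarrow> 'a set" where
  "sources g w = {c \<in> Q. \<exists>q\<in>joining (paths E) g c w. set q \<inter> hubs = {}}"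

lemma hub_in_V: "hub g w \<Longrightarrow> w \<in> V"
proof -
  assume "hub g w"
  then obtain c q where q: "c \<in> Q" "q \<in> joining (paths E) g c w"
    unfolding hub_def by (metis card.empty finite.emptyI le0)
  have "c \<in> V" using q(1) Q EV by auto
  moreover have "q \<in> walks E g c" using q(2) joining_paths_walks by blast
  ultimately show "w \<in> V" using walk_last_in_V q(2) by (auto simp: joining_def)
qed

lemma finite_hubs: "finite hubs"
  by (rule finite_subset[OF _ finV]) (auto simp: hubs_def hub_in_V)

text \<open>If \<open>w\<close> is not a hub, some set \<open>Z\<close> of at most
  \<open>Suc M3\<close> vertices meets every tail with \<open>g\<close> edges from \<open>Q\<close>
  to \<open>w\<close> outside \<open>w\<close>. Cutting a tail at such a vertex \<open>y\<close>
  makes its start a source of \<open>y\<close> for a smaller length, and induction applies to each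
  of the at most \<open>Suc M3 * j\<close> pairs of vertex and length.\<close>

lemma card_sources: "g < j \<Longrightarrow> card (sources g w) \<le> (Suc M3 * j + 1) ^ g"
proof (induction g arbitrary: w rule: less_induct)
  case (less g)
  show ?case
  proof (cases "g = 0")
    case True
    have "sources 0 w \<subseteq> {w}"
    proof
      fix c assume "c \<in> sources 0 w"
      then obtain q where "length q = Suc 0" "hd q = c" "last q = w"
        by (auto simp: sources_def joining_def)
      then show "c \<in> {w}" by (cases q) auto
    qed
    then show ?thesis using True card_mono[of "{w}" "sources 0 w"] by simp
  next
    case False
    show ?thesis
    proof (cases "w \<in> hubs")
      case True
      then have "sources g w = {}" using joining_ends by (fastforce simp: sources_def)
      then show ?thesis by simp
    next
      case nh: False
      then have "\<not> hub g w" using less.prems False by (auto simp: hubs_def)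
      then obtain Z where Z: "finite Z" "card Z \<le> Suc M3"
        "\<And>c q. c \<in> Q \<Longrightarrow> q \<in> joining (paths E) g c w \<Longrightarrow> \<not> set q \<inter> Z \<subseteq> {w}"
        unfolding hub_def by blast
      have "sources g w \<subseteq> (\<Union>y\<in>Z. \<Union>i<g. sources i y)"
      proof
        fix c assume "c \<in> sources g w"
        then obtain q where q: "c \<in> Q" "q \<in> joining (paths E) g c w" "set q \<inter> hubs = {}"
          by (auto simp: sources_def)
        then obtain y where y: "y \<in> set q" "y \<in> Z" "y \<noteq> w" using Z(3)[OF q(1,2)] by blast
        have ql: "length q = Suc g" "hd q = c" "last q = w" "q \<in> paths E"
          using q(2) by (auto simp: joining_def)
        then obtain i where i: "i \<le> g" "q ! i = y" using y(1) by (auto simp: in_set_conv_nth less_Suc_eq_le)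
        have "q ! g = w" using ql by (metis diff_Suc_1 last_conv_nth length_0_conv nat.distinct(1))
        then have "i < g" using i y(3) by (metis le_neq_implies_less)
        let ?q = "take (Suc i) q"
        have "?q \<in> paths E" using paths_sublist[OF ql(4), of ?q] ql(1) by (auto simp: sublist_take simp flip: length_0_conv)
        moreover have "last ?q = y" using i ql by (subst last_conv_nth) auto
        ultimately have "?q \<in> joining (paths E) i c y" using ql i by (auto simp: joining_def)
        moreover have "set ?q \<inter> hubs = {}" using q(3) set_take_subset[of "Suc i" q] by blast
        ultimately have "c \<in> sources i y" using q(1) by (auto simp: sources_def)
        then show "c \<in> (\<Union>y\<in>Z. \<Union>i<g. sources i y)" using y(2) \<open>i < g\<close> by blast
      qed
      then have "card (sources g w) \<le> card (\<Union>y\<in>Z. \<Union>i<g. sources i y)"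
        using Z(1) finite_Q by (intro card_mono) (auto simp: sources_def)
      also have "\<dots> \<le> (\<Sum>y\<in>Z. card (\<Union>i<g. sources i y))" using Z(1) by (rule card_UN_le)
      also have "\<dots> \<le> (\<Sum>y\<in>Z. \<Sum>i<g. card (sources i y))" by (intro sum_mono card_UN_le) simp
      also have "\<dots> \<le> (\<Sum>y\<in>Z. \<Sum>i<g. (Suc M3 * j + 1) ^ (g - 1))"
      proof (intro sum_mono)
        fix y i assume "i \<in> {..<g}"
        then have "card (sources i y) \<le> (Suc M3 * j + 1) ^ i" using less by simp
        also have "\<dots> \<le> (Suc M3 * j + 1) ^ (g - 1)" using \<open>i \<in> {..<g}\<close> by (intro power_increasing) auto
        finally show "card (sources i y) \<le> (Suc M3 * j + 1) ^ (g - 1)" .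
      qed
      also have "\<dots> = (card Z * g) * (Suc M3 * j + 1) ^ (g - 1)" by simp
      also have "\<dots> \<le> (Suc M3 * j + 1) * (Suc M3 * j + 1) ^ (g - 1)"
      proof (rule mult_right_mono)
        have "card Z * g \<le> Suc M3 * j" using Z(2) less.prems by (intro mult_le_mono) auto
        then show "card Z * g \<le> Suc M3 * j + 1" by simp
      qed simp
      also have "\<dots> = (Suc M3 * j + 1) ^ g" using False by (cases g) auto
      finally show ?thesis .
    qed
  qed
qed

text \<open>Otherwise count triples of a neighbour \<open>c\<close> that is not a hub, a heavy leg
  for \<open>c\<close>, and an alternative path between their ends without hubs inside. Heaviness
  gives many of them. On the other hand the leg and the second vertex of the alternative leave few
  choices for \<open>c\<close> by \<open>card_sources\<close>, and few light paths from there to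
  \<open>c\<close>.\<close>

lemma many_hubs: "T < card hubs"
proof (rule ccontr)
  assume "\<not> T < card hubs"
  then have T: "card hubs \<le> T" by simp
  define L where "L = light E f (j - 1)"
  define B where "B c = {\<gamma> \<in> walks E (j - 1) z. rev \<gamma> @ [c] \<in> heavy E f j}" for c
  define Alt where "Alt c \<gamma> = {p \<in> joining L j (last \<gamma>) c. \<forall>i. 0 < i \<and> i < j \<longrightarrow> p ! i \<notin> hubs}" for c \<gamma>
  have N0: "0 < N" using N by simp
  have finB: "finite (B c)" and finAlt: "finite (Alt c \<gamma>)" for c \<gamma>
    by (simp_all add: B_def Alt_def L_def)
  have cB: "\<rho> * D ^ (j - 1) \<le> card (B c)" if "c \<in> Q" for c
  proof -
    have "{\<gamma> \<in> walks E (j - 1) z. take (Suc 0) \<gamma> = take (Suc 0) (\<beta> 0) \<and> rev \<gamma> @ [c] \<in> heavy E f j} \<subseteq> B c"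
      by (auto simp: B_def)
    then have "real (card {\<gamma> \<in> walks E (j - 1) z. take (Suc 0) \<gamma> = take (Suc 0) (\<beta> 0) \<and> rev \<gamma> @ [c] \<in> heavy E f j})
      \<le> card (B c)" using finB by (intro of_nat_mono card_mono)
    then show ?thesis using ext[OF N0 that, of 0] j2 by simp
  qed
  \<comment> \<open>At most \<open>T * j * F * F\<close> alternatives meet a hub inside, which is at
    most half of \<open>f j\<close> by \<open>f1\<close>.\<close>
  have cAlt: "real (f j) / 2 \<le> card (Alt c \<gamma>)" if "c \<in> Q" "\<gamma> \<in> B c" for c \<gamma>
  proof -
    have h: "rev \<gamma> @ [c] \<in> heavy E f j" "\<gamma> \<noteq> []" using that j2 by (auto simp: B_def walks_def)
    have "f j < card (joining L j (last \<gamma>) c)"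
      using h by (simp add: heavy_def L_def hd_append hd_rev)
    also have "\<dots> \<le> card (Alt c \<gamma> \<union> {p \<in> joining L j (last \<gamma>) c. \<exists>i. 0 < i \<and> i < j \<and> p ! i \<in> hubs})"
      using finAlt by (intro card_mono) (auto simp: Alt_def L_def)
    also have "\<dots> \<le> card (Alt c \<gamma>) + card {p \<in> joining L j (last \<gamma>) c. \<exists>i. 0 < i \<and> i < j \<and> p ! i \<in> hubs}"
      by (rule card_Un_le)
    also have "card {p \<in> joining L j (last \<gamma>) c. \<exists>i. 0 < i \<and> i < j \<and> p ! i \<in> hubs} \<le> card hubs * j * F * F"
      unfolding L_def by (rule light_through_card[OF F finite_hubs])
    also have "\<dots> \<le> T * j * F * F" using T by (intro mult_le_mono) auto
    finally have "f j < card (Alt c \<gamma>) + T * j * F * F" by simp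
    then have "2 * f j < 2 * card (Alt c \<gamma>) + 2 * T * j * F * F" by simp
    then have "f j \<le> 2 * card (Alt c \<gamma>)" using f1 by linarith
    then show ?thesis by simp
  qed
  define X where "X = (SIGMA c:Q - hubs. SIGMA \<gamma>:B c. Alt c \<gamma>)"
  define Y where "Y = (SIGMA \<gamma>:walks E (j - 1) z. SIGMA v:E `` {last \<gamma>}. SIGMA c:sources (j - 1) v. joining L (j - 1) v c)"
  have "(\<sigma> * D / 2) * (\<rho> * D ^ (j - 1) * (f j / 2)) \<le> card X"
  proof -
    have "card X = (\<Sum>c\<in>Q - hubs. \<Sum>\<gamma>\<in>B c. card (Alt c \<gamma>))"
      unfolding X_def using finite_Q finB finAlt by simp
    then have cX: "real (card X) = (\<Sum>c\<in>Q - hubs. \<Sum>\<gamma>\<in>B c. real (card (Alt c \<gamma>)))" by simp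
    have "card Q - card hubs \<le> card (Q - hubs)" by (rule diff_card_le_card_Diff[OF finite_hubs])
    then have "\<sigma> * D / 2 \<le> card (Q - hubs)" using cQ T Dlarge(3) by linarith
    then have "(\<sigma> * D / 2) * (\<rho> * D ^ (j - 1) * (f j / 2)) \<le> card (Q - hubs) * (\<rho> * D ^ (j - 1) * (f j / 2))"
      using \<rho> D1 by (intro mult_right_mono) auto
    also have "\<dots> = (\<Sum>c\<in>Q - hubs. \<rho> * D ^ (j - 1) * (f j / 2))" by simp
    also have "\<dots> \<le> (\<Sum>c\<in>Q - hubs. \<Sum>\<gamma>\<in>B c. real (f j) / 2)"
    proof (rule sum_mono)
      fix c assume "c \<in> Q - hubs"
      then have "\<rho> * D ^ (j - 1) * (real (f j) / 2) \<le> card (B c) * (real (f j) / 2)"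
        using cB by (intro mult_right_mono) auto
      then show "\<rho> * D ^ (j - 1) * (real (f j) / 2) \<le> (\<Sum>\<gamma>\<in>B c. real (f j) / 2)" by simp
    qed
    also have "\<dots> \<le> (\<Sum>c\<in>Q - hubs. \<Sum>\<gamma>\<in>B c. real (card (Alt c \<gamma>)))"
      using cAlt by (intro sum_mono) auto
    finally show ?thesis using cX by simp
  qed
  \<comment> \<open>The first vertex \<open>last \<gamma>\<close> of the alternative may be a hub
    and is split off. What remains avoids hubs up to and including \<open>c\<close>, so
    \<open>c\<close> is a source of \<open>p ! 1\<close>.\<close>
  also have "real (card X) \<le> real (card Y)"
  proof (intro of_nat_mono card_inj_on_le[of "\<lambda>(c, \<gamma>, p). (\<gamma>, p ! 1, c, drop 1 p)"])
    show "inj_on (\<lambda>(c, \<gamma>, p). (\<gamma>, p ! 1, c, drop 1 p)) X"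
    proof (rule inj_onI)
      fix x x' assume x: "x \<in> X" "x' \<in> X"
        and eq: "(\<lambda>(c, \<gamma>, p). (\<gamma>, p ! 1, c, drop 1 p)) x = (\<lambda>(c, \<gamma>, p). (\<gamma>, p ! 1, c, drop 1 p)) x'"
      obtain c \<gamma> p c' \<gamma>' p' where c: "x = (c, \<gamma>, p)" "x' = (c', \<gamma>', p')" by (metis prod.exhaust)
      have "hd p = last \<gamma>" "hd p' = last \<gamma>'" "p \<noteq> []" "p' \<noteq> []"
        using x c by (auto simp: X_def Alt_def joining_def)
      then show "x = x'" using eq c by (cases p; cases p') auto
    qed
    show "(\<lambda>(c, \<gamma>, p). (\<gamma>, p ! 1, c, drop 1 p)) ` X \<subseteq> Y"
    proof safe
      fix c \<gamma> p assume "(c, \<gamma>, p) \<in> X"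
      then have c: "c \<in> Q" "c \<notin> hubs" and \<gamma>: "\<gamma> \<in> B c" and p: "p \<in> Alt c \<gamma>" by (auto simp: X_def)
      have pl: "p \<in> L" "length p = Suc j" "hd p = last \<gamma>" "last p = c" "\<And>i. 0 < i \<Longrightarrow> i < j \<Longrightarrow> p ! i \<notin> hubs"
        using p by (auto simp: Alt_def joining_def)
      have pp: "p \<in> paths E" using pl(1) light_paths by (auto simp: L_def)
      have "drop 1 p \<in> L" using light_sublist[OF pl(1)[unfolded L_def], of "drop 1 p"] pl(2) j2
        by (auto simp: L_def sublist_drop simp flip: length_0_conv)
      then have dr: "drop 1 p \<in> joining L (j - 1) (p ! 1) c"
        using pl j2 by (auto simp: joining_def hd_drop_conv_nth)
      then have "drop 1 p \<in> joining (paths E) (j - 1) (p ! 1) c"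
        using light_paths by (auto simp: joining_def L_def)
      then have "rev (drop 1 p) \<in> joining (paths E) (j - 1) c (p ! 1)" by (rule joining_paths_rev[OF symE])
      moreover have "set (rev (drop 1 p)) \<inter> hubs = {}"
      proof -
        have "p ! i \<notin> hubs" if "0 < i" "i \<le> j" for i
        proof (cases "i = j")
          case True
          then have "p ! i = c" using pl by (metis diff_Suc_1 last_conv_nth length_0_conv nat.distinct(1))
          then show ?thesis using c by simp
        qed (use pl(5) that in auto)
        then show ?thesis using pl(2) by (auto simp: in_set_conv_nth)
      qed
      ultimately have "c \<in> sources (j - 1) (p ! 1)" using c(1) unfolding sources_def by blast
      moreover have "(last \<gamma>, p ! 1) \<in> E"
      proof -
        have "(p ! 0, p ! Suc 0) \<in> E" using pp pl(2) j2 by (auto simp: paths_def walk_def)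
        moreover have "p ! 0 = last \<gamma>" using pl(2,3) by (metis hd_conv_nth length_0_conv nat.distinct(1))
        ultimately show ?thesis by simp
      qed
      moreover have "\<gamma> \<in> walks E (j - 1) z" using \<gamma> by (simp add: B_def)
      ultimately show "(\<gamma>, p ! 1, c, drop 1 p) \<in> Y" using dr by (auto simp: Y_def)
    qed
    show "finite Y" unfolding Y_def using finite_Q by (auto simp: sources_def L_def)
  qed
  also have "real (card Y) \<le> D ^ (j - 1) * (D * (real ((Suc M3 * j + 1) ^ j) * F))"
  proof -
    have 1: "card (SIGMA c:sources (j - 1) v. joining L (j - 1) v c) \<le> (Suc M3 * j + 1) ^ j * F" for v
    proof -
      have "card (SIGMA c:sources (j - 1) v. joining L (j - 1) v c) = (\<Sum>c\<in>sources (j - 1) v. card (joining L (j - 1) v c))"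
        using finite_Q by (intro card_SigmaI) (auto simp: sources_def L_def)
      also have "\<dots> \<le> (\<Sum>c\<in>sources (j - 1) v. F)"
      proof (rule sum_mono)
        fix c
        have "card (joining L (j - 1) v c) \<le> f (j - 1)"
          using card_joining_light[of "j - 1" "j - 1" f v c] j2 by (simp add: L_def)
        then show "card (joining L (j - 1) v c) \<le> F" using F[of "j - 1"] j2 by simp
      qed
      also have "\<dots> \<le> (Suc M3 * j + 1) ^ j * F"
      proof -
        have "card (sources (j - 1) v) \<le> (Suc M3 * j + 1) ^ (j - 1)" using card_sources j2 by simp
        also have "\<dots> \<le> (Suc M3 * j + 1) ^ j" by (intro power_increasing) auto
        finally show ?thesis by simp
      qed
      finally show ?thesis .
    qed
    have 2: "real (card (SIGMA v:E `` {last \<gamma>}. SIGMA c:sources (j - 1) v. joining L (j - 1) v c)) \<le>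
      D * (real ((Suc M3 * j + 1) ^ j) * F)" if "\<gamma> \<in> walks E (j - 1) z" for \<gamma>
    proof -
      have "card (SIGMA v:E `` {last \<gamma>}. SIGMA c:sources (j - 1) v. joining L (j - 1) v c) =
        (\<Sum>v\<in>E `` {last \<gamma>}. card (SIGMA c:sources (j - 1) v. joining L (j - 1) v c))"
        using finite_Q by (intro card_SigmaI) (auto simp: sources_def L_def)
      also have "\<dots> \<le> (\<Sum>v\<in>E `` {last \<gamma>}. (Suc M3 * j + 1) ^ j * F)" by (intro sum_mono 1)
      finally have "real (card (SIGMA v:E `` {last \<gamma>}. SIGMA c:sources (j - 1) v. joining L (j - 1) v c)) \<le>
        real (card (E `` {last \<gamma>}) * ((Suc M3 * j + 1) ^ j * F))"
        by (simp del: of_nat_mult)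
      also have "\<dots> = real (card (E `` {last \<gamma>})) * (real ((Suc M3 * j + 1) ^ j) * F)" by simp
      also have "\<dots> \<le> D * (real ((Suc M3 * j + 1) ^ j) * F)"
        using deg_le[OF walk_last_in_V[OF zV that]] by (intro mult_right_mono) auto
      finally show ?thesis .
    qed
    have "card Y = (\<Sum>\<gamma>\<in>walks E (j - 1) z. card (SIGMA v:E `` {last \<gamma>}. SIGMA c:sources (j - 1) v. joining L (j - 1) v c))"
      unfolding Y_def using finite_Q by (intro card_SigmaI) (auto simp: sources_def L_def)
    then have "real (card Y) = (\<Sum>\<gamma>\<in>walks E (j - 1) z. real (card (SIGMA v:E `` {last \<gamma>}. SIGMA c:sources (j - 1) v. joining L (j - 1) v c)))"
      by simp
    also have "\<dots> \<le> (\<Sum>\<gamma>\<in>walks E (j - 1) z. D * (real ((Suc M3 * j + 1) ^ j) * F))"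
      by (intro sum_mono 2)
    also have "\<dots> = card (walks E (j - 1) z) * (D * (real ((Suc M3 * j + 1) ^ j) * F))" by simp
    also have "\<dots> \<le> D ^ (j - 1) * (D * (real ((Suc M3 * j + 1) ^ j) * F))"
      using card_walks_le[OF zV] D1 by (intro mult_right_mono) auto
    finally show ?thesis .
  qed
  \<comment> \<open>Both counts contain the same power of \<open>D\<close>; comparing the remaining
    factors contradicts \<open>f2\<close>.\<close>
  finally have "(D * D ^ (j - 1)) * (\<sigma> * \<rho> * f j) \<le> (D * D ^ (j - 1)) * (4 * real ((Suc M3 * j + 1) ^ j) * F)"
    by (simp add: algebra_simps)
  moreover have "0 < D * D ^ (j - 1)" using D1 by simp
  ultimately show False using f2 by (simp add: mult_le_cancel_left_pos)
qed

text \<open>Pigeonhole over the at most \<open>j\<close> tail lengths, by which \<open>T\<close>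
  exceeds or equals \<open>j * T'\<close>.\<close>

lemma obtain_hubs:
  obtains g where "0 < g" "g < j" "T' < card {w. hub g w}"
proof -
  have "\<exists>g. 0 < g \<and> g < j \<and> T' < card {w. hub g w}"
  proof (rule ccontr)
    assume "\<not> ?thesis"
    then have small: "card {w. hub g w} \<le> T'" if "g \<in> {0<..<j}" for g
      using that by (metis greaterThanLessThan_iff not_less)
    have "hubs = (\<Union>g\<in>{0<..<j}. {w. hub g w})" by (auto simp: hubs_def)
    then have "card hubs \<le> (\<Sum>g\<in>{0<..<j}. card {w. hub g w})" by (simp add: card_UN_le)
    also have "\<dots> \<le> (\<Sum>g\<in>{0<..<j}. T')" by (intro sum_mono small)
    also have "\<dots> = (j - 1) * T'" by simp
    also have "\<dots> \<le> j * T'" by (intro mult_le_mono1) simp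
    also note T
    finally show False using many_hubs by simp
  qed
  then show ?thesis using that by blast
qed

text \<open>For \<open>e \<ge> 2\<close> the wings run from position \<open>e - 1\<close> of the
  legs to \<open>Q\<close>. For \<open>e = 1\<close> that position would be \<open>z\<close>, which
  all legs share. Then a hub tail with \<open>g\<close> edges is attached to zigzags starting at
  position \<open>g\<close>; the leg is shortened by \<open>g\<close> and the tail adds
  \<open>g\<close>, so the total length does not depend on \<open>g\<close>.\<close>

lemma robust_wings:
  assumes e: "1 \<le> e" "e \<le> j"
  obtains W g where "finite W" "T' < card W" "0 < g" "g < j"
    "\<And>a w s. a < N \<Longrightarrow> w \<in> W \<Longrightarrow> s \<le> S \<Longrightarrow> \<beta> a ! g \<noteq> w \<Longrightarrow> robust E M3 ((2 * s + 2) * j - e) (\<beta> a ! g) w"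
proof (cases "e = 1")
  case False
  have r: "robust E M3 ((2 * s + 2) * j - e) (\<beta> a ! (e - 1)) c" if "a < N" "c \<in> Q" "s \<le> S" for a c s
  proof -
    have "s * K \<le> S * K" using that by (intro mult_right_mono) auto
    then have "M3 + s * K \<le> M1" using M1 by linarith
    then have "robust E M3 (s * (j + j) + (j + (j - 1 - (e - 1)))) c (\<beta> a ! (e - 1))"
      using that e by (intro robust_zigzag) auto
    moreover have "s * (j + j) + (j + (j - 1 - (e - 1))) = (2 * s + 2) * j - e"
      using e by (simp add: algebra_simps)
    ultimately show ?thesis using robust_sym[OF symE] by simp
  qed
  show ?thesis
    using that[of Q "e - 1"] r finite_Q card_Q T' e False by auto
next
  case True
  obtain g where g: "0 < g" "g < j" "T' < card {w. hub g w}" by (rule obtain_hubs)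
  have r: "robust E M3 ((2 * s + 2) * j - e) (\<beta> a ! g) w" if "a < N" "hub g w" "s \<le> S" "\<beta> a ! g \<noteq> w" for a w s
  proof -
    note w = that(2)
    have sK: "s * K \<le> S * K" using that by (intro mult_right_mono) auto
    let ?n = "s * (j + j) + (j + (j - 1 - g))"
    have "robust E M3 (?n + g) (\<beta> a ! g) w"
    \<comment> \<open>\<open>robust_extend\<close> asks for a final segment avoiding
      \<open>Suc M3\<close> vertices, which is the number in the definition of
      \<open>hub\<close>.\<close>
    proof (rule robust_extend[where M' = "M3 + j + 1"])
      show "\<beta> a ! g \<noteq> w" by fact
      show "M3 + g + 1 \<le> M3 + j + 1" using g by simp
      fix Z :: "'a set" assume "finite Z" "card Z \<le> Suc M3"
      then obtain c q where q: "c \<in> Q" "q \<in> joining (paths E) g c w" "set q \<inter> Z \<subseteq> {w}"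
        using w unfolding hub_def by blast
      have "(M3 + j + 1) + s * K \<le> M1" using M1 sK by linarith
      then have "robust E (M3 + j + 1) ?n c (\<beta> a ! g)"
        using that g q by (intro robust_zigzag) auto
      then show "\<exists>c q. q \<in> joining (paths E) g c w \<and> set q \<inter> Z \<subseteq> {w} \<and> robust E (M3 + j + 1) ?n (\<beta> a ! g) c"
        using q robust_sym[OF symE] by blast
    qed
    moreover have "?n + g = (2 * s + 2) * j - e" using g True by (simp add: algebra_simps)
    ultimately show ?thesis by simp
  qed
  have "finite {w. hub g w}" by (rule finite_subset[OF _ finV]) (auto simp: hub_in_V)
  then show ?thesis using that[of "{w. hub g w}" g] r g by blast
qed

text \<open>Two wings are joined at a vertex of \<open>W\<close> outside the forbidden set and
  different from all \<open>t\<close> chosen leg vertices. With \<open>l + e = q * j\<close> and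
  \<open>s1 + s2 = q - 2\<close>, the lengths of the wings add up to
  \<open>2 * q * j - 2 * e = 2 * l\<close>.\<close>

lemma robust_clique_heavy:
  assumes l: "j \<le> l" "l \<le> S" and M: "M + 2 * j * S + 2 * j + 2 \<le> M3" and T'N: "M + 1 + t \<le> T'" "t \<le> N"
  shows "\<exists>U\<subseteq>V. card U = t \<and> (\<forall>u\<in>U. \<forall>u'\<in>U. u \<noteq> u' \<longrightarrow> robust E M (2 * l) u u')"
proof -
  \<comment> \<open>If \<open>j\<close> divides \<open>l\<close> this gives \<open>e = j\<close> and
    not \<open>0\<close>, as \<open>robust_wings\<close> requires \<open>1 \<le> e\<close>. The
    quotient \<open>q\<close> is therefore \<open>l div j + 1\<close> in every case.\<close>
  define e where "e = j - l mod j"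
  define q where "q = l div j + 1"
  define s1 where "s1 = (q - 2) div 2"
  define s2 where "s2 = (q - 1) div 2"
  have e: "1 \<le> e" "e \<le> j" using j2 by (auto simp: e_def Suc_le_eq)
  have q: "2 \<le> q" using l(1) j2 by (simp add: q_def div_greater_zero_iff Suc_le_eq)
  have "l mod j \<le> j" using j2 by (simp add: less_imp_le)
  then have "l mod j + e = j" by (simp add: e_def)
  moreover have "l = l div j * j + l mod j" by simp
  ultimately have "l + e = l div j * j + j" by linarith
  then have le: "l + e = q * j" by (simp add: q_def)
  have s12: "s1 + s2 = q - 2" using q unfolding s1_def s2_def by presburger
  have "q \<le> l + 1" unfolding q_def by simp
  then have s: "s1 \<le> S" "s2 \<le> S" using l(2) unfolding s1_def s2_def by linarith+
  have len: "((2 * s1 + 2) * j - e) + ((2 * s2 + 2) * j - e) = 2 * l"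
  proof -
    have "(2 * s1 + 2) * j + (2 * s2 + 2) * j = (2 * (s1 + s2) + 4) * j" by (simp add: algebra_simps)
    also have "2 * (s1 + s2) + 4 = 2 * q" using s12 q by simp
    finally have "(2 * s1 + 2) * j + (2 * s2 + 2) * j = 2 * l + 2 * e" using le by simp
    moreover have "e \<le> (2 * s1 + 2) * j" "e \<le> (2 * s2 + 2) * j" using e by (simp_all add: trans_le_add1)
    ultimately show ?thesis by linarith
  qed
  \<comment> \<open>Only multiples of \<open>2 * j\<close> can be added to the length \<open>2 * j - e\<close>, so if \<open>q\<close> is odd the path of
    length \<open>2 * l\<close> is split into parts of lengths \<open>l - j\<close> and \<open>l + j\<close> instead of two halves.\<close>
  obtain W g where W: "finite W" "T' < card W" "0 < g" "g < j"
    "\<And>a w s. a < N \<Longrightarrow> w \<in> W \<Longrightarrow> s \<le> S \<Longrightarrow> \<beta> a ! g \<noteq> w \<Longrightarrow> robust E M3 ((2 * s + 2) * j - e) (\<beta> a ! g) w"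
    using robust_wings[OF e] by metis
  define u where "u a = \<beta> a ! g" for a
  have inj: "inj_on u {..<t}"
  proof (rule inj_onI)
    fix a b assume "a \<in> {..<t}" "b \<in> {..<t}" "u a = u b"
    then show "a = b" using branches[of a b g] W(3,4) T'N(2) by (auto simp: u_def)
  qed
  have uV: "u a \<in> V" if "a < N" for a
  proof -
    have "u a \<in> set (\<beta> a)" using leg_length[OF that] W(4) by (simp add: u_def)
    then show ?thesis using walks_V[OF zV \<beta>[OF that]] by blast
  qed
  have "robust E M (2 * l) (u a) (u b)" if ab: "a < t" "b < t" "u a \<noteq> u b" for a b
    unfolding len[symmetric]
  proof (rule robust_trans[where M' = M3])
    show "u a \<noteq> u b" by fact
    have "s2 * j \<le> S * j" using s by (intro mult_right_mono) auto
    moreover have "(2 * s2 + 2) * j = 2 * (s2 * j) + 2 * j" "2 * j * S = 2 * (S * j)"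
      by (simp_all add: algebra_simps)
    ultimately have "(2 * s2 + 2) * j - e \<le> 2 * j * S + 2 * j" by linarith
    then show "M + ((2 * s2 + 2) * j - e) + 2 \<le> M3" using M by linarith
    fix Z :: "'a set" assume Z: "finite Z" "card Z \<le> M + 1"
    have "card (Z \<union> u ` {..<t}) \<le> M + 1 + t"
      using card_Un_le[of Z "u ` {..<t}"] card_image_le[of "{..<t}" u] Z by simp
    then have "\<not> W \<subseteq> Z \<union> u ` {..<t}"
      using card_mono[of "Z \<union> u ` {..<t}" W] W(2) T'N(1) Z(1) by auto
    then obtain w where w: "w \<in> W" "w \<notin> Z" "w \<notin> u ` {..<t}" by auto
    then have "u a \<noteq> w" "u b \<noteq> w" using ab by auto
    then show "\<exists>w. w \<notin> Z \<and> robust E M3 ((2 * s1 + 2) * j - e) (u a) w \<and> robust E M3 ((2 * s2 + 2) * j - e) w (u b)"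
      using W(5)[of a w s1] W(5)[of b w s2] ab s w(1) T'N(2) robust_sym[OF symE] w(2)
      by (auto simp: u_def)
  qed
  then show ?thesis
    using inj uV T'N(2) by (intro exI[of _ "u ` {..<t}"]) (auto simp: card_image)
qed

end

section \<open>Finding a centre with many heavy legs\<close>

context near_regular
begin

text \<open>Pigeonhole over the last but one vertex of the heavy paths.\<close>

lemma heavy_at_vertex:
  fixes c :: real
  assumes j: "0 < j" and dense: "c * card V * D ^ j \<le> card (heavy E f j)"
  shows "\<exists>z\<in>V. c * D ^ j \<le> card {p \<in> heavy E f j. p ! (j - 1) = z}"
proof (rule ccontr)
  assume "\<not> ?thesis"
  then have "(\<Sum>z\<in>V. real (card {p \<in> heavy E f j. p ! (j - 1) = z})) < (\<Sum>z\<in>V. c * D ^ j)"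
    using finV V_ne by (intro sum_strict_mono) (auto simp: not_le)
  moreover have hp: "p \<in> all_walks j" if "p \<in> heavy E f j" for p
    using that light_paths j by (intro paths_all_walks) (auto simp: heavy_def)
  then have finh: "finite (heavy E f j)" by (meson finite_all_walks finite_subset subsetI)
  have "heavy E f j = (\<Union>z\<in>V. {p \<in> heavy E f j. p ! (j - 1) = z})"
  proof safe
    fix p assume p: "p \<in> heavy E f j"
    then have "p ! (j - 1) \<in> set p" by (simp add: heavy_def)
    moreover have "set p \<subseteq> V" using hp[OF p] walks_V by (auto simp: all_walks_def)
    ultimately show "p \<in> (\<Union>z\<in>V. {p \<in> heavy E f j. p ! (j - 1) = z})" using p by auto
  qed
  then have "card (heavy E f j) \<le> (\<Sum>z\<in>V. card {p \<in> heavy E f j. p ! (j - 1) = z})"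
    using card_UN_le[OF finV, of "\<lambda>z. {p \<in> heavy E f j. p ! (j - 1) = z}"] by argo
  then have "real (card (heavy E f j)) \<le> (\<Sum>z\<in>V. real (card {p \<in> heavy E f j. p ! (j - 1) = z}))"
    by (simp flip: of_nat_sum)
  ultimately show False using dense by (simp add: mult_ac)
qed

lemma heavy_legs_card:
  assumes j: "0 < j"
  shows "card {p \<in> heavy E f j. p ! (j - 1) = z} \<le>
    card {(\<gamma>, y) \<in> walks E (j - 1) z \<times> E `` {z}. rev \<gamma> @ [y] \<in> heavy E f j}"
proof (rule card_inj_on_le[of "\<lambda>p. (rev (butlast p), last p)"])
  have ne: "p \<noteq> []" if "p \<in> heavy E f j" for p using that by (auto simp: heavy_def)
  show "inj_on (\<lambda>p. (rev (butlast p), last p)) {p \<in> heavy E f j. p ! (j - 1) = z}"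
  proof (rule inj_onI)
    fix p q assume "p \<in> {p \<in> heavy E f j. p ! (j - 1) = z}" "q \<in> {p \<in> heavy E f j. p ! (j - 1) = z}"
      and "(rev (butlast p), last p) = (rev (butlast q), last q)"
    then have "p \<noteq> []" "q \<noteq> []" "butlast p @ [last p] = butlast q @ [last q]" using ne by auto
    then show "p = q" by simp
  qed
  show "(\<lambda>p. (rev (butlast p), last p)) ` {p \<in> heavy E f j. p ! (j - 1) = z} \<subseteq>
    {(\<gamma>, y) \<in> walks E (j - 1) z \<times> E `` {z}. rev \<gamma> @ [y] \<in> heavy E f j}"
  proof (rule image_subsetI)
    fix p assume "p \<in> {p \<in> heavy E f j. p ! (j - 1) = z}"
    then have p: "p \<in> heavy E f j" and z: "p ! (j - 1) = z" by auto
    have l: "length p = Suc j" and w: "walk E p" using p light_paths by (auto simp: heavy_def paths_def)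
    have bl: "butlast p = take j p" using l by (simp add: butlast_conv_take)
    have "walk E (rev (butlast p))"
      unfolding bl using w by (intro walk_rev symE) (auto intro: walk_sublist)
    moreover have "last (butlast p) = p ! (j - 1)"
      unfolding bl using l j by (subst last_conv_nth) auto
    ultimately have 1: "rev (butlast p) \<in> walks E (j - 1) z"
      using l j z by (auto simp: walks_def hd_rev)
    have "(p ! (j - 1), p ! Suc (j - 1)) \<in> E" using w l j by (cases j) (simp_all add: walk_def)
    moreover have "last p = p ! Suc (j - 1)" using l j by (subst last_conv_nth) auto
    ultimately have 2: "last p \<in> E `` {z}" using z by simp
    show "(rev (butlast p), last p) \<in>
      {(\<gamma>, y) \<in> walks E (j - 1) z \<times> E `` {z}. rev \<gamma> @ [y] \<in> heavy E f j}"
      using 1 2 p ne[OF p] by simp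
  qed
  show "finite {(\<gamma>, y) \<in> walks E (j - 1) z \<times> E `` {z}. rev \<gamma> @ [y] \<in> heavy E f j}"
    by (rule finite_subset[of _ "walks E (j - 1) z \<times> E `` {z}"]) auto
qed

text \<open>Poor pairs are grouped by the segment with \<open>g\<close> edges and by
  \<open>y\<close>. There are at most \<open>D ^ g * D\<close> groups, each with fewer than
  \<open>\<rho> * D ^ (j - 1 - g)\<close> members.\<close>

lemma poor_legs_card:
  fixes \<rho> :: real
  assumes z: "z \<in> V" and g: "g < j" and \<rho>: "0 \<le> \<rho>"
  shows "card {(\<gamma>, y) \<in> walks E (j - 1) z \<times> E `` {z}. A \<gamma> y \<and>
    card {\<gamma>' \<in> walks E (j - 1) z. take (Suc g) \<gamma>' = take (Suc g) \<gamma> \<and> A \<gamma>' y} < \<rho> * D ^ (j - 1 - g)} \<le> \<rho> * D ^ j"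
proof -
  define X where "X = walks E (j - 1) z"
  define Y where "Y = E `` {z}"
  define Ext where "Ext r y = {\<gamma>' \<in> X. take (Suc g) \<gamma>' = r \<and> A \<gamma>' y}" for r y
  define P where "P = {(\<gamma>, y) \<in> X \<times> Y. A \<gamma> y \<and> card (Ext (take (Suc g) \<gamma>) y) < \<rho> * D ^ (j - 1 - g)}"
  define B where "B r y = (if card (Ext r y) < \<rho> * D ^ (j - 1 - g) then Ext r y else {})" for r y
  have fin: "finite X" "finite Y" "\<And>r y. finite (B r y)" by (simp_all add: X_def Y_def B_def Ext_def)
  have "P \<subseteq> (\<lambda>(r, y, \<gamma>). (\<gamma>, y)) ` (SIGMA r:walks E g z. SIGMA y:Y. B r y)"
  proof
    fix x assume "x \<in> P"
    then obtain \<gamma> y where x: "x = (\<gamma>, y)" "\<gamma> \<in> X" "y \<in> Y" "A \<gamma> y"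
      "card (Ext (take (Suc g) \<gamma>) y) < \<rho> * D ^ (j - 1 - g)" by (auto simp: P_def)
    have "take (Suc g) \<gamma> \<in> walks E g z" using walks_take[of \<gamma> "j - 1" z g] x(2) g by (simp add: X_def)
    moreover have "\<gamma> \<in> B (take (Suc g) \<gamma>) y" using x by (simp add: B_def Ext_def)
    ultimately show "x \<in> (\<lambda>(r, y, \<gamma>). (\<gamma>, y)) ` (SIGMA r:walks E g z. SIGMA y:Y. B r y)"
      using x by (intro image_eqI[of _ _ "(take (Suc g) \<gamma>, y, \<gamma>)"]) auto
  qed
  then have "card P \<le> card (SIGMA r:walks E g z. SIGMA y:Y. B r y)"
    using fin by (intro surj_card_le) auto
  also have "\<dots> = (\<Sum>r\<in>walks E g z. card (SIGMA y:Y. B r y))"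
    using fin by (intro card_SigmaI) auto
  also have "\<dots> = (\<Sum>r\<in>walks E g z. \<Sum>y\<in>Y. card (B r y))"
    using fin by simp
  finally have "real (card P) \<le> (\<Sum>r\<in>walks E g z. \<Sum>y\<in>Y. real (card (B r y)))"
    by (simp flip: of_nat_sum)
  also have "\<dots> \<le> (\<Sum>r\<in>walks E g z. \<Sum>y\<in>Y. \<rho> * D ^ (j - 1 - g))"
    using \<rho> D1 by (intro sum_mono) (simp add: B_def)
  also have "\<dots> = card (walks E g z) * (card Y * (\<rho> * D ^ (j - 1 - g)))" by simp
  also have "\<dots> \<le> D ^ g * (D * (\<rho> * D ^ (j - 1 - g)))"
    using card_walks_le[OF z] deg_le[OF z] \<rho> D1 by (intro mult_mono) (auto simp: Y_def)
  also have "\<dots> = \<rho> * (D ^ g * D * D ^ (j - 1 - g))" by simp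
  also have "D ^ g * D * D ^ (j - 1 - g) = D ^ j"
  proof -
    have "Suc g + (j - 1 - g) = j" using g by simp
    then show ?thesis by (metis mult.commute power_Suc power_add)
  qed
  finally show ?thesis by (simp add: P_def Ext_def X_def Y_def)
qed

text \<open>Around a popular centre, the pairs of leg and neighbour are discarded in which some
  initial segment of the leg has few heavy continuations for that neighbour.
  \<open>dense_common_neighbours\<close> is applied to the rest; two legs conflict if they agree at
  some position other than 0.\<close>

lemma heavy_centre_exists:
  fixes c K :: real
  assumes j: "2 \<le> j" "j \<le> l" and c: "0 < c" and dense: "c * card V * D ^ j \<le> card (heavy E f j)"
    and K: "D \<le> K * d" "1 \<le> K" and DN: "8 * real N * l * K ^ l \<le> c * D"
  obtains z \<beta> Q where "z \<in> V" "Q \<subseteq> E `` {z}" "(c / 8) ^ Suc N / K * D \<le> card Q"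
    "\<And>a. a < N \<Longrightarrow> \<beta> a \<in> walks E (j - 1) z"
    "\<And>a c. a < N \<Longrightarrow> c \<in> Q \<Longrightarrow> rev (\<beta> a) @ [c] \<in> heavy E f j"
    "\<And>a b g. a < N \<Longrightarrow> b < N \<Longrightarrow> a \<noteq> b \<Longrightarrow> 0 < g \<Longrightarrow> g < j \<Longrightarrow> \<beta> a ! g \<noteq> \<beta> b ! g"
    "\<And>a y g. a < N \<Longrightarrow> y \<in> Q \<Longrightarrow> g < j \<Longrightarrow> c / (2 * real l) * D ^ (j - 1 - g) \<le>
      card {\<gamma> \<in> walks E (j - 1) z. take (Suc g) \<gamma> = take (Suc g) (\<beta> a) \<and> rev \<gamma> @ [y] \<in> heavy E f j}"
proof -
  \<comment> \<open>For each of the at most \<open>l\<close> values of \<open>g\<close> at most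
    \<open>\<rho> * D ^ j\<close> pairs are discarded, so half of the \<open>c * D ^ j\<close> heavy
    pairs remain.\<close>
  define \<rho> where "\<rho> = c / (2 * real l)"
  have l0: "0 < real l" using j by simp
  have \<rho>: "0 \<le> \<rho>" "real l * \<rho> = c / 2" using c l0 by (simp_all add: \<rho>_def)
  obtain z where z: "z \<in> V" "c * D ^ j \<le> card {p \<in> heavy E f j. p ! (j - 1) = z}"
    using heavy_at_vertex[OF _ dense] j by auto
  define X where "X = walks E (j - 1) z"
  define Y where "Y = E `` {z}"
  define A where "A \<gamma> y \<longleftrightarrow> rev \<gamma> @ [y] \<in> heavy E f j" for \<gamma> y
  define Poor where "Poor g = {(\<gamma>, y) \<in> X \<times> Y. A \<gamma> y \<and>
    card {\<gamma>' \<in> X. take (Suc g) \<gamma>' = take (Suc g) \<gamma> \<and> A \<gamma>' y} < \<rho> * D ^ (j - 1 - g)}" for g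
  define Good where "Good \<gamma> y \<longleftrightarrow> A \<gamma> y \<and> (\<forall>g<j. \<rho> * D ^ (j - 1 - g) \<le>
    card {\<gamma>' \<in> X. take (Suc g) \<gamma>' = take (Suc g) \<gamma> \<and> A \<gamma>' y})" for \<gamma> y
  have fin: "finite X" "finite Y" "\<And>g. finite (Poor g)"
    by (auto simp: X_def Y_def Poor_def intro: finite_subset[of _ "walks E (j - 1) z \<times> E `` {z}"])
  have cX: "d ^ (j - 1) \<le> card X" "card X \<le> D ^ (j - 1)"
    using card_walks_ge[OF z(1)] card_walks_le[OF z(1)] by (simp_all add: X_def)
  have cY: "d \<le> card Y" "card Y \<le> D" using deg_ge[OF z(1)] deg_le[OF z(1)] by (simp_all add: Y_def)
  have d0: "0 < d" using d1 by simp
  have "0 < real (card X)" using cX(1) zero_less_power[OF d0, of "j - 1"] by linarith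
  then have Xne: "X \<noteq> {}" by auto
  have "{(\<gamma>, y) \<in> X \<times> Y. A \<gamma> y} \<subseteq> {(\<gamma>, y) \<in> X \<times> Y. Good \<gamma> y} \<union> (\<Union>g<j. Poor g)"
    by (auto simp: Good_def Poor_def not_le)
  then have "card {(\<gamma>, y) \<in> X \<times> Y. A \<gamma> y} \<le> card ({(\<gamma>, y) \<in> X \<times> Y. Good \<gamma> y} \<union> (\<Union>g<j. Poor g))"
    using fin by (intro card_mono) (auto intro: finite_subset[of _ "X \<times> Y"])
  also have "\<dots> \<le> card {(\<gamma>, y) \<in> X \<times> Y. Good \<gamma> y} + (\<Sum>g<j. card (Poor g))"
    using card_Un_le[of "{(\<gamma>, y) \<in> X \<times> Y. Good \<gamma> y}" "\<Union>g<j. Poor g"] card_UN_le[of "{..<j}" Poor] by simp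
  finally have "real (card {(\<gamma>, y) \<in> X \<times> Y. A \<gamma> y}) \<le>
    real (card {(\<gamma>, y) \<in> X \<times> Y. Good \<gamma> y}) + (\<Sum>g<j. real (card (Poor g)))"
    by (simp flip: of_nat_sum of_nat_add)
  moreover have "(\<Sum>g<j. real (card (Poor g))) \<le> (\<Sum>g<j. \<rho> * D ^ j)"
    unfolding Poor_def X_def Y_def using \<rho>(1) by (intro sum_mono poor_legs_card z(1)) auto
  moreover have "(\<Sum>g<j. \<rho> * D ^ j) \<le> c / 2 * D ^ j"
  proof -
    have "real j * \<rho> \<le> real l * \<rho>" using j \<rho>(1) by (intro mult_right_mono) auto
    then have "real j * \<rho> * D ^ j \<le> c / 2 * D ^ j" using \<rho>(2) D1 by (intro mult_right_mono) auto
    then show ?thesis by (simp add: mult_ac)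
  qed
  moreover have "c * D ^ j \<le> card {(\<gamma>, y) \<in> X \<times> Y. A \<gamma> y}"
    using z(2) heavy_legs_card[of j f z] j unfolding X_def Y_def A_def by simp
  ultimately have good: "c / 2 * D ^ j \<le> card {(\<gamma>, y) \<in> X \<times> Y. Good \<gamma> y}" by linarith
  have "real (card X) * card Y \<le> D ^ (j - 1) * D" using cX cY D1 by (intro mult_mono) auto
  also have "\<dots> = D ^ j" using j by (cases j) auto
  finally have "c / 2 * (real (card X) * card Y) \<le> c / 2 * D ^ j" using c by simp
  then have gd: "c / 2 * card X * card Y \<le> card {(\<gamma>, y) \<in> X \<times> Y. Good \<gamma> y}"
    using good by (simp add: mult.assoc)
  define C where "C \<gamma> \<gamma>' y \<longleftrightarrow> (\<exists>g. 0 < g \<and> g < j \<and> \<gamma> ! g = \<gamma>' ! g)" for \<gamma> \<gamma>' :: "'a list" and y :: 'a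
  \<comment> \<open>At most \<open>l * D ^ (j - 2)\<close> legs conflict with a given one, while
    \<open>card X\<close> is at least \<open>d ^ (j - 1)\<close>; the factor \<open>K ^ l\<close>
    covers the ratio of \<open>D\<close> to \<open>d\<close>.\<close>
  define \<kappa> where "\<kappa> = real l * K ^ l / D"
  have D0: "0 < D" using D1 by simp
  have conf: "card {\<gamma>' \<in> X. C \<gamma> \<gamma>' y} \<le> \<kappa> * card X" for \<gamma> y
  proof -
    have "{\<gamma>' \<in> X. C \<gamma> \<gamma>' y} \<subseteq> (\<Union>g\<in>{0<..<j}. {\<gamma>' \<in> X. \<gamma>' ! g = \<gamma> ! g})"
      by (auto simp: C_def)
    then have "card {\<gamma>' \<in> X. C \<gamma> \<gamma>' y} \<le> card (\<Union>g\<in>{0<..<j}. {\<gamma>' \<in> X. \<gamma>' ! g = \<gamma> ! g})"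
      using fin by (intro card_mono) auto
    also have "\<dots> \<le> (\<Sum>g\<in>{0<..<j}. card {\<gamma>' \<in> X. \<gamma>' ! g = \<gamma> ! g})" by (rule card_UN_le) simp
    finally have "real (card {\<gamma>' \<in> X. C \<gamma> \<gamma>' y}) \<le> (\<Sum>g\<in>{0<..<j}. real (card {\<gamma>' \<in> X. \<gamma>' ! g = \<gamma> ! g}))"
      by (simp flip: of_nat_sum)
    also have "\<dots> \<le> (\<Sum>g\<in>{0<..<j}. D ^ (j - 1 - 1))"
    proof (rule sum_mono)
      fix g assume "g \<in> {0<..<j}"
      then show "real (card {\<gamma>' \<in> X. \<gamma>' ! g = \<gamma> ! g}) \<le> D ^ (j - 1 - 1)"
        unfolding X_def using walks_through[OF z(1), of g "j - 1" "\<gamma> ! g"] by auto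
    qed
    also have "\<dots> = real (j - 1) * D ^ (j - 1 - 1)" by simp
    also have "\<dots> \<le> real l * D ^ (j - 1 - 1)" using j D1 by (intro mult_right_mono) auto
    also have "\<dots> = real l * D ^ (j - 1) / D"
    proof -
      have "D ^ (j - 1) = D ^ (j - 1 - 1) * D" using j by (cases "j - 1") auto
      then show ?thesis using D0 by simp
    qed
    also have "\<dots> \<le> real l * (K ^ l * card X) / D"
    proof -
      have "D ^ (j - 1) \<le> (K * d) ^ (j - 1)" using K D0 by (intro power_mono) auto
      also have "\<dots> = K ^ (j - 1) * d ^ (j - 1)" by (simp add: power_mult_distrib)
      also have "\<dots> \<le> K ^ l * card X"
        using cX(1) K(2) j d0 by (intro mult_mono power_increasing) auto
      finally show ?thesis using D0 by (intro divide_right_mono mult_left_mono) auto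
    qed
    finally show ?thesis by (simp add: \<kappa>_def)
  qed
  have "\<exists>\<beta>. (\<forall>a<N. \<beta> a \<in> X) \<and> (c / 2 / 4) ^ Suc N * card Y \<le>
    card {y \<in> Y. (\<forall>a<N. Good (\<beta> a) y) \<and> (\<forall>a<N. \<forall>b<N. a \<noteq> b \<longrightarrow> \<not> C (\<beta> a) (\<beta> b) y)}"
  proof (rule dense_common_neighbours[OF fin(1,2) Xne gd conf])
    show "real N * \<kappa> \<le> c / 2 / 4" using DN D0 by (simp add: \<kappa>_def field_simps)
    show "0 \<le> c / 2" "0 \<le> \<kappa>" using c K D0 by (simp_all add: \<kappa>_def)
    show "\<And>x x' y. C x x' y \<Longrightarrow> C x' x y" unfolding C_def by metis
  qed
  then obtain \<beta> where \<beta>: "\<forall>a<N. \<beta> a \<in> X" "(c / 8) ^ Suc N * card Y \<le>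
    card {y \<in> Y. (\<forall>a<N. Good (\<beta> a) y) \<and> (\<forall>a<N. \<forall>b<N. a \<noteq> b \<longrightarrow> \<not> C (\<beta> a) (\<beta> b) y)}" by auto
  define Q where "Q = {y \<in> Y. (\<forall>a<N. Good (\<beta> a) y) \<and> (\<forall>a<N. \<forall>b<N. a \<noteq> b \<longrightarrow> \<not> C (\<beta> a) (\<beta> b) y)}"
  have "(c / 8) ^ Suc N / K * D \<le> (c / 8) ^ Suc N * d"
  proof -
    have "D / K \<le> d" using K by (simp add: divide_le_eq mult.commute)
    then have "(c / 8) ^ Suc N * (D / K) \<le> (c / 8) ^ Suc N * d" using c by (intro mult_left_mono) auto
    then show ?thesis by simp
  qed
  also have "\<dots> \<le> (c / 8) ^ Suc N * card Y" using c cY by (intro mult_left_mono) auto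
  also have "\<dots> \<le> card Q" using \<beta>(2) unfolding Q_def .
  finally have cQ: "(c / 8) ^ Suc N / K * D \<le> card Q" .
  have "0 < (c / 8) ^ Suc N / K * D" using c K D0 by simp
  then have "0 < card Q" using cQ by linarith
  then have "Q \<noteq> {}" by auto
  \<comment> \<open>The absence of conflicts between legs is recorded only at members of
    \<open>Q\<close>, so one member is needed to read it off.\<close>
  then obtain y0 where y0: "y0 \<in> Q" by blast
  show ?thesis
  proof (rule that[of z Q \<beta>])
    show "z \<in> V" "Q \<subseteq> E `` {z}" "(c / 8) ^ Suc N / K * D \<le> card Q"
      using z cQ by (auto simp: Q_def Y_def)
    show "\<beta> a \<in> walks E (j - 1) z" if "a < N" for a using \<beta> that by (simp add: X_def)
    show "rev (\<beta> a) @ [y] \<in> heavy E f j" if "a < N" "y \<in> Q" for a y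
      using that by (auto simp: Q_def Good_def A_def)
    show "\<beta> a ! g \<noteq> \<beta> b ! g" if "a < N" "b < N" "a \<noteq> b" "0 < g" "g < j" for a b g
      using y0 that unfolding Q_def C_def by blast
    show "c / (2 * real l) * D ^ (j - 1 - g) \<le>
      card {\<gamma> \<in> walks E (j - 1) z. take (Suc g) \<gamma> = take (Suc g) (\<beta> a) \<and> rev \<gamma> @ [y] \<in> heavy E f j}"
      if "a < N" "y \<in> Q" "g < j" for a y g
      using that unfolding Q_def Good_def A_def X_def \<rho>_def by blast
  qed
qed

end

section \<open>Choice of the constants\<close>

primrec threshold :: "nat \<Rightarrow> nat \<Rightarrow> nat" where
  "threshold C 0 = 1"
| "threshold C (Suc i) = C * (threshold C i)\<^sup>2"

lemma threshold_pos: "0 < C \<Longrightarrow> 0 < threshold C i"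
  by (induction i) auto

lemma threshold_mono: "0 < C \<Longrightarrow> i \<le> i' \<Longrightarrow> threshold C i \<le> threshold C i'"
proof (induction i')
  case (Suc i')
  have "threshold C i' \<le> threshold C (Suc i')"
    using threshold_pos[OF Suc.prems(1), of i'] Suc.prems(1) by (simp add: power2_eq_square)
  then show ?case using Suc by (cases "i = Suc i'") auto
qed simp

text \<open>Let \<open>x = d ^ l / m\<close>. The bound on \<open>d\<close> gives
  \<open>x \<ge> m powr (- (\<delta> * l))\<close>, and \<open>m \<le> d powr (2 * l)\<close> turns
  this into a bound by a power of \<open>d\<close>. The choice of \<open>\<delta>\<close> ensures
  \<open>x ^ t \<ge> d powr (- 1 / 2)\<close>, so \<open>d * x ^ t\<close> is at least
  \<open>sqrt d\<close> and exceeds the constants.\<close>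

lemma light_numerics:
  fixes m d x D K c A \<delta> :: real and l t :: nat
  assumes l: "0 < l" and m: "1 \<le> m" and d: "1 \<le> d" and \<delta>: "\<delta> = 1 / (4 * real l * real l * (real t + 1))"
    and dm: "m powr (1 / l - \<delta>) \<le> d" and D: "0 \<le> D" "D \<le> K * d" and K: "1 \<le> K"
    and c: "1 \<le> c" and A: "0 \<le> A"
    and large: "(A * K ^ l * c ^ Suc t)\<^sup>2 < d"
  shows "A * D ^ (l - 1) < (d ^ l / (c * m)) ^ Suc t * m"
proof -
  have l1: "1 \<le> real l" using l by simp
  have d0: "0 < d" and m0: "0 < m" using d m by auto
  have \<delta>0: "0 < \<delta>" unfolding \<delta> using l1 by simp
  have \<delta>l: "\<delta> * (4 * real l * real l * (real t + 1)) = 1" unfolding \<delta> using l1 by simp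
  have "\<delta> * (2 * real l) \<le> \<delta> * (4 * real l * real l * (real t + 1))"
  proof (rule mult_left_mono)
    have "2 * real l * 1 \<le> (2 * real l) * (2 * real l * (real t + 1))"
      using l1 mult_mono[of 1 "2 * real l" 1 "real t + 1"] by (intro mult_left_mono) auto
    then show "2 * real l \<le> 4 * real l * real l * (real t + 1)" by (simp add: mult_ac)
  qed (use \<delta>0 in simp)
  then have "\<delta> * (2 * real l) \<le> 1" using \<delta>l by simp
  \<comment> \<open>Keeping the exponent above \<open>1 / (2 * l)\<close> bounds \<open>m\<close> by
    a fixed power of \<open>d\<close>.\<close>
  then have half: "1 / (2 * real l) \<le> 1 / l - \<delta>" using l1 by (simp add: field_simps)
  have "m powr (1 / (2 * real l)) \<le> d"
    using dm powr_mono[OF half m] by linarith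
  then have "(m powr (1 / (2 * real l))) powr (2 * real l) \<le> d powr (2 * real l)"
    using l1 by (intro powr_mono2) auto
  then have md: "m \<le> d powr (2 * real l)" using m0 l1 by (simp add: powr_powr)
  define x where "x = d ^ l / m"
  have x0: "0 < x" using d0 m0 by (simp add: x_def)
  have "(m powr (1 / l - \<delta>)) powr l \<le> d powr l" using dm l1 by (intro powr_mono2) auto
  then have "m powr (1 - \<delta> * l) \<le> d ^ l" using d0 l1 by (simp add: powr_powr powr_realpow left_diff_distrib)
  then have "m powr (1 - \<delta> * l) / m \<le> x" unfolding x_def using m0 by (intro divide_right_mono) auto
  moreover have "m powr (1 - \<delta> * l) / m = m powr (- (\<delta> * l))"
    using m0 by (simp add: powr_diff powr_minus field_simps)
  ultimately have "m powr (- (\<delta> * l)) \<le> x" by simp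
  moreover have "(d powr (2 * real l)) powr (- (\<delta> * l)) \<le> m powr (- (\<delta> * l))"
    using md m0 \<delta>0 by (intro powr_mono2') auto
  ultimately have "d powr (- (2 * real l * (\<delta> * l))) \<le> x" by (simp add: powr_powr)
  then have "(d powr (- (2 * real l * (\<delta> * l)))) ^ t \<le> x ^ t" by (intro power_mono) auto
  then have xt: "d powr (- (2 * real l * (\<delta> * l)) * t) \<le> x ^ t"
    using d0 by (simp add: powr_power mult_ac)
  have "2 * real l * (\<delta> * l) * t \<le> 1 / 2"
  proof -
    have "2 * real l * (\<delta> * l) * t \<le> 2 * real l * (\<delta> * l) * (real t + 1)"
      using \<delta>0 l1 by (intro mult_left_mono) auto
    also have "\<dots> = \<delta> * (4 * real l * real l * (real t + 1)) / 2" by simp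
    finally show ?thesis using \<delta>l by simp
  qed
  then have "d powr (- 1 / 2) \<le> d powr (- (2 * real l * (\<delta> * l)) * t)"
    using d by (intro powr_mono) auto
  then have xt2: "d powr (- 1 / 2) \<le> x ^ t" using xt by linarith
  have "A * K ^ l * c ^ Suc t = sqrt ((A * K ^ l * c ^ Suc t)\<^sup>2)"
    using A K c by simp
  also have "\<dots> < sqrt d" using large by (intro real_sqrt_less_mono)
  also have "sqrt d = d * d powr (- 1 / 2)"
  proof -
    have "d * d powr (- 1 / 2) = d powr (1 + - 1 / 2)" using d0 by (simp only: powr_add powr_one)
    then show ?thesis using d0 by (simp add: powr_half_sqrt)
  qed
  also have "\<dots> \<le> d * x ^ t" using xt2 d0 by (intro mult_left_mono) auto
  finally have key: "A * K ^ l * c ^ Suc t < d * x ^ t" .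
  have "A * D ^ (l - 1) \<le> A * (K * d) ^ (l - 1)" using A D by (intro mult_left_mono power_mono) auto
  also have "\<dots> \<le> A * (K ^ l * d ^ (l - 1))"
    unfolding power_mult_distrib using A K d0 by (intro mult_left_mono mult_right_mono power_increasing) auto
  finally have "A * D ^ (l - 1) * c ^ Suc t \<le> A * (K ^ l * d ^ (l - 1)) * c ^ Suc t"
    using c by (intro mult_right_mono) auto
  also have "\<dots> < d ^ (l - 1) * (d * x ^ t)"
    using mult_strict_left_mono[OF key, of "d ^ (l - 1)"] d0 by (simp add: mult_ac)
  also have "d ^ (l - 1) * (d * x ^ t) = d ^ l * x ^ t" using l by (cases l) auto
  also have "\<dots> = x ^ Suc t * m" using m0 by (simp add: x_def)
  finally have "A * D ^ (l - 1) * c ^ Suc t < x ^ Suc t * m" .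
  then have "A * D ^ (l - 1) < x ^ Suc t * m / c ^ Suc t" using c by (simp add: less_divide_eq)
  also have "\<dots> = (x / c) ^ Suc t * m" by (simp add: power_divide)
  also have "x / c = d ^ l / (c * m)" by (simp add: x_def)
  finally show ?thesis .
qed


text \<open>Either for some \<open>j\<close> the heavy paths reach a proportion \<open>c\<close> of
  \<open>card V * D ^ j\<close>, and there is a heavy centre, or enough light paths remain. All
  constants are chosen before the graph, so \<open>d0\<close> serves every graph.\<close>

lemma robust_clique_exists:
  fixes l t M :: nat and K \<delta> :: real
  assumes l: "0 < l" and K: "1 \<le> K" and \<delta>: "\<delta> = 1 / (4 * real l * real l * (real t + 1))"
  shows "\<exists>d0::real. \<forall>(V :: 'a set) E d D. near_regular V E d D \<longrightarrow> D \<le> K * d \<longrightarrow> d0 \<le> d \<longrightarrow>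
    card V powr (1 / l - \<delta>) \<le> d \<longrightarrow>
    (\<exists>U\<subseteq>V. card U = t \<and> (\<forall>u\<in>U. \<forall>u'\<in>U. u \<noteq> u' \<longrightarrow> robust E M (2 * l) u u'))"
proof -
  \<comment> \<open>With this \<open>c\<close> the loss from heavy paths in
    \<open>many_light_paths\<close> is at most \<open>d ^ l / 8\<close>.\<close>
  define c where "c = 1 / (8 * real (Suc l) * real (Suc l) * K ^ l)"
  \<comment> \<open>The budgets are fixed from the end of the argument backwards, with
    \<open>l\<close> bounding \<open>j\<close>: \<open>M3\<close> pays for joining two wings,
    \<open>T'\<close> for the vertices that a midpoint must avoid, \<open>KK\<close> for one zigzag
    step, \<open>M1\<close> for up to \<open>l\<close> such steps and a tail, and \<open>M0\<close>
    for one more concatenation with a heavy path.\<close>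
  define M3 where "M3 = M + 2 * l * l + 2 * l + 2"
  define T' where "T' = M + 1 + t"
  define KK where "KK = 2 * l * l + 2 * l + 2"
  define M1 where "M1 = M3 + l + 1 + l * KK + T' + 1"
  define M0 where "M0 = M1 + 2 * l + 2"
  define N where "N = M1 + 2 + t"
  define T where "T = l * T'"
  define \<rho> where "\<rho> = c / (2 * real l)"
  define \<sigma> where "\<sigma> = (c / 8) ^ Suc N / K"
  define B where "B = 4 * real ((Suc M3 * l + 1) ^ l) / (\<sigma> * \<rho>)"
  \<comment> \<open>The summands serve \<open>f0\<close>, \<open>f1\<close> and \<open>f2\<close> in
    turn. Each threshold is \<open>C\<close> times the square of the previous one, so
    \<open>f j\<close> exceeds \<open>F * F\<close> by this factor when
    \<open>F = f (j - 1)\<close>.\<close>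
  define C where "C = M0 * l + 2 * T * l + nat \<lceil>B\<rceil> + 1"
  define f where "f = threshold C"
  define A where "A = real t * (real l * l) + real M * real (Suc l)"
  have K0: "0 < K" and l1: "1 \<le> real l" using K l by auto
  have Kl: "1 \<le> K ^ l" using K by simp
  have c0: "0 < c" using K0 by (simp add: c_def)
  have pos: "0 < \<rho>" "0 < \<sigma>" using c0 l1 K0 by (simp_all add: \<rho>_def \<sigma>_def)
  have C0: "0 < C" by (simp add: C_def)
  have fpos: "1 \<le> f i" for i using threshold_pos[OF C0, of i] by (simp add: f_def)
  have fSuc: "f (Suc i) = C * (f i * f i)" for i by (simp add: f_def power2_eq_square)
  have fmono: "f i \<le> f i'" if "i \<le> i'" for i i' using threshold_mono[OF C0 that] by (simp add: f_def)
  have CB: "4 * real ((Suc M3 * l + 1) ^ l) < \<sigma> * \<rho> * C"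
  proof -
    have "B < C" unfolding C_def by linarith
    then have "B * (\<sigma> * \<rho>) < C * (\<sigma> * \<rho>)" using pos by (intro mult_strict_right_mono) auto
    then show ?thesis using pos by (simp add: B_def mult_ac)
  qed
  \<comment> \<open>Lower bounds for \<open>d\<close>: \<open>E1\<close> makes walks with
    repetitions rare, \<open>E2\<close> to \<open>E4\<close> give the three bounds
    \<open>Dlarge\<close>, \<open>E5\<close> makes conflicts between legs rare, and
    \<open>E6\<close> is the largeness condition of \<open>light_numerics\<close>.\<close>
  define E1 where "E1 = 8 * real l * l * K ^ l"
  define E2 where "E2 = real (M1 + 1) * l / \<rho>"
  define E3 where "E3 = real (M1 + 2) / \<sigma>"
  define E4 where "E4 = 2 * real T / \<sigma>"
  define E5 where "E5 = 8 * real N * l * K ^ l / c"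
  define E6 where "E6 = (A * K ^ l * (8 * real (f l)) ^ Suc t)\<^sup>2"
  define d0 where "d0 = E1 + E2 + E3 + E4 + E5 + E6 + 1"
  have Epos: "0 \<le> E1" "0 \<le> E2" "0 \<le> E3" "0 \<le> E4" "0 \<le> E5" "0 \<le> E6"
    using pos K0 c0 by (simp_all add: E1_def E2_def E3_def E4_def E5_def E6_def)
  have "\<exists>U\<subseteq>V. card U = t \<and> (\<forall>u\<in>U. \<forall>u'\<in>U. u \<noteq> u' \<longrightarrow> robust E M (2 * l) u u')"
    if nr: "near_regular V E d D" and DK: "D \<le> K * d" and dd0: "d0 \<le> d"
      and Vd: "card V powr (1 / l - \<delta>) \<le> d" for V :: "'a set" and E d D
  proof -
    interpret near_regular V E d D by (rule nr)
    have Ed: "E1 < d" "E2 < d" "E3 < d" "E4 < d" "E5 < d" "E6 < d"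
      using dd0 Epos unfolding d0_def by linarith+
    have cV: "1 \<le> real (card V)" using V_ne finV by (simp add: Suc_le_eq card_gt_0_iff)
    show ?thesis
    proof (cases "\<exists>j. 2 \<le> j \<and> j \<le> l \<and> c * card V * D ^ j \<le> card (heavy E f j)")
      case True
      then obtain j where j: "2 \<le> j" "j \<le> l" "c * card V * D ^ j \<le> card (heavy E f j)" by blast
      have DN: "8 * real N * l * K ^ l \<le> c * D"
      proof -
        have "E5 \<le> D" using Ed dD by linarith
        then show ?thesis using c0 by (simp add: E5_def divide_le_eq mult.commute)
      qed
      obtain z \<beta> Q where centre: "z \<in> V" "Q \<subseteq> E `` {z}" "(c / 8) ^ Suc N / K * D \<le> card Q"
        "\<And>a. a < N \<Longrightarrow> \<beta> a \<in> walks E (j - 1) z"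
        "\<And>a c. a < N \<Longrightarrow> c \<in> Q \<Longrightarrow> rev (\<beta> a) @ [c] \<in> heavy E f j"
        "\<And>a b g. a < N \<Longrightarrow> b < N \<Longrightarrow> a \<noteq> b \<Longrightarrow> 0 < g \<Longrightarrow> g < j \<Longrightarrow> \<beta> a ! g \<noteq> \<beta> b ! g"
        "\<And>a y g. a < N \<Longrightarrow> y \<in> Q \<Longrightarrow> g < j \<Longrightarrow> c / (2 * real l) * D ^ (j - 1 - g) \<le>
          card {\<gamma> \<in> walks E (j - 1) z. take (Suc g) \<gamma> = take (Suc g) (\<beta> a) \<and> rev \<gamma> @ [y] \<in> heavy E f j}"
        by (rule heavy_centre_exists[OF j(1,2) c0 j(3) DK K DN]) (rule that)
      define F where "F = f (j - 1)"
      have F1: "1 \<le> F" using fpos by (simp add: F_def)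
      have fj: "f j = C * (F * F)" using fSuc[of "j - 1"] j(1) by (simp add: F_def)
      have jS: "2 * j * l + 2 * j + 2 \<le> KK"
      proof -
        have "2 * j * l \<le> 2 * l * l" using j by (intro mult_right_mono) auto
        then show ?thesis using j(2) unfolding KK_def by linarith
      qed
      interpret hc: heavy_centre V E d D f j F N M0 M1 M3 l KK T T' z \<beta> Q \<rho> \<sigma>
      proof unfold_locales
        show "2 \<le> j" "z \<in> V" "Q \<subseteq> E `` {z}" using j centre by auto
        show "\<sigma> * D \<le> card Q" using centre(3) by (simp add: \<sigma>_def)
        show "0 < \<rho>" "0 < \<sigma>" "1 \<le> F" by (fact pos F1)+
        show "\<And>a. a < N \<Longrightarrow> \<beta> a \<in> walks E (j - 1) z" by (fact centre)
        show "\<And>a c. a < N \<Longrightarrow> c \<in> Q \<Longrightarrow> rev (\<beta> a) @ [c] \<in> heavy E f j" by (fact centre)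
        show "\<And>a b g. a < N \<Longrightarrow> b < N \<Longrightarrow> a \<noteq> b \<Longrightarrow> 0 < g \<Longrightarrow> g < j \<Longrightarrow> \<beta> a ! g \<noteq> \<beta> b ! g"
          by (fact centre)
        show "\<And>a y g. a < N \<Longrightarrow> y \<in> Q \<Longrightarrow> g < j \<Longrightarrow> \<rho> * D ^ (j - 1 - g) \<le>
          card {\<gamma> \<in> walks E (j - 1) z. take (Suc g) \<gamma> = take (Suc g) (\<beta> a) \<and> rev \<gamma> @ [y] \<in> heavy E f j}"
          unfolding \<rho>_def by (fact centre)
        show "\<And>i. i < j \<Longrightarrow> f i \<le> F" unfolding F_def by (intro fmono) simp
        have "M0 * j \<le> M0 * l" using j by simp
        then have "M0 * j \<le> C" unfolding C_def by linarith
        then have "(M0 * j) * (F * F) \<le> C * (F * F)" by (intro mult_right_mono) auto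
        then show "M0 * j * F * F \<le> f j" by (simp add: fj mult_ac)
        have "2 * T * j \<le> 2 * T * l" using j by simp
        then have "2 * T * j \<le> C" unfolding C_def by linarith
        then have "(2 * T * j) * (F * F) \<le> C * (F * F)" by (intro mult_right_mono) auto
        then show "2 * T * j * F * F \<le> f j" by (simp add: fj mult_ac)
        show "4 * real ((Suc M3 * j + 1) ^ j) * real F < \<sigma> * \<rho> * real (f j)"
        proof -
          have "Suc M3 * j + 1 \<le> Suc M3 * l + 1" using j(2) by (intro add_mono mult_le_mono) auto
          then have "(Suc M3 * j + 1) ^ j \<le> (Suc M3 * l + 1) ^ j" by (rule power_mono) simp
          also have "\<dots> \<le> (Suc M3 * l + 1) ^ l" using j by (intro power_increasing) auto
          finally have "real ((Suc M3 * j + 1) ^ j) \<le> real ((Suc M3 * l + 1) ^ l)" by (simp only: of_nat_le_iff)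
          then have "4 * real ((Suc M3 * j + 1) ^ j) < \<sigma> * \<rho> * C" using CB by linarith
          then have "4 * real ((Suc M3 * j + 1) ^ j) * F < \<sigma> * \<rho> * C * F"
            using F1 by (intro mult_strict_right_mono) auto
          also have "\<dots> \<le> \<sigma> * \<rho> * C * (F * F)"
            using pos F1 by (intro mult_left_mono) auto
          finally show ?thesis by (simp add: fj mult_ac)
        qed
        show "M1 + 2 * j + 2 \<le> M0" using j by (simp add: M0_def)
        show "M3 + j + 1 + l * KK \<le> M1" using j by (simp add: M1_def)
        show "2 * j * l + 2 * j + 2 \<le> KK" by (fact jS)
        show "M1 + 1 < N" by (simp add: N_def)
        have E: "E2 < D" "E3 < D" "E4 < D" using Ed dD by linarith+
        have "real (M1 + 1) * j \<le> real (M1 + 1) * l" using j by (intro mult_left_mono) auto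
        also have "\<dots> < \<rho> * D" using E(1) pos by (simp add: E2_def divide_less_eq mult.commute)
        finally show "real (M1 + 1) * j < \<rho> * D" .
        show "real (M1 + 2) < \<sigma> * D" using E(2) pos by (simp add: E3_def divide_less_eq mult.commute)
        show "2 * real T \<le> \<sigma> * D" using E(3) pos by (simp add: E4_def divide_less_eq mult.commute)
        show "j * T' \<le> T" using j by (simp add: T_def)
        show "real T' < real M1" unfolding of_nat_less_iff M1_def by simp
      qed
      have "M + 2 * j * l + 2 * j + 2 \<le> M3"
      proof -
        have "2 * j * l \<le> 2 * l * l" using j by (intro mult_right_mono) auto
        then show ?thesis using j(2) unfolding M3_def by linarith
      qed
      then show ?thesis
        by (intro hc.robust_clique_heavy[where t = t]) (use j in \<open>auto simp: T'_def N_def\<close>)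
    next
      case False
      have "card V * (d ^ l - real l * l * D ^ (l - 1) - real (Suc l) * real (Suc l) * c * D ^ l) \<le>
        card {p \<in> all_walks l. p \<in> light E f l}"
      proof (rule many_light_paths)
        show "card (heavy E f j) \<le> c * card V * D ^ j" if "2 \<le> j" "j \<le> l" for j
          using False that linear by blast
      qed (use fpos c0 in auto)
      moreover have "real l * l * D ^ (l - 1) \<le> d ^ l / 8"
      proof -
        have "real l * l * D ^ (l - 1) \<le> real l * l * (K * d) ^ (l - 1)"
          using D1 DK by (intro mult_left_mono power_mono) auto
        also have "\<dots> \<le> real l * l * (K ^ l * d ^ (l - 1))"
          unfolding power_mult_distrib using K d1
          by (intro mult_left_mono mult_right_mono power_increasing) auto
        also have "\<dots> = E1 * d ^ (l - 1) / 8" by (simp add: E1_def)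
        also have "\<dots> \<le> d * d ^ (l - 1) / 8"
          using Ed(1) d1 by (intro divide_right_mono mult_right_mono) auto
        also have "d * d ^ (l - 1) = d ^ l" using l by (cases l) auto
        finally show ?thesis .
      qed
      moreover have "real (Suc l) * real (Suc l) * c * D ^ l \<le> d ^ l / 8"
      proof -
        have "real (Suc l) * real (Suc l) * c * D ^ l \<le> real (Suc l) * real (Suc l) * c * (K * d) ^ l"
          using D1 DK c0 by (intro mult_left_mono power_mono) auto
        also have "\<dots> = (real (Suc l) * real (Suc l) * c * K ^ l) * d ^ l"
          by (simp add: power_mult_distrib)
        also have "real (Suc l) * real (Suc l) * c * K ^ l = 1 / 8"
        proof -
          have "real (Suc l) \<noteq> 0" "K ^ l \<noteq> 0" using K0 by auto
          then show ?thesis by (simp add: c_def del: of_nat_Suc)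
        qed
        finally show ?thesis by simp
      qed
      moreover have "0 \<le> d ^ l" using d1 by simp
      ultimately have "card V * (d ^ l / 2) \<le> card {p \<in> all_walks l. p \<in> light E f l}"
        using mult_left_mono[of "d ^ l / 2" "d ^ l - real l * l * D ^ (l - 1) - real (Suc l) * real (Suc l) * c * D ^ l" "card V"]
        by linarith
      then have many: "card V * d ^ l / 2 \<le> card {p \<in> all_walks l. p \<in> light E f l}" by simp
      define \<mu> where "\<mu> = d ^ l / (2 * real (f l) * card V)"
      have \<mu>0: "0 \<le> \<mu>" using d1 by (simp add: \<mu>_def)
      have A0: "0 \<le> A" by (simp add: A_def)
      have f8: "1 \<le> 8 * real (f l)" using fpos[of l] by (simp add: Suc_le_eq)
      \<comment> \<open>The constant 8 combines the 2 in the definition of \<open>\<mu>\<close> with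
        the 4 from \<open>dense_common_neighbours\<close>.\<close>
      have "A * D ^ (l - 1) < (d ^ l / ((8 * real (f l)) * card V)) ^ Suc t * card V"
        using l cV d1 \<delta> Vd D1 DK K f8 A0 Ed(6)
        by (intro light_numerics[where K = K and \<delta> = \<delta>]) (auto simp: E6_def)
      also have "d ^ l / ((8 * real (f l)) * card V) = \<mu> / 4" by (simp add: \<mu>_def)
      finally have key: "A * D ^ (l - 1) < (\<mu> / 4) ^ Suc t * card V" .
      have Dl: "0 \<le> D ^ (l - 1)" using D1 by simp
      show ?thesis
      proof (rule robust_clique_light[OF l _ many \<mu>_def])
        show "1 \<le> f l" by (rule fpos)
        have "real M * real (Suc l) \<le> A" by (simp add: A_def)
        then have "real M * real (Suc l) * D ^ (l - 1) \<le> A * D ^ (l - 1)" using Dl by (intro mult_right_mono)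
        then show "real M * (real (Suc l) * D ^ (l - 1)) < (\<mu> / 4) ^ Suc t * card V"
          using key by (simp only: mult.assoc)
        \<comment> \<open>Now \<open>(\<mu> / 4) ^ Suc t\<close> is at most
          \<open>\<mu> / 4\<close>, so \<open>key\<close> also yields the condition on the number of
          conflicts.\<close>
        assume "\<mu> \<le> 1"
        then have "(\<mu> / 4) ^ Suc t \<le> \<mu> / 4"
          using \<mu>0 power_decreasing[of 1 "Suc t" "\<mu> / 4"] by simp
        then have "(\<mu> / 4) ^ Suc t * card V \<le> \<mu> / 4 * card V" by (intro mult_right_mono) auto
        moreover have "real t * (real l * l) * D ^ (l - 1) \<le> A * D ^ (l - 1)"
          using Dl by (intro mult_right_mono) (simp_all add: A_def)
        ultimately show "real t * (real l * l * D ^ (l - 1)) \<le> \<mu> / 4 * card V"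
          using key by (simp only: mult.assoc)
      qed
    qed
  qed
  then show ?thesis by blast
qed

section \<open>Passing to an almost regular subgraph\<close>

text \<open>Deleting an element of least value never lowers the average. The inequality compares the
  averages over \<open>T\<close> and \<open>U\<close> with denominators cleared.\<close>

lemma heavy_subset_exists:
  fixes f :: "'a \<Rightarrow> real"
  assumes fin: "finite U" and q: "q \<le> card U"
  shows "\<exists>T\<subseteq>U. card T = q \<and> q * sum f U \<le> card U * sum f T"
  using q
proof (induction q rule: inc_induct)
  case base
  then show ?case using fin by blast
next
  case (step q)
  then obtain T where T: "T \<subseteq> U" "card T = Suc q" "real (Suc q) * sum f U \<le> card U * sum f T" by blast
  have finT: "finite T" "T \<noteq> {}" using T fin finite_subset by auto
  define x where "x = arg_min_on f T"
  have x: "x \<in> T" "\<And>y. y \<in> T \<Longrightarrow> f x \<le> f y"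
    using arg_min_if_finite[OF finT, of f] finT arg_min_least[OF finT, of _ f] by (auto simp: x_def)
  have "real (Suc q) * f x \<le> sum f T" using sum_bounded_below[of T "f x" f] x T by simp
  moreover have "sum f (T - {x}) = sum f T - f x" using finT x by (simp add: sum_diff1)
  moreover have "real (Suc q) * (sum f T - f x) = real q * sum f T + (sum f T - real (Suc q) * f x)"
    by (simp add: algebra_simps)
  ultimately have "real q * sum f T \<le> real (Suc q) * sum f (T - {x})" by simp
  then have *: "card U * (real q * sum f T) \<le> card U * (real (Suc q) * sum f (T - {x}))"
    by (intro mult_left_mono) auto
  have "real (Suc q) * (real q * sum f U) = real q * (real (Suc q) * sum f U)" by (simp only: mult_ac)
  also have "\<dots> \<le> real q * (card U * sum f T)" using T(3) by (intro mult_left_mono) auto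
  also have "\<dots> = card U * (real q * sum f T)" by (simp only: mult_ac)
  also note *
  also have "card U * (real (Suc q) * sum f (T - {x})) = real (Suc q) * (card U * sum f (T - {x}))"
    by (simp only: mult_ac)
  finally have "real (Suc q) * (real q * sum f U) \<le> real (Suc q) * (card U * sum f (T - {x}))" .
  then have "real q * sum f U \<le> card U * sum f (T - {x})" by (simp only: mult_le_cancel_left_pos of_nat_0_less_iff zero_less_Suc)
  then show ?case using T x finT by (intro exI[of _ "T - {x}"]) auto
qed

context finite_arcs
begin

text \<open>Ordered pairs are counted, so each edge inside \<open>S\<close> contributes 2.\<close>

definition ends_in :: "'a set \<Rightarrow> nat" where
  "ends_in S = card (E \<inter> S \<times> S)"

definition deg_in :: "'a set \<Rightarrow> 'a \<Rightarrow> nat" where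
  "deg_in S v = card {y \<in> S. (v, y) \<in> E}"

lemma finite_E: "finite E"
  using finV EV finite_subset by blast

lemma card_arcs_between: "finite S \<Longrightarrow> finite T \<Longrightarrow> card (E \<inter> S \<times> T) = (\<Sum>v\<in>S. card {y \<in> T. (v, y) \<in> E})"
proof -
  assume fin: "finite S" "finite T"
  have "E \<inter> S \<times> T = (SIGMA v:S. {y \<in> T. (v, y) \<in> E})" by auto
  then show ?thesis using fin by simp
qed

lemma card_arcs_swap: "card (E \<inter> S \<times> T) = card (E \<inter> T \<times> S)"
proof -
  have "E \<inter> T \<times> S = (E \<inter> S \<times> T)\<inverse>"
    using symE by (auto simp: sym_def)
  then show ?thesis by simp
qed

text \<open>A lost pair has its first or its second entry in \<open>T\<close>, and by symmetry both
  kinds are equally numerous.\<close>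

lemma ends_in_Diff: "ends_in S \<le> ends_in (S - T) + 2 * card (E \<inter> T \<times> S)"
proof -
  have "E \<inter> S \<times> S \<subseteq> (E \<inter> (S - T) \<times> (S - T)) \<union> (E \<inter> T \<times> S) \<union> (E \<inter> S \<times> T)" by auto
  then have "ends_in S \<le> card ((E \<inter> (S - T) \<times> (S - T)) \<union> (E \<inter> T \<times> S) \<union> (E \<inter> S \<times> T))"
    unfolding ends_in_def using finite_E by (intro card_mono) auto
  also have "\<dots> \<le> card ((E \<inter> (S - T) \<times> (S - T)) \<union> (E \<inter> T \<times> S)) + card (E \<inter> S \<times> T)" by (rule card_Un_le)
  also have "\<dots> \<le> ends_in (S - T) + card (E \<inter> T \<times> S) + card (E \<inter> T \<times> S)"
    unfolding ends_in_def using card_Un_le card_arcs_swap[of S T] by (intro add_mono) auto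
  finally show ?thesis by simp
qed

lemma ends_in_remove: "ends_in S \<le> ends_in (S - {v}) + 2 * deg_in S v"
proof -
  have "E \<inter> {v} \<times> S = Pair v ` {y \<in> S. (v, y) \<in> E}" by auto
  then have "card (E \<inter> {v} \<times> S) = deg_in S v" by (simp add: deg_in_def card_image inj_on_def)
  then show ?thesis using ends_in_Diff[of S "{v}"] by simp
qed

text \<open>In a minimal set \<open>U\<close> of density at least \<open>C\<close> all smaller sets are sparse. If the set \<open>S\<close> of
  vertices of large degree met many edges, then \<open>S\<close> together with equally many vertices that have
  the most neighbours in \<open>S\<close> would not be sparse. So \<open>S\<close> can be deleted, and maximising
  \<open>ends_in W - \<eta> * card W\<close> restores the minimum degree.\<close>

lemma near_regular_subset_exists:
  fixes \<alpha> C K :: real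
  assumes \<alpha>: "0 < \<alpha>" "\<alpha> \<le> 1" and C: "8 \<le> C" and V: "V \<noteq> {}"
    and many: "C * card V powr (1 + \<alpha>) \<le> card E"
    and K: "K = 4 * 16 powr (1 / \<alpha>)"
  shows "\<exists>W d. W \<subseteq> V \<and> near_regular W (E \<inter> W \<times> W) d (8 * K * d) \<and> C / 8 * card W powr \<alpha> \<le> d \<and> C / 8 \<le> d"
proof -
  define good where "good U \<longleftrightarrow> U \<subseteq> V \<and> U \<noteq> {} \<and> C * card U powr (1 + \<alpha>) \<le> ends_in U" for U
  have "E \<inter> V \<times> V = E" using EV by auto
  then have "good V" using V many by (simp add: good_def ends_in_def)
  then obtain U where U: "good U" "\<And>U'. good U' \<Longrightarrow> card U \<le> card U'"
    using ex_has_least_nat[of good V card] by blast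
  define m where "m = card U"
  define mr where "mr = real m"
  have UV: "U \<subseteq> V" "U \<noteq> {}" "C * mr powr (1 + \<alpha>) \<le> ends_in U"
    using U(1) by (simp_all add: good_def m_def mr_def)
  have finU: "finite U" using UV finV finite_subset by blast
  have m1: "1 \<le> mr" using UV finU by (simp add: m_def mr_def Suc_le_eq card_gt_0_iff)
  have mpow: "mr powr (1 + \<alpha>) = mr * mr powr \<alpha>" using m1 by (simp add: powr_add)
  have ma1: "1 \<le> mr powr \<alpha>" using m1 \<alpha> by (simp add: ge_one_powr_ge_zero)
  have sparse: "ends_in S \<le> C * card S powr (1 + \<alpha>)" if "S \<subseteq> U" "card S < m" for S
  proof (cases "S = {}")
    case True
    then show ?thesis by (simp add: ends_in_def)
  next
    case False
    then have "\<not> good S" using U(2)[of S] that by (auto simp: m_def)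
    then show ?thesis using False that UV by (auto simp: good_def)
  qed
  \<comment> \<open>Only \<open>mr * mr\<close> ordered pairs fit into \<open>U\<close>, while the
    density demands at least \<open>C * mr\<close>.\<close>
  have m8: "8 \<le> mr"
  proof -
    have "ends_in U \<le> card (U \<times> U)" unfolding ends_in_def using finU by (intro card_mono) auto
    then have "real (ends_in U) \<le> mr * mr"
      unfolding mr_def m_def by (simp only: card_cartesian_product flip: of_nat_mult of_nat_le_iff)
    then have "C * (mr * mr powr \<alpha>) \<le> mr * mr" using UV(3) mpow by simp
    moreover have "C * (mr * 1) \<le> C * (mr * mr powr \<alpha>)" using C m1 ma1 by (intro mult_left_mono) auto
    ultimately have "mr * C \<le> mr * mr" by (simp add: mult_ac)
    then show ?thesis using C m1 by simp
  qed
  have deg_sum: "real (ends_in U) = (\<Sum>v\<in>U. real (deg_in U v))"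
    using card_arcs_between[OF finU finU] by (simp add: ends_in_def deg_in_def)
  \<comment> \<open>By minimality \<open>U\<close> is not much denser than required: deleting a
    vertex of least degree loses at most a quarter of the pairs, as \<open>mr \<ge> 8\<close>, and
    leaves a sparse set.\<close>
  have upper: "ends_in U \<le> 2 * C * (mr * mr powr \<alpha>)"
  proof -
    define v where "v = arg_min_on (deg_in U) U"
    have v: "v \<in> U" "\<And>y. y \<in> U \<Longrightarrow> deg_in U v \<le> deg_in U y"
      using arg_min_if_finite[OF finU UV(2), of "deg_in U"] arg_min_least[OF finU UV(2), of _ "deg_in U"]
      by (auto simp: v_def)
    have "mr * deg_in U v \<le> ends_in U"
      unfolding deg_sum mr_def m_def using sum_bounded_below[of U "real (deg_in U v)" "\<lambda>y. real (deg_in U y)"] v by simp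
    then have "8 * real (deg_in U v) \<le> ends_in U"
      using m8 mult_right_mono[of 8 mr "real (deg_in U v)"] by linarith
    moreover have "real (ends_in U) \<le> real (ends_in (U - {v})) + 2 * real (deg_in U v)"
      using ends_in_remove[of U v] by (simp flip: of_nat_add of_nat_mult of_nat_le_iff)
    moreover have "ends_in (U - {v}) \<le> C * card (U - {v}) powr (1 + \<alpha>)"
      using card_Diff1_less[OF finU v(1)] by (intro sparse) (auto simp: m_def)
    moreover have "C * card (U - {v}) powr (1 + \<alpha>) \<le> C * mr powr (1 + \<alpha>)"
      using C \<alpha> finU unfolding mr_def m_def by (intro mult_left_mono powr_mono2) (auto intro: card_Diff1_le)
    moreover have "C * mr powr (1 + \<alpha>) = C * (mr * mr powr \<alpha>)" "0 \<le> C * (mr * mr powr \<alpha>)"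
      using mpow C m1 by simp_all
    ultimately show ?thesis by linarith
  qed
  define S where "S = {v \<in> U. K * C * mr powr \<alpha> < deg_in U v}"
  have SU: "S \<subseteq> U" and finS: "finite S" using finU by (auto simp: S_def)
  have "(16::real) powr 1 \<le> 16 powr (1 / \<alpha>)" using \<alpha> by (intro powr_mono) (auto simp: field_simps)
  then have K64: "64 \<le> K" by (simp add: K)
  have KC: "0 < C * mr powr \<alpha>" using C ma1 by (intro mult_pos_pos) linarith+
  have "K * real (card S) \<le> 2 * mr"
  proof -
    have "real (card S) * (K * C * mr powr \<alpha>) \<le> (\<Sum>v\<in>S. real (deg_in U v))"
      using sum_bounded_below[of S "K * C * mr powr \<alpha>" "\<lambda>v. real (deg_in U v)"] by (simp add: S_def less_imp_le)
    also have "\<dots> \<le> ends_in U" unfolding deg_sum using finU SU by (intro sum_mono2) auto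
    finally have "(C * mr powr \<alpha>) * (K * real (card S)) \<le> (C * mr powr \<alpha>) * (2 * mr)"
      using upper by (simp add: mult_ac)
    then show ?thesis using KC by (simp only: mult_le_cancel_left_pos)
  qed
  \<comment> \<open>The second bound makes \<open>S \<union> T\<close> below smaller than
    \<open>U\<close>, so that \<open>sparse\<close> applies. The first one meets the choice of
    \<open>K\<close>, for which \<open>(4 * mr / K) powr \<alpha>\<close> is a sixteenth of
    \<open>mr powr \<alpha>\<close>.\<close>
  then have cS: "2 * real (card S) \<le> 4 * mr / K" "2 * real (card S) \<le> mr / 16"
    using K64 m1 mult_right_mono[OF K64, of "real (card S)"] by (simp_all add: field_simps)
  define e where "e = card (E \<inter> S \<times> U)"
  have e: "real e \<le> C * (mr * mr powr \<alpha>) / 8"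
  proof (cases "S = {}")
    case True
    then show ?thesis using C m1 by (simp add: e_def)
  next
    case False
    then have S1: "0 < real (card S)" using finS by (simp add: card_gt_0_iff)
    have "card S \<le> card U" using finU SU by (rule card_mono)
    then obtain T where T: "T \<subseteq> U" "card T = card S"
      "card S * (\<Sum>v\<in>U. real (card {y \<in> S. (v, y) \<in> E})) \<le> card U * (\<Sum>v\<in>T. real (card {y \<in> S. (v, y) \<in> E}))"
      using heavy_subset_exists[OF finU, of "card S" "\<lambda>v. real (card {y \<in> S. (v, y) \<in> E})"] by blast
    have finT: "finite T" using T finU finite_subset by blast
    have "card S * real e \<le> mr * card (E \<inter> T \<times> S)"
      using T(3) card_arcs_between[OF finU finS] card_arcs_between[OF finT finS] card_arcs_swap[of S U]
      by (simp add: e_def mr_def m_def)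
    moreover have "real (card (E \<inter> T \<times> S)) \<le> real (ends_in (S \<union> T))"
      unfolding ends_in_def using finite_E by (intro of_nat_mono card_mono) auto
    moreover have "ends_in (S \<union> T) \<le> C * (2 * real (card S)) powr (1 + \<alpha>)"
    proof -
      have c: "card (S \<union> T) \<le> 2 * card S" using card_Un_le[of S T] T by simp
      then have "real (card (S \<union> T)) \<le> 2 * real (card S)" by linarith
      moreover from this have "real (card (S \<union> T)) < mr" using cS(2) m1 by linarith
      then have "card (S \<union> T) < m" by (simp add: mr_def)
      then have "ends_in (S \<union> T) \<le> C * card (S \<union> T) powr (1 + \<alpha>)" using SU T by (intro sparse) auto
      moreover have "C * card (S \<union> T) powr (1 + \<alpha>) \<le> C * (2 * real (card S)) powr (1 + \<alpha>)"
        using calculation(1) C \<alpha> by (intro mult_left_mono powr_mono2) auto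
      ultimately show ?thesis by linarith
    qed
    ultimately have "card S * real e \<le> mr * card (E \<inter> T \<times> S)"
      "real (card (E \<inter> T \<times> S)) \<le> C * (2 * real (card S)) powr (1 + \<alpha>)" by linarith+
    moreover from this(2) have "mr * card (E \<inter> T \<times> S) \<le> mr * (C * (2 * real (card S)) powr (1 + \<alpha>))"
      using m1 by (intro mult_left_mono) auto
    ultimately have "card S * real e \<le> mr * (C * (2 * real (card S)) powr (1 + \<alpha>))" by linarith
    also have "(2 * real (card S)) powr (1 + \<alpha>) = 2 * real (card S) * (2 * real (card S)) powr \<alpha>"
      using S1 by (simp add: powr_add)
    finally have "card S * real e \<le> card S * (2 * mr * C * (2 * real (card S)) powr \<alpha>)" by (simp add: mult_ac)
    then have "real e \<le> 2 * mr * C * (2 * real (card S)) powr \<alpha>" using S1 by (simp only: mult_le_cancel_left_pos)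
    also have "\<dots> \<le> 2 * mr * C * (4 * mr / K) powr \<alpha>"
      using cS(1) m1 C \<alpha> by (intro mult_left_mono powr_mono2) auto
    also have "(4 * mr / K) powr \<alpha> = mr powr \<alpha> / 16"
    proof -
      have "4 * mr / K = mr / 16 powr (1 / \<alpha>)" by (simp add: K)
      then have "(4 * mr / K) powr \<alpha> = mr powr \<alpha> / (16 powr (1 / \<alpha>)) powr \<alpha>"
        using m1 by (simp add: powr_divide)
      also have "(16 powr (1 / \<alpha>)) powr \<alpha> = (16::real)" using \<alpha> by (simp add: powr_powr)
      finally show ?thesis .
    qed
    finally show ?thesis by (simp add: mult_ac)
  qed
  define U2 where "U2 = U - S"
  have U2: "3 / 4 * (C * (mr * mr powr \<alpha>)) \<le> ends_in U2"
  proof -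
    have "real (ends_in U) \<le> real (ends_in U2) + 2 * real e"
      using ends_in_Diff[of U S] unfolding U2_def e_def by linarith
    moreover have "C * mr powr (1 + \<alpha>) = C * (mr * mr powr \<alpha>)" using mpow by simp
    ultimately show ?thesis using UV(3) e by linarith
  qed
  \<comment> \<open>\<open>\<eta> * mr\<close> is a third of the number of pairs guaranteed in
    \<open>U2\<close>, so the maximum of \<open>h\<close> is positive and is not attained at the
    empty set.\<close>
  define \<eta> where "\<eta> = C / 4 * mr powr \<alpha>"
  define h where "h W = real (ends_in W) - \<eta> * card W" for W
  have finP: "finite (Pow U2)" "Pow U2 \<noteq> {}" using finU by (auto simp: U2_def)
  obtain W where W: "W \<subseteq> U2" "\<And>W'. W' \<subseteq> U2 \<Longrightarrow> h W' \<le> h W"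
  proof -
    have "Max (h ` Pow U2) \<in> h ` Pow U2" using finP by (intro Max_in) auto
    then obtain W where W: "W \<in> Pow U2" "h W = Max (h ` Pow U2)" by auto
    moreover have "h W' \<le> Max (h ` Pow U2)" if "W' \<subseteq> U2" for W' using finP that by (intro Max_ge) auto
    ultimately show ?thesis using that by auto
  qed
  have finW: "finite W" using W finU unfolding U2_def by (meson finite_Diff finite_subset)
  have WV: "W \<subseteq> V" using W UV by (auto simp: U2_def)
  have "real (card U2) \<le> mr" unfolding mr_def m_def U2_def using finU by (simp add: card_mono)
  then have "\<eta> * card U2 \<le> \<eta> * mr" using C by (intro mult_left_mono) (auto simp: \<eta>_def)
  also have "\<eta> * mr = C * (mr * mr powr \<alpha>) / 4" by (simp add: \<eta>_def)
  finally have "C * (mr * mr powr \<alpha>) / 2 \<le> h U2" using U2 by (simp add: h_def)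
  moreover have "0 < C * (mr * mr powr \<alpha>)" using C m1 by simp
  ultimately have "0 < h W" using W(2)[OF order_refl] by linarith
  then have Wne: "W \<noteq> {}" by (auto simp: h_def ends_in_def)
  \<comment> \<open>Removing \<open>v\<close> lowers the penalty by \<open>\<eta>\<close> and loses
    at most twice its degree, so maximality forces the degree up.\<close>
  have deg_lo: "\<eta> / 2 \<le> deg_in W v" if v: "v \<in> W" for v
  proof -
    have "h (W - {v}) \<le> h W" using W by (intro W(2)) auto
    moreover have "0 < card W" using v finW card_gt_0_iff by blast
    then have "real (card W) = real (card (W - {v})) + 1" using v finW by simp
    then have "\<eta> * card W = \<eta> * card (W - {v}) + \<eta>" by (simp add: algebra_simps)
    ultimately have "real (ends_in (W - {v})) + \<eta> \<le> ends_in W" unfolding h_def by linarith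
    moreover have "real (ends_in W) \<le> real (ends_in (W - {v})) + 2 * real (deg_in W v)"
      using ends_in_remove[of W v] by linarith
    ultimately show ?thesis by linarith
  qed
  \<comment> \<open>Vertices of larger degree were deleted with \<open>S\<close>, and
    \<open>K * C * mr powr \<alpha>\<close> equals \<open>8 * K * (\<eta> / 2)\<close>.\<close>
  have deg_hi: "deg_in W v \<le> 8 * K * (\<eta> / 2)" if v: "v \<in> W" for v
  proof -
    have "v \<in> U" "v \<notin> S" using v W by (auto simp: U2_def)
    then have "real (deg_in U v) \<le> K * C * mr powr \<alpha>" by (simp add: S_def not_less)
    moreover have "deg_in W v \<le> deg_in U v"
      unfolding deg_in_def using W finU by (intro card_mono) (auto simp: U2_def)
    ultimately show ?thesis by (simp add: \<eta>_def)
  qed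
  have nb: "(E \<inter> W \<times> W) `` {x} = {y \<in> W. (x, y) \<in> E}" if "x \<in> W" for x using that by auto
  have \<eta>: "C / 8 * mr powr \<alpha> = \<eta> / 2" by (simp add: \<eta>_def)
  have "C / 8 * 1 \<le> C / 8 * mr powr \<alpha>" using C ma1 by (intro mult_left_mono) auto
  then have C8: "C / 8 \<le> \<eta> / 2" using \<eta> by simp
  have "real (card W) \<le> mr"
    unfolding mr_def m_def using W(1) finU by (intro of_nat_mono card_mono) (auto simp: U2_def)
  then have "C / 8 * card W powr \<alpha> \<le> C / 8 * mr powr \<alpha>"
    using C \<alpha> by (intro mult_left_mono powr_mono2) auto
  then have Wl: "C / 8 * card W powr \<alpha> \<le> \<eta> / 2" using \<eta> by simp
  have "near_regular W (E \<inter> W \<times> W) (\<eta> / 2) (8 * K * (\<eta> / 2))"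
  proof
    show "finite W" "W \<noteq> {}" "E \<inter> W \<times> W \<subseteq> W \<times> W" by (use finW Wne in auto)
    show "sym (E \<inter> W \<times> W)" using symE by (auto simp: sym_def)
    show "irrefl (E \<inter> W \<times> W)" using irrE by (auto simp: irrefl_def)
    show "1 \<le> \<eta> / 2" using C8 C by linarith
    then show "\<eta> / 2 \<le> 8 * K * (\<eta> / 2)" using K64 mult_right_mono[of 1 "8 * K" "\<eta> / 2"] by simp
    show "\<eta> / 2 \<le> card ((E \<inter> W \<times> W) `` {x})" if "x \<in> W" for x
      using deg_lo[OF that] nb[OF that] by (simp add: deg_in_def)
    show "card ((E \<inter> W \<times> W) `` {x}) \<le> 8 * K * (\<eta> / 2)" if "x \<in> W" for x
      using deg_hi[OF that] nb[OF that] by (simp add: deg_in_def)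
  qed
  then show ?thesis using WV Wl C8 by blast
qed

end

section \<open>The extremal number\<close>

lemma robust_arcs_mono: "robust E' M n x y \<Longrightarrow> E' \<subseteq> E \<Longrightarrow> robust E M n x y"
proof -
  assume r: "robust E' M n x y" and "E' \<subseteq> E"
  then have "joining (paths E') n x y \<subseteq> joining (paths E) n x y"
    by (intro joining_mono) (auto simp: paths_def walk_def)
  then show "robust E M n x y" using r unfolding robust_def by blast
qed

lemma finite_arcs_graph:
  assumes "simple_graph G"
  shows "finite_arcs (verts G) (arcs G)"
proof
  show "finite (verts G)" using assms by (simp add: simple_graph_def)
  show "arcs G \<subseteq> verts G \<times> verts G" using assms by (auto simp: simple_graph_def arcs_def)
  show "sym (arcs G)" by (auto simp: sym_def arcs_def insert_commute)
  show "irrefl (arcs G)" using assms by (fastforce simp: irrefl_def arcs_def simple_graph_def)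
qed

lemma card_edges_le_arcs:
  assumes "simple_graph G"
  shows "card (edges G) \<le> card (arcs G)"
proof -
  interpret finite_arcs "verts G" "arcs G" by (rule finite_arcs_graph[OF assms])
  have "edges G \<subseteq> (\<lambda>(x, y). {x, y}) ` arcs G"
  proof
    fix e assume e: "e \<in> edges G"
    then obtain x y where "e = {x, y}" using assms by (auto simp: simple_graph_def card_2_iff)
    then show "e \<in> (\<lambda>(x, y). {x, y}) ` arcs G"
      using e by (intro image_eqI[of _ _ "(x, y)"]) (auto simp: arcs_def)
  qed
  then show ?thesis by (rule surj_card_le[OF finite_E])
qed

text \<open>An almost regular part of large degree contains \<open>card (verts H)\<close> pairwise
  robustly connected vertices; \<open>M\<close> is the number of obstacles that the linkage may have
  to avoid.\<close>

lemma dense_graph_contains_subdivision: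
  fixes l :: nat and H :: "'b graph"
  assumes l: "0 < l" and H: "simple_graph H"
    and \<delta>: "\<delta> = 1 / (4 * real l * real l * (real (card (verts H)) + 1))"
  shows "\<exists>C::real. \<forall>G :: 'a graph. simple_graph G \<longrightarrow> verts G \<noteq> {} \<longrightarrow>
    C * card (verts G) powr (1 + (1 / l - \<delta>)) \<le> card (edges G) \<longrightarrow> contains_copy G (subdivision (2 * l - 1) H)"
proof -
  define \<alpha> where "\<alpha> = 1 / l - \<delta>"
  define K where "K = 4 * 16 powr (1 / \<alpha>)"
  define M where "M = card (verts H) + card (edges H) * Suc (2 * l)"
  have l1: "1 \<le> real l" using l by simp
  have "real l * 1 < real l * (4 * real l * (real (card (verts H)) + 1))"
  proof (rule mult_strict_left_mono)
    have "1 * 1 \<le> real l * (real (card (verts H)) + 1)" using l1 by (intro mult_mono) auto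
    then show "1 < 4 * real l * (real (card (verts H)) + 1)" by simp
  qed (use l1 in simp)
  then have "\<delta> < 1 / l" unfolding \<delta> using l1 by (intro divide_strict_left_mono) (auto simp: mult_ac)
  moreover have "0 < \<delta>" unfolding \<delta> using l1 by simp
  moreover have "1 / real l \<le> 1" using l1 by simp
  ultimately have \<alpha>: "0 < \<alpha>" "\<alpha> \<le> 1" by (simp_all add: \<alpha>_def)
  have "(16::real) powr 0 \<le> 16 powr (1 / \<alpha>)" using \<alpha> by (intro powr_mono) auto
  then have K1: "1 \<le> 8 * K" by (simp add: K_def)
  obtain d0 :: real where d0: "\<And>(V :: 'a set) E d D. near_regular V E d D \<Longrightarrow> D \<le> 8 * K * d \<Longrightarrow> d0 \<le> d \<Longrightarrow>
    card V powr \<alpha> \<le> d \<Longrightarrow>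
    \<exists>U\<subseteq>V. card U = card (verts H) \<and> (\<forall>u\<in>U. \<forall>u'\<in>U. u \<noteq> u' \<longrightarrow> robust E M (2 * l) u u')"
    using robust_clique_exists[OF l K1 \<delta>, where M = M] unfolding \<alpha>_def by blast
  \<comment> \<open>The factor 8 is lost in \<open>near_regular_subset_exists\<close>; the maximum
    secures both \<open>d0 \<le> d\<close> and \<open>card W powr \<alpha> \<le> d\<close>.\<close>
  define C where "C = 8 * max 1 d0"
  have C: "8 \<le> C" "d0 \<le> C / 8" "1 \<le> C / 8" by (simp_all add: C_def)
  have "contains_copy G (subdivision (2 * l - 1) H)"
    if G: "simple_graph G" "verts G \<noteq> {}" and many: "C * card (verts G) powr (1 + \<alpha>) \<le> card (edges G)"
    for G :: "'a graph"
  proof -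
    interpret finite_arcs "verts G" "arcs G" by (rule finite_arcs_graph[OF G(1)])
    have "C * card (verts G) powr (1 + \<alpha>) \<le> card (arcs G)"
      using many card_edges_le_arcs[OF G(1)] by linarith
    then obtain W d where W: "W \<subseteq> verts G" "near_regular W (arcs G \<inter> W \<times> W) d (8 * K * d)"
      "C / 8 * card W powr \<alpha> \<le> d" "C / 8 \<le> d"
      using near_regular_subset_exists[OF \<alpha> C(1) G(2) _ K_def] by blast
    have "1 * card W powr \<alpha> \<le> C / 8 * card W powr \<alpha>" using C(3) by (intro mult_right_mono) auto
    then have "card W powr \<alpha> \<le> d" using W(3) by linarith
    moreover have "d0 \<le> d" using W(4) C(2) by linarith
    ultimately obtain U where U: "U \<subseteq> W" "card U = card (verts H)"
      "\<And>u u'. u \<in> U \<Longrightarrow> u' \<in> U \<Longrightarrow> u \<noteq> u' \<Longrightarrow> robust (arcs G \<inter> W \<times> W) M (2 * l) u u'"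
      using d0[OF W(2) order_refl] by metis
    have "finite U" using U(1) W(1) finV by (meson finite_subset)
    moreover have "finite (verts H)" using H by (simp add: simple_graph_def)
    ultimately obtain \<phi> where \<phi>: "bij_betw \<phi> (verts H) U"
      using U(2) by (metis finite_same_card_bij)
    show ?thesis
    proof (rule contains_subdivision[OF H _ _ _ G(1), where \<phi> = \<phi> and M = M])
      show "0 < 2 * l" using l by simp
      show "inj_on \<phi> (verts H)" using \<phi> by (rule bij_betw_imp_inj_on)
      show "\<phi> ` verts H \<subseteq> verts G" using \<phi> U(1) W(1) by (auto simp: bij_betw_def)
      show "card (verts H) + card (edges H) * Suc (2 * l) \<le> M" by (simp add: M_def)
      fix x y assume xy: "x \<in> verts H" "y \<in> verts H" "x \<noteq> y"
      then have "\<phi> x \<in> U" "\<phi> y \<in> U" "\<phi> x \<noteq> \<phi> y"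
        using \<phi> by (auto simp: bij_betw_def dest: inj_onD)
      then show "robust (arcs G) M (2 * l) (\<phi> x) (\<phi> y)"
        using robust_arcs_mono[OF U(3)] by blast
    qed
  qed
  then show ?thesis unfolding \<alpha>_def by blast
qed

theorem theorem1p18:
  fixes k :: nat and H :: "'a graph"
  assumes "k \<ge> 2" and "even k" and "simple_graph H"
  shows "\<exists>\<delta>::real. \<delta> > 0 \<and>
    (\<lambda>n. real (ex n (subdivision (k - 1) H))) \<in> O(\<lambda>n. real n powr (1 + 2 / real k - \<delta>))"
proof -
  obtain l where k: "k = 2 * l" using assms(2) by blast
  have l: "0 < l" using assms(1) k by simp
  define \<delta> where "\<delta> = 1 / (4 * real l * real l * (real (card (verts H)) + 1))"
  have \<delta>0: "0 < \<delta>" using l by (simp add: \<delta>_def)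
  obtain C :: real where C: "\<And>G :: nat graph. simple_graph G \<Longrightarrow> verts G \<noteq> {} \<Longrightarrow>
    C * card (verts G) powr (1 + (1 / l - \<delta>)) \<le> card (edges G) \<Longrightarrow> contains_copy G (subdivision (2 * l - 1) H)"
    using dense_graph_contains_subdivision[OF l assms(3) \<delta>_def] by blast
  have bound: "real (ex n (subdivision (k - 1) H)) \<le> \<bar>C\<bar> * real n powr (1 + 2 / real k - \<delta>)" if n: "1 \<le> n" for n
  \<comment> \<open>The supremum of the empty set is 0. A nonempty set of sizes is finite, so some
    graph attains the supremum.\<close>
  proof (cases "F_free_sizes n (subdivision (k - 1) H) = {}")
    case True
    then show ?thesis by (simp add: ex_def)
  next
    case False
    then have "ex n (subdivision (k - 1) H) \<in> F_free_sizes n (subdivision (k - 1) H)"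
      using Max_in[OF finite_F_free_sizes False] by (simp add: ex_def Sup_nat_def)
    then obtain G :: "nat graph" where G: "simple_graph G" "card (verts G) = n"
      "\<not> contains_copy G (subdivision (k - 1) H)" "ex n (subdivision (k - 1) H) = card (edges G)"
      by (auto simp: F_free_sizes_def)
    have "verts G \<noteq> {}" using G(2) n by auto
    then have "card (edges G) < C * n powr (1 + (1 / l - \<delta>))"
      using C[OF G(1)] G(2,3) k by (meson not_le)
    also have "1 + (1 / l - \<delta>) = 1 + 2 / real k - \<delta>" using k by simp
    \<comment> \<open>The absolute value is taken because nothing is known here about the sign of
      \<open>C\<close>.\<close>
    also have "C * n powr (1 + 2 / real k - \<delta>) \<le> \<bar>C\<bar> * n powr (1 + 2 / real k - \<delta>)"
      by (intro mult_right_mono) auto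
    finally show ?thesis using G(4) by simp
  qed
  have "(\<lambda>n. real (ex n (subdivision (k - 1) H))) \<in> O(\<lambda>n. real n powr (1 + 2 / real k - \<delta>))"
  proof (rule bigoI[of _ "\<bar>C\<bar>"])
    show "\<forall>\<^sub>F n in sequentially. norm (real (ex n (subdivision (k - 1) H))) \<le>
      \<bar>C\<bar> * norm (real n powr (1 + 2 / real k - \<delta>))"
      using bound by (intro eventually_at_top_linorderI[of 1]) simp
  qed
  then show ?thesis using \<delta>0 by blast
qed

end
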